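(* Let $k\in\{0,1,2,\dots\}$. For every $g\in SL_2(\Gamma_n)$ and every $f\in C^\infty_c(E^n,\Sigma)$, \[D^{2k+1}\big(\pi'_{-k-\frac12}(g)f\big)=\pi'_{k+\frac12}(g)\big(D^{2k+1}f\big)\] on the dense open set of $x\in E^n$ where $d^*-b^*x\neq0$ (with $g=\begin{pmatrix} a&b\\ c&d\end{pmatrix}$).
   Context: Let $n\ge 2$, let $E^n=\mathbb R^n$ with orthonormal basis $e_1,\dots,e_n$, coordinates $x=(x_1,\dots,x_n)$, and $E^{n-1}=\mathrm{span}(e_2,\dots,e_n)$. Let $Cl_{n-1}$ be the real Clifford algebra generated by $E^{n-1}$ with relations $uv+vu=-2(u,v)$; identify $E^n$ with $\mathbb R\oplus E^{n-1}\subset Cl_{n-1}$, $e_1\leftrightarrow1$ (elements of $E^n$ are called vectors). Let $a\mapsto a'$ be the principal automorphism ($e_j\mapsto-e_j$, $j\ge 2$), $a\mapsto a^*$ the reversion (anti-automorphism fixing each $e_j$), and $|\cdot|$ the canonical norm of $Cl_{n-1}$. The Clifford group $\Gamma_n$ is the set of finite products of nonzero vectors. A Clifford matrix is $\begin{pmatrix} a&b\\ c&d\end{pmatrix}$ with $a,b,c,d\in\Gamma_n\cup\{0\}$, $ad^*-bc^*=1$, $ab^*\in E^n$, $cd^*\in E^n$; they form a group $SL_2(\Gamma_n)$ (a twofold cover of the Möbius group of $\mathbb R^n\cup\{\infty\}$), and $d^*-b^*x\in\Gamma_n\cup\{0\}$ for $x\in E^n$. Let $\Sigma$ be a finite-dimensional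 complex Hilbert space with skew-Hermitian operators $E_1,\dots,E_n$ satisfying $E_iE_j+E_jE_i=-2\delta_{ij}\mathrm{Id}$; let $\tau:Cl_{n-1}\to\mathrm{End}(\Sigma)$ be the unital algebra homomorphism with $\tau(e_j)=E_1E_j$ ($2\le j\le n$), and $\tau'(a)=\tau(a')$. For $\mu\in\mathbb C$ and $g=\begin{pmatrix} a&b\\ c&d\end{pmatrix}$ define, for $x$ with $d^*-b^*x\ne0$, $\pi'_\mu(g)f(x)=|d^*-b^*x|^{-2\mu-n}\,\tau'\big(\tfrac{d^*-b^*x}{|d^*-b^*x|}\big)^{-1}f\big((-c^*+a^*x)(d^*-b^*x)^{-1}\big)$. The Dirac operator is $Df=\sum_{j=1}^nE_j\,\partial f/\partial x_j$. *)

theory Defs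
  imports "HOL-Analysis.Analysis"
begin

text \<open>E^n is modelled as (real, 'n) vec, where the finite linearly ordered index type 'n
  lists the orthonormal basis e_1 < e_2 < ... < e_n (so n = CARD('n)).
  e_1 is the least index; E^{n-1} is spanned by the remaining indices.\<close>

definition cl_e1 :: "'n::{finite,linorder}" where
  "cl_e1 = Min UNIV"

definition cl_gens :: "'n::{finite,linorder} set" where
  "cl_gens = UNIV - {cl_e1}"

text \<open>Elements of Cl_{n-1} are coefficient functions on the basis monomials
  e_A = e_{j_1} ... e_{j_k} (j_1 < ... < j_k, A a subset of cl_gens).\<close>

type_synonym 'n cl = "'n set \<Rightarrow> real"

definition cl_elem :: "'n::{finite,linorder} cl \<Rightarrow> bool" where
  "cl_elem a \<longleftrightarrow> (\<forall>A. \<not> A \<subseteq> cl_gens \<longrightarrow> a A = 0)"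

text \<open>Sign in e_A e_B = sign(A,B) e_{A symmetric-difference B}, coming from
  uv + vu = -2(u,v).\<close>
definition cl_sign :: "'n::{finite,linorder} set \<Rightarrow> 'n set \<Rightarrow> real" where
  "cl_sign A B = (-1) ^ (card {(i, j). i \<in> A \<and> j \<in> B \<and> j < i} + card (A \<inter> B))"

definition cl_mult :: "'n::{finite,linorder} cl \<Rightarrow> 'n cl \<Rightarrow> 'n cl" where
  "cl_mult a b = (\<lambda>C. if C \<subseteq> cl_gens then
      (\<Sum>A\<in>Pow cl_gens. cl_sign A ((A - C) \<union> (C - A)) * a A * b ((A - C) \<union> (C - A)))
     else 0)"

definition cl_one :: "'n::{finite,linorder} cl" where
  "cl_one = (\<lambda>A. if A = {} then 1 else 0)"

definition cl_add :: "'n::{finite,linorder} cl \<Rightarrow> 'n cl \<Rightarrow> 'n cl" where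
  "cl_add a b = (\<lambda>A. a A + b A)"

definition cl_sub :: "'n::{finite,linorder} cl \<Rightarrow> 'n cl \<Rightarrow> 'n cl" where
  "cl_sub a b = (\<lambda>A. a A - b A)"

definition cl_neg :: "'n::{finite,linorder} cl \<Rightarrow> 'n cl" where
  "cl_neg a = (\<lambda>A. - a A)"

definition cl_scale :: "real \<Rightarrow> 'n::{finite,linorder} cl \<Rightarrow> 'n cl" where
  "cl_scale r a = (\<lambda>A. r * a A)"

text \<open>Principal automorphism a \<mapsto> a' (e_j \<mapsto> -e_j).\<close>
definition cl_prin :: "'n::{finite,linorder} cl \<Rightarrow> 'n cl" where
  "cl_prin a = (\<lambda>A. (-1) ^ card A * a A)"

text \<open>Reversion a \<mapsto> a^* (anti-automorphism fixing each e_j).\<close>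
definition cl_rev :: "'n::{finite,linorder} cl \<Rightarrow> 'n cl" where
  "cl_rev a = (\<lambda>A. (-1) ^ (card A * (card A - 1) div 2) * a A)"

definition cl_norm :: "'n::{finite,linorder} cl \<Rightarrow> real" where
  "cl_norm a = sqrt (\<Sum>A\<in>Pow cl_gens. (a A)\<^sup>2)"

text \<open>Inverse in Cl_{n-1} (meaningful for invertible elements).\<close>
definition cl_inv :: "'n::{finite,linorder} cl \<Rightarrow> 'n cl" where
  "cl_inv a = (THE b. cl_elem b \<and> cl_mult a b = cl_one)"

text \<open>Identification E^n = R + E^{n-1} inside Cl_{n-1}, e_1 \<leftrightarrow> 1.\<close>
definition vec_to_cl :: "(real, 'n::{finite,linorder}) vec \<Rightarrow> 'n cl" where
  "vec_to_cl x = (\<lambda>A. if A = {} then x $ cl_e1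
                      else if (\<exists>j\<in>cl_gens. A = {j}) then x $ (the_elem A) else 0)"

definition cl_to_vec :: "'n::{finite,linorder} cl \<Rightarrow> (real, 'n) vec" where
  "cl_to_vec u = (\<chi> i. if i = cl_e1 then u {} else u {i})"

definition cl_vectors :: "'n::{finite,linorder} cl set" where
  "cl_vectors = range vec_to_cl"

definition clifford_group :: "'n::{finite,linorder} cl set" where
  "clifford_group = {foldr cl_mult vs cl_one | vs.
      \<forall>v\<in>set vs. v \<in> cl_vectors \<and> v \<noteq> (\<lambda>_. 0)}"

definition SL2_Gamma :: "('n::{finite,linorder} cl \<times> 'n cl \<times> 'n cl \<times> 'n cl) set" where
  "SL2_Gamma = {(a, b, c, d). a \<in> clifford_group \<union> {\<lambda>_. 0} \<and> b \<in> clifford_group \<union> {\<lambda>_. 0}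
      \<and> c \<in> clifford_group \<union> {\<lambda>_. 0} \<and> d \<in> clifford_group \<union> {\<lambda>_. 0}
      \<and> cl_sub (cl_mult a (cl_rev d)) (cl_mult b (cl_rev c)) = cl_one
      \<and> cl_mult a (cl_rev b) \<in> cl_vectors \<and> cl_mult c (cl_rev d) \<in> cl_vectors}"

text \<open>Sigma is modelled as complex^'m with its standard Hermitian inner product;
  operators are complex matrices complex^'m^'m.\<close>

definition skew_hermitian :: "complex^'m^'m \<Rightarrow> bool" where
  "skew_hermitian M \<longleftrightarrow> (\<forall>p q. M $ p $ q = - cnj (M $ q $ p))"

definition clifford_ops :: "('n::{finite,linorder} \<Rightarrow> complex^'m^'m) \<Rightarrow> bool" where
  "clifford_ops E \<longleftrightarrow> (\<forall>i. skew_hermitian (E i)) \<and>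
     (\<forall>i j. E i ** E j + E j ** E i = (if i = j then -2 else 0) *\<^sub>R mat 1)"

text \<open>The unital algebra homomorphism tau with tau(e_j) = E_1 E_j:
  tau(e_A) = product over j in A (increasing) of E_1 E_j.\<close>
definition tau :: "('n::{finite,linorder} \<Rightarrow> complex^'m^'m) \<Rightarrow> 'n cl \<Rightarrow> complex^'m^'m" where
  "tau E a = (\<Sum>A\<in>Pow cl_gens. a A *\<^sub>R
      foldr (\<lambda>j M. (E cl_e1 ** E j) ** M) (sorted_list_of_set A) (mat 1))"

definition tau' :: "('n::{finite,linorder} \<Rightarrow> complex^'m^'m) \<Rightarrow> 'n cl \<Rightarrow> complex^'m^'m" where
  "tau' E a = tau E (cl_prin a)"

definition pi' :: "('n::{finite,linorder} \<Rightarrow> complex^'m^'m) \<Rightarrow> complex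
    \<Rightarrow> ('n cl \<times> 'n cl \<times> 'n cl \<times> 'n cl)
    \<Rightarrow> ((real, 'n) vec \<Rightarrow> complex^'m) \<Rightarrow> ((real, 'n) vec \<Rightarrow> complex^'m)" where
  "pi' E \<mu> g f = (\<lambda>x. case g of (a, b, c, d) \<Rightarrow>
      (let w = cl_sub (cl_rev d) (cl_mult (cl_rev b) (vec_to_cl x)) in
       if w = (\<lambda>_. 0) then 0 else
       (complex_of_real (cl_norm w) powr (- 2 * \<mu> - of_nat CARD('n))) *s
       (matrix_inv (tau' E (cl_scale (1 / cl_norm w) w)) *v
        f (cl_to_vec (cl_mult (cl_add (cl_neg (cl_rev c)) (cl_mult (cl_rev a) (vec_to_cl x)))
                              (cl_inv w))))))"

definition partial :: "'n::finite \<Rightarrow> ((real, 'n) vec \<Rightarrow> 'b::real_normed_vector) \<Rightarrow> (real, 'n) vec \<Rightarrow> 'b" where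
  "partial j f x = vector_derivative (\<lambda>t. f (x + t *\<^sub>R axis j 1)) (at 0)"

definition dirac :: "('n::{finite,linorder} \<Rightarrow> complex^'m^'m)
    \<Rightarrow> ((real, 'n) vec \<Rightarrow> complex^'m) \<Rightarrow> ((real, 'n) vec \<Rightarrow> complex^'m)" where
  "dirac E f = (\<lambda>x. \<Sum>j\<in>UNIV. E j *v partial j f x)"

fun Ck :: "nat \<Rightarrow> ((real, 'n::finite) vec \<Rightarrow> 'b::real_normed_vector) \<Rightarrow> bool" where
  "Ck 0 f \<longleftrightarrow> continuous_on UNIV f"
| "Ck (Suc k) f \<longleftrightarrow> continuous_on UNIV f \<and>
     (\<forall>j x. (\<lambda>t. f (x + t *\<^sub>R axis j 1)) differentiable (at 0)) \<and>
     (\<forall>j. Ck k (partial j f))"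

definition smooth_compact_support :: "((real, 'n::finite) vec \<Rightarrow> 'b::real_normed_vector) \<Rightarrow> bool" where
  "smooth_compact_support f \<longleftrightarrow> (\<forall>k. Ck k f) \<and> compact (closure {x. f x \<noteq> 0})"

end

theory Submission
  imports Defs
begin

text \<open>
  If \<open>b = 0\<close>, the action of \<open>g\<close> on \<open>E\<^sup>n\<close> is \<open>x \<mapsto> q + a\<^sup>* x a\<close>; if \<open>b \<noteq> 0\<close>, put \<open>\<kappa> = b\<^sup>*\<^sup>-\<^sup>1\<close>; then
  \<open>d\<^sup>* - b\<^sup>* x = - b\<^sup>* (x - p)\<close> with a vector \<open>p\<close>, and \<open>g\<close> acts by \<open>x \<mapsto> q - \<kappa>\<^sup>* (x - p)\<^sup>-\<^sup>1 \<kappa>\<close>.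
  So \<open>\<pi>'(g)\<close> is composed of translations, of the operators \<open>f \<mapsto> v f(R\<^sub>v x)\<close> with \<open>R\<^sub>v\<close> a scaled
  reflection (each factor of \<open>a\<close> or \<open>\<kappa>\<close> contributes two of them), and of the Kelvin transform
  \<open>J f(x) = \<bar>x\<bar>\<^sup>-\<^sup>n x f(x / \<bar>x\<bar>\<^sup>2)\<close>.  The first two kinds commute with the Dirac operator \<open>D\<close> up to a
  constant, and \<open>D J = - \<bar>x\<bar>\<^sup>-\<^sup>2 J D\<close>.

  The identity \<open>D\<^sup>2\<^sup>k\<^sup>+\<^sup>1 \<bar>x\<bar>\<^sup>2\<^sup>k J = - \<bar>x\<bar>\<^sup>-\<^sup>2\<^sup>k\<^sup>-\<^sup>2 J D\<^sup>2\<^sup>k\<^sup>+\<^sup>1\<close> follows by induction on \<open>k\<close> from the relations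
  of the Lie superalgebra osp(1|2) spanned by \<open>D\<close>, multiplication by \<open>x\<close>, their squares and
  \<open>H = \<Sum> x\<^sub>i \<partial>\<^sub>i + n/2\<close>: one commutes \<open>D\<^sup>2\<^sup>k\<^sup>+\<^sup>3\<close> past \<open>\<bar>x\<bar>\<^sup>2\<close> and recognises in the result, conjugated
  by \<open>\<bar>x\<bar>\<^sup>2\<^sup>k\<^sup>+\<^sup>2\<close>, the operator \<open>(\<bar>x\<bar>\<^sup>2 D)\<^sup>2\<close>.
\<close>

section \<open>The Clifford algebra\<close>

text \<open>Why these exponents: once the norm that normalises the argument of \<open>tau'\<close>
  is absorbed, the factor of \<open>pi'\<close> is |w|^t times the inverse of w, with t = -2\<mu> -
  n + 1. So t is 2k + 2 - n for \<mu> = -k - 1/2, and -2k - n for \<mu> = k + 1/2. Up to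
  conjugation, the Kelvin transform supplies |x - p|^(2 - n) times the inverse of x - p. What
  remains is |x - p|^(2k) before differentiation and |x - p|^(-2k - 2) after it, the two powers in
  the inversion identity. Its minus sign cancels against an odd power of the minus sign in x
  \<mapsto> q - ..., and the powers of |\<kappa>| match by the same count.

  The algebraic obstacle is that p is a vector: a Clifford matrix only comes with a b^* and c d^*
  being vectors, and the determinant is needed to reach p.

  The analytic obstacle is the pole: all functions are total, while the operator relations hold only
  where w is nonzero. They are therefore proved pointwise for functions smooth on an open set and
  iterated through congruence of derivatives on open sets.\<close>

definition symdiff :: "'a set \<Rightarrow> 'a set \<Rightarrow> 'a set" where
  "symdiff A B = (A - B) \<union> (B - A)"

lemma symdiff_assoc: "symdiff (symdiff A B) C = symdiff A (symdiff B C)"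
  and symdiff_commute: "symdiff A B = symdiff B A"
  and symdiff_self [simp]: "symdiff A A = {}"
  and symdiff_empty [simp]: "symdiff A {} = A" "symdiff {} A = A"
  and symdiff_cancel [simp]: "symdiff A (symdiff A B) = B"
  and symdiff_subset: "A \<subseteq> C \<Longrightarrow> B \<subseteq> C \<Longrightarrow> symdiff A B \<subseteq> C"
  by (auto simp: symdiff_def)

lemma symdiff_eq_empty [simp]: "symdiff A B = {} \<longleftrightarrow> A = B"
  by (auto simp: symdiff_def)

text \<open>Factors over the intersection occur twice on the right and cancel, since each f i
  squares to 1.\<close>

lemma prod_symdiff:
  fixes f :: "'a \<Rightarrow> real"
  assumes "finite A" "finite B" "\<And>i. f i * f i = 1"
  shows "prod f (symdiff A B) = prod f A * prod f B"
proof -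
  have "prod f A * prod f B = (prod f (A - B) * prod f (A \<inter> B)) * (prod f (B - A) * prod f (A \<inter> B))"
    using assms by (metis Diff_Int2 Int_commute inf_commute Int_Diff prod.Int_Diff mult.commute)
  also have "\<dots> = prod f (A - B) * prod f (B - A) * prod (\<lambda>i. f i * f i) (A \<inter> B)"
    by (simp add: prod.distrib)
  also have "\<dots> = prod f (symdiff A B)"
    unfolding symdiff_def using assms by (subst prod.union_disjoint) (auto simp: assms(3))
  finally show ?thesis by simp
qed

lemma card_symdiff:
  assumes "finite A" "finite B"
  shows "card (symdiff A B) + 2 * card (A \<inter> B) = card A + card B"
proof -
  have "card (symdiff A B) = card (A - B) + card (B - A)"
    unfolding symdiff_def using assms by (intro card_Un_disjoint) auto
  moreover have "card A = card (A - B) + card (A \<inter> B)"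
    using assms by (metis card_Int_Diff add.commute)
  moreover have "card B = card (B - A) + card (A \<inter> B)"
    using assms by (metis card_Int_Diff add.commute inf_commute)
  ultimately show ?thesis by simp
qed

text \<open>An inversion j < i and a repeated index each cost one sign, the latter because e_j
  squares to -1; so both counts merge into one.\<close>

lemma cl_sign_card:
  "cl_sign A B = (-1) ^ card {(i, j). i \<in> A \<and> j \<in> B \<and> j \<le> i}"
proof -
  have "{(i, j). i \<in> A \<and> j \<in> B \<and> j \<le> i} =
     {(i, j). i \<in> A \<and> j \<in> B \<and> j < i} \<union> (\<lambda>i. (i, i)) ` (A \<inter> B)" by auto
  moreover have "card ({(i, j). i \<in> A \<and> j \<in> B \<and> j < i} \<union> (\<lambda>i. (i, i)) ` (A \<inter> B)) =
    card {(i, j). i \<in> A \<and> j \<in> B \<and> j < i} + card ((\<lambda>i. (i, i)) ` (A \<inter> B))"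
    by (intro card_Un_disjoint) auto
  moreover have "card ((\<lambda>i. (i, i)) ` (A \<inter> B)) = card (A \<inter> B)"
    by (intro card_image) (auto simp: inj_on_def)
  ultimately show ?thesis by (simp add: cl_sign_def)
qed

text \<open>The sign is a bicharacter of the group of subsets under symmetric difference;
  this makes the multiplication associative.\<close>
lemma cl_sign_prod: "cl_sign A B = (\<Prod>i\<in>A. \<Prod>j\<in>B. if j \<le> i then -1 else 1)"
proof -
  have "(\<Prod>i\<in>A. \<Prod>j\<in>B. if j \<le> i then -1 else 1) = (\<Prod>p\<in>A \<times> B. if snd p \<le> fst p then -1 else (1::real))"
    by (subst prod.cartesian_product) (auto intro!: prod.cong)
  also have "\<dots> = (-1) ^ card ((A \<times> B) \<inter> {p. snd p \<le> fst p})"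
    by (subst prod.If_cases) auto
  also have "(A \<times> B) \<inter> {p. snd p \<le> fst p} = {(i, j). i \<in> A \<and> j \<in> B \<and> j \<le> i}" by auto
  finally show ?thesis by (simp add: cl_sign_card)
qed

lemma cl_sign_symdiff_left: "cl_sign (symdiff A B) C = cl_sign A C * cl_sign B C"
  unfolding cl_sign_prod by (rule prod_symdiff) (auto simp: prod.distrib[symmetric] intro!: prod.neutral)

lemma cl_sign_symdiff_right: "cl_sign A (symdiff B C) = cl_sign A B * cl_sign A C"
  unfolding cl_sign_prod prod.distrib[symmetric]
  by (intro prod.cong refl prod_symdiff) auto

lemma cl_sign_empty [simp]: "cl_sign {} B = 1" "cl_sign A {} = 1"
  by (simp_all add: cl_sign_prod)

lemma cl_sign_square [simp]: "cl_sign A B * cl_sign A B = 1"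
  by (simp add: cl_sign_def flip: power_add mult_2)

text \<open>The sign by which e_A and e_B commute. The pairs with j \<le> i and those with i \<le> j
  cover the product of A and B and overlap in the diagonal of the intersection.\<close>

lemma cl_sign_exchange:
  "cl_sign A B * cl_sign B A = (-1) ^ (card A * card B + card (A \<inter> B))"
proof -
  let ?X = "{(i, j). i \<in> A \<and> j \<in> B \<and> j \<le> i}" and ?Y = "{(i, j). i \<in> A \<and> j \<in> B \<and> i \<le> j}"
  have "card {(i, j). i \<in> B \<and> j \<in> A \<and> j \<le> i} = card (prod.swap ` {(i, j). i \<in> B \<and> j \<in> A \<and> j \<le> i})"
    by (rule card_image[symmetric]) auto
  also have "prod.swap ` {(i, j). i \<in> B \<and> j \<in> A \<and> j \<le> i} = ?Y" by force
  finally have Y: "cl_sign B A = (-1) ^ card ?Y" by (simp add: cl_sign_card)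
  have "card ?X + card ?Y = card (?X \<union> ?Y) + card (?X \<inter> ?Y)"
    by (intro card_Un_Int) auto
  also have "?X \<union> ?Y = A \<times> B" by auto
  also have "?X \<inter> ?Y = (\<lambda>i. (i, i)) ` (A \<inter> B)" by auto
  also have "card ((\<lambda>i. (i, i)) ` (A \<inter> B)) = card (A \<inter> B)"
    by (intro card_image) (auto simp: inj_on_def)
  finally have "card ?X + card ?Y = card A * card B + card (A \<inter> B)"
    by (simp add: card_cartesian_product)
  then show ?thesis
    by (simp add: Y cl_sign_card[of A B] flip: power_add)
qed

text \<open>The square of e_A: the pairs counted form the triangle of A \<times> A including the
  diagonal.\<close>

lemma cl_sign_diag: "cl_sign A A = (-1) ^ (card A * (card A + 1) div 2)"
proof -
  let ?X = "{(i, j). i \<in> A \<and> j \<in> A \<and> j \<le> i}" and ?Y = "{(i, j). i \<in> A \<and> j \<in> A \<and> i \<le> j}"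
  have "card ?X = card (prod.swap ` ?X)"
    by (rule card_image[symmetric]) auto
  also have "prod.swap ` ?X = ?Y" by force
  finally have "card ?X = card ?Y" .
  moreover have "card ?X + card ?Y = card (?X \<union> ?Y) + card (?X \<inter> ?Y)"
    by (intro card_Un_Int) auto
  moreover have "?X \<union> ?Y = A \<times> A" by auto
  moreover have "?X \<inter> ?Y = (\<lambda>i. (i, i)) ` A" by auto
  moreover have "card ((\<lambda>i. (i, i)) ` A) = card A"
    by (intro card_image) (auto simp: inj_on_def)
  ultimately have "2 * card ?X = card A * (card A + 1)"
    by (simp add: card_cartesian_product)
  then have "card ?X = card A * (card A + 1) div 2" by linarith
  then show ?thesis by (simp add: cl_sign_card)
qed

section \<open>Associativity and the Clifford algebra as a type\<close>

lemma cl_mult_symdiff: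
  "cl_mult a b C = (if C \<subseteq> cl_gens then
     (\<Sum>A\<in>Pow cl_gens. cl_sign A (symdiff A C) * a A * b (symdiff A C)) else 0)"
  by (simp add: cl_mult_def symdiff_def)

lemma sum_Pow_symdiff:
  assumes "A \<subseteq> cl_gens"
  shows "(\<Sum>B\<in>Pow cl_gens. h (symdiff A B)) = (\<Sum>B\<in>Pow (cl_gens :: 'n::{finite,linorder} set). h B)"
  by (rule sum.reindex_bij_witness[of _ "symdiff A" "symdiff A"]) (use assms in \<open>auto simp: symdiff_def\<close>)

lemma cl_mult_assoc: "cl_mult (cl_mult a b) c = cl_mult a (cl_mult b c)"
proof
  fix C :: "'a set"
  let ?P = "Pow (cl_gens :: 'a set)"
  show "cl_mult (cl_mult a b) c C = cl_mult a (cl_mult b c) C"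
  proof (cases "C \<subseteq> cl_gens")
    case True
    have "cl_mult (cl_mult a b) c C =
      (\<Sum>D\<in>?P. \<Sum>A\<in>?P. cl_sign D (symdiff D C) * (cl_sign A (symdiff A D) * a A * b (symdiff A D)) * c (symdiff D C))"
      using True by (simp add: cl_mult_symdiff sum_distrib_left sum_distrib_right)
    also have "\<dots> = (\<Sum>A\<in>?P. \<Sum>D\<in>?P. cl_sign D (symdiff D C) * (cl_sign A (symdiff A D) * a A * b (symdiff A D)) * c (symdiff D C))"
      by (rule sum.swap)
    \<comment> \<open>D indexes the monomials of the product of a and b. Substituting D =
      \<open>symdiff A B\<close> makes A and B the indices of the first two factors.\<close>
    also have "\<dots> = (\<Sum>A\<in>?P. \<Sum>B\<in>?P. cl_sign (symdiff A B) (symdiff (symdiff A B) C) * (cl_sign A B * a A * b B) * c (symdiff (symdiff A B) C))"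
    proof (rule sum.cong[OF refl])
      fix A :: "'a set" assume "A \<in> ?P"
      then have "A \<subseteq> cl_gens" by simp
      from sum_Pow_symdiff[OF this, of "\<lambda>D. cl_sign D (symdiff D C) * (cl_sign A (symdiff A D) * a A * b (symdiff A D)) * c (symdiff D C)"]
      show "(\<Sum>D\<in>?P. cl_sign D (symdiff D C) * (cl_sign A (symdiff A D) * a A * b (symdiff A D)) * c (symdiff D C)) =
        (\<Sum>B\<in>?P. cl_sign (symdiff A B) (symdiff (symdiff A B) C) * (cl_sign A B * a A * b B) * c (symdiff (symdiff A B) C))"
        by simp
    qed
    also have "\<dots> = (\<Sum>A\<in>?P. \<Sum>B\<in>?P. cl_sign A (symdiff A C) * a A * (cl_sign B (symdiff B (symdiff A C)) * b B * c (symdiff B (symdiff A C))))"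
    proof (intro sum.cong refl)
      fix A B :: "'a set"
      have e: "symdiff (symdiff A B) C = symdiff B (symdiff A C)" by (metis symdiff_assoc symdiff_commute)
      \<comment> \<open>Expanding by the bicharacter rules, the two sides differ by the square of
        \<open>cl_sign A B\<close>, which is 1.\<close>
      have "cl_sign (symdiff A B) (symdiff B (symdiff A C)) * cl_sign A B = cl_sign A (symdiff A C) * cl_sign B (symdiff B (symdiff A C))"
        by (simp add: cl_sign_symdiff_left cl_sign_symdiff_right)
      then show "cl_sign (symdiff A B) (symdiff (symdiff A B) C) * (cl_sign A B * a A * b B) * c (symdiff (symdiff A B) C) =
        cl_sign A (symdiff A C) * a A * (cl_sign B (symdiff B (symdiff A C)) * b B * c (symdiff B (symdiff A C)))"
        unfolding e by algebra
    qed
    also have "\<dots> = cl_mult a (cl_mult b c) C"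
      using True by (simp add: cl_mult_symdiff sum_distrib_left symdiff_subset)
    finally show ?thesis .
  qed (simp add: cl_mult_symdiff)
qed

lemma cl_elem_mult: "cl_elem (cl_mult a b)"
  by (simp add: cl_elem_def cl_mult_def)

lemma cl_one_mult: "cl_elem a \<Longrightarrow> cl_mult cl_one a = a"
  by (rule ext) (auto simp: cl_mult_symdiff cl_one_def cl_elem_def if_distrib[of "\<lambda>x. _ * x"]
    if_distrib[of "\<lambda>x. x * _"] sum.delta cong: if_cong)

lemma cl_mult_one: "cl_elem a \<Longrightarrow> cl_mult a cl_one = a"
  by (rule ext) (auto simp: cl_mult_symdiff cl_one_def cl_elem_def if_distrib[of "\<lambda>x. _ * x"]
    if_distrib[of "\<lambda>x. x * _"] sum.delta cong: if_cong)

text \<open>On coefficient functions the unit laws hold only for those supported on subsets of the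
  generators. As a type these form a \<open>real_algebra_1\<close>, and ring reasoning becomes
  available; the \<open>rep_eq\<close> rules lead back to the functions in the theorem.\<close>

typedef (overloaded) ('n::"{finite,linorder}") clif = "{a :: 'n cl. cl_elem a}"
  by (rule exI[of _ "\<lambda>_. 0"]) (simp add: cl_elem_def)

setup_lifting type_definition_clif

instantiation clif :: ("{finite,linorder}") real_algebra_1
begin

lift_definition zero_clif :: "'a clif" is "\<lambda>_. 0" by (simp add: cl_elem_def)
lift_definition one_clif :: "'a clif" is cl_one by (simp add: cl_elem_def cl_one_def)
lift_definition plus_clif :: "'a clif \<Rightarrow> 'a clif \<Rightarrow> 'a clif" is cl_add
  by (simp add: cl_elem_def cl_add_def)
lift_definition minus_clif :: "'a clif \<Rightarrow> 'a clif \<Rightarrow> 'a clif" is cl_sub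
  by (simp add: cl_elem_def cl_sub_def)
lift_definition uminus_clif :: "'a clif \<Rightarrow> 'a clif" is cl_neg
  by (simp add: cl_elem_def cl_neg_def)
lift_definition scaleR_clif :: "real \<Rightarrow> 'a clif \<Rightarrow> 'a clif" is cl_scale
  by (simp add: cl_elem_def cl_scale_def)
lift_definition times_clif :: "'a clif \<Rightarrow> 'a clif \<Rightarrow> 'a clif" is cl_mult
  by (simp add: cl_elem_mult)

instance
proof
  fix a b c :: "'a clif" and r s :: real
  show "a * b * c = a * (b * c)" by transfer (rule cl_mult_assoc)
  show "1 * a = a" by transfer (rule cl_one_mult)
  show "a * 1 = a" by transfer (rule cl_mult_one)
  show "(0 :: 'a clif) \<noteq> 1" by transfer (auto simp: cl_one_def fun_eq_iff intro!: exI[of _ "{}"])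
  show "(a + b) * c = a * c + b * c" "a * (b + c) = a * b + a * c"
    "r *\<^sub>R a * b = r *\<^sub>R (a * b)" "a * r *\<^sub>R b = r *\<^sub>R (a * b)"
    by (transfer, auto simp: fun_eq_iff cl_mult_symdiff cl_add_def cl_scale_def
      sum_distrib_left sum.distrib[symmetric] algebra_simps intro!: sum.cong)+
qed (transfer, simp add: cl_add_def cl_sub_def cl_neg_def cl_scale_def fun_eq_iff algebra_simps)+

end

text \<open>This is -(v,v) times the reflection in the hyperplane orthogonal to v: it scales v by
  (v,v) and the orthogonal complement by -(v,v). The scaling avoids a division and is the one that
  products v x v produce.\<close>

definition vrefl :: "'a::real_inner \<Rightarrow> 'a \<Rightarrow> 'a" where
  "vrefl v x = (2 * (x \<bullet> v)) *\<^sub>R v - (v \<bullet> v) *\<^sub>R x"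

lemma vrefl_linear: "linear (vrefl v)"
  by (rule linearI) (simp_all add: vrefl_def inner_add_left algebra_simps scaleR_add_left)

section \<open>Reversion, principal automorphism and norm\<close>

lift_definition crev :: "'n::{finite,linorder} clif \<Rightarrow> 'n clif" is cl_rev
  by (simp add: cl_elem_def cl_rev_def)

lift_definition cprin :: "'n::{finite,linorder} clif \<Rightarrow> 'n clif" is cl_prin
  by (simp add: cl_elem_def cl_prin_def)

lift_definition vec_clif :: "(real, 'n::{finite,linorder}) vec \<Rightarrow> 'n clif" is vec_to_cl
  by (auto simp: cl_elem_def vec_to_cl_def)

text \<open>The principal automorphism on vectors. Writing it as a \<open>vrefl\<close> lets
  conjugation count as one more reflection in the analysis of the Dirac operator.\<close>

definition vconj :: "(real, 'n::{finite,linorder}) vec \<Rightarrow> (real, 'n) vec" where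
  "vconj = vrefl (axis cl_e1 1)"

lemma vconj_component: "vconj x $ i = (if i = cl_e1 then x $ i else - x $ i)"
  by (simp add: vconj_def vrefl_def inner_axis inner_axis_axis) (simp add: axis_def)

lemma vconj_vconj [simp]: "vconj (vconj x) = x"
  by (simp add: vec_eq_iff vconj_component)

lemma norm_vconj [simp]: "norm (vconj x) = norm x"
  by (auto simp: norm_vec_def L2_set_def vconj_component intro!: arg_cong[of _ _ sqrt] sum.cong)

lemma vconj_eq_0 [simp]: "vconj x = 0 \<longleftrightarrow> x = 0"
  by (metis norm_vconj norm_eq_zero)

lemma cl_e1_not_gen [simp]: "cl_e1 \<notin> cl_gens"
  by (simp add: cl_gens_def)

lemma vec_clif_inject: "vec_clif x = vec_clif y \<longleftrightarrow> x = (y :: (real, 'n::{finite,linorder}) vec)"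
proof
  assume "vec_clif x = vec_clif y"
  then have *: "vec_to_cl x = vec_to_cl y" by transfer
  show "x = y"
  proof (rule Finite_Cartesian_Product.vec_eq_iff[THEN iffD2], rule allI)
    fix i
    show "x $ i = y $ i"
    proof (cases "i = cl_e1")
      case True
      then show ?thesis using fun_cong[OF *, of "{}"] by (simp add: vec_to_cl_def)
    next
      case False
      then show ?thesis using fun_cong[OF *, of "{i}"] by (simp add: vec_to_cl_def cl_gens_def)
    qed
  qed
qed simp

lemma cl_to_vec_vec [simp]: "cl_to_vec (Rep_clif (vec_clif x)) = x"
  unfolding vec_clif.rep_eq by (auto simp: cl_to_vec_def vec_to_cl_def Finite_Cartesian_Product.vec_eq_iff cl_gens_def)

lemma vec_add: "vec_clif (x + y) = vec_clif x + vec_clif y"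
  and vec_diff: "vec_clif (x - y) = vec_clif x - vec_clif y"
  and vec_minus: "vec_clif (- x) = - vec_clif x"
  and vec_scaleR: "vec_clif (r *\<^sub>R x) = r *\<^sub>R vec_clif x"
  and vec_0 [simp]: "vec_clif 0 = 0"
  by (transfer, auto simp: vec_to_cl_def cl_add_def cl_sub_def cl_neg_def cl_scale_def fun_eq_iff)+

lemma vec_eq_0 [simp]: "vec_clif x = 0 \<longleftrightarrow> x = 0"
  by (metis vec_0 vec_clif_inject)

lemma vec_sum: "vec_clif (\<Sum>i\<in>I. f i) = (\<Sum>i\<in>I. vec_clif (f i))"
  by (induction I rule: infinite_finite_induct) (auto simp: vec_add)

lemma crev_simps:
  "crev (a + b) = crev a + crev b" "crev (a - b) = crev a - crev b" "crev (- a) = - crev a"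
  "crev (r *\<^sub>R a) = r *\<^sub>R crev a" "crev 1 = 1" "crev 0 = 0" "crev (vec_clif x) = vec_clif x"
  by (transfer, auto simp: cl_rev_def vec_to_cl_def cl_add_def cl_sub_def cl_neg_def cl_scale_def
       cl_one_def fun_eq_iff algebra_simps)+

lemma cprin_simps:
  "cprin (a + b) = cprin a + cprin b" "cprin (a - b) = cprin a - cprin b" "cprin (- a) = - cprin a"
  "cprin (r *\<^sub>R a) = r *\<^sub>R cprin a" "cprin 1 = 1" "cprin 0 = 0"
  by (transfer, auto simp: cl_prin_def vec_to_cl_def cl_add_def cl_sub_def cl_neg_def cl_scale_def
       cl_one_def fun_eq_iff algebra_simps)+

lemma cprin_vec: "cprin (vec_clif x) = vec_clif (vconj x)"
  by transfer (auto simp: cl_prin_def vec_to_cl_def vconj_component fun_eq_iff)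

lemma crev_crev [simp]: "crev (crev a) = a"
  by transfer (auto simp: cl_rev_def fun_eq_iff simp flip: power_add mult_2 mult.assoc)

lemma minus_one_power_cong: "even m = even n \<Longrightarrow> (- 1 :: real) ^ m = (- 1) ^ n"
  by (simp add: minus_one_power_iff)

lemma cprin_mult: "cprin (a * b) = cprin a * cprin b"
proof (transfer, rule ext)
  fix a b :: "'a cl" and C :: "'a set"
  have *: "(-1) ^ card (symdiff A C) * (-1) ^ card A = ((-1) ^ card C :: real)" for A
  proof -
    have "card (symdiff A C) + card A + 2 * card (A \<inter> C) = 2 * card A + card C"
      using card_symdiff[of A C] by simp
    then have "even (card (symdiff A C) + card A) = even (card C)" by presburger
    then show ?thesis unfolding power_add[symmetric] by (rule minus_one_power_cong)
  qed
  have "(-1) ^ card C * (cl_sign A (symdiff A C) * a A * b (symdiff A C))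
     = cl_sign A (symdiff A C) * ((-1) ^ card A * a A) * ((-1) ^ card (symdiff A C) * b (symdiff A C))" for A
    unfolding *[of A, symmetric] by (simp add: mult_ac)
  then show "cl_prin (cl_mult a b) C = cl_mult (cl_prin a) (cl_prin b) C"
    by (auto simp: cl_prin_def cl_mult_symdiff sum_distrib_left simp del: mult_cancel_left mult_cancel_right intro!: sum.cong)
qed

text \<open>Here a, b, t, s stand for the sizes of A, B, their intersection and their symmetric
  difference. Modulo 2, the binomial coefficient of a + b - 2t over 2 is the sum of those of a and b
  over 2, plus ab + t.\<close>

lemma rev_sign_parity:
  fixes a b t s :: nat
  assumes "s + 2 * t = a + b"
  shows "even (s * (s - 1) div 2 + (a * b + t)) = even (a * (a - 1) div 2 + b * (b - 1) div 2)"
proof -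
  have ex: "\<exists>m. even m \<and> m = (int n * (int n - 1)) \<and> int (n * (n - 1) div 2) * 2 = m" for n :: nat
    by (cases n) (auto simp: zdiv_int algebra_simps)
  have tr: "int (n * (n - 1) div 2) * 2 = int n * (int n - 1)" for n
    using ex[of n] by auto
  let ?s = "int (s * (s - 1) div 2)" and ?a = "int (a * (a - 1) div 2)" and ?b = "int (b * (b - 1) div 2)"
  have s: "int s = int a + int b - 2 * int t" using assms by linarith
  have "2 * ?s = 2 * (?a + ?b + int a * int b - 2 * int t * (int a + int b) + 2 * int t * int t + int t)"
    using tr[of s] tr[of a] tr[of b] unfolding s by (simp add: algebra_simps)
  then have "?s + (int a * int b + int t) = ?a + ?b + 2 * (int a * int b - int t * (int a + int b) + int t * int t + int t)"
    by (simp add: algebra_simps)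
  then have "even (?s + (int a * int b + int t)) = even (?a + ?b)" by simp
  then show ?thesis by (metis even_of_nat of_nat_add of_nat_mult)
qed

text \<open>On monomials this is a sign identity: the sign of exchanging e_A and e_B is exactly the
  defect by which the reversal sign fails to be multiplicative under symmetric difference.\<close>

lemma crev_mult: "crev (a * b) = crev b * crev a"
proof (transfer, rule ext)
  fix a b :: "'a cl" and C :: "'a set"
  let ?r = "\<lambda>A::'a set. (-1) ^ (card A * (card A - 1) div 2) :: real"
  have sgn: "cl_sign A B * ?r (symdiff A B) = ?r A * ?r B * cl_sign B A" for A B :: "'a set"
  proof -
    have "?r (symdiff A B) * (cl_sign A B * cl_sign B A) = ?r A * ?r B"
      unfolding cl_sign_exchange power_add[symmetric]
      by (intro minus_one_power_cong rev_sign_parity card_symdiff) auto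
    then have "?r (symdiff A B) * cl_sign A B * (cl_sign B A * cl_sign B A) = ?r A * ?r B * cl_sign B A"
      by (metis mult.assoc)
    then show ?thesis by (simp add: mult.commute)
  qed
  show "cl_rev (cl_mult a b) C = cl_mult (cl_rev b) (cl_rev a) C"
  proof (cases "C \<subseteq> cl_gens")
    case True
    \<comment> \<open>The factors have changed places, so the sum is reindexed by the complementary
      monomial \<open>symdiff C A\<close> in order to run over the monomials of a again.\<close>
    have "cl_mult (cl_rev b) (cl_rev a) C =
       (\<Sum>A\<in>Pow cl_gens. cl_sign (symdiff C A) (symdiff (symdiff C A) C) * cl_rev b (symdiff C A) * cl_rev a (symdiff (symdiff C A) C))"
      using True sum_Pow_symdiff[OF True, of "\<lambda>A. cl_sign A (symdiff A C) * cl_rev b A * cl_rev a (symdiff A C)"]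
      by (simp add: cl_mult_symdiff)
    also have "\<dots> = (\<Sum>A\<in>Pow cl_gens. cl_sign (symdiff A C) A * cl_rev b (symdiff A C) * cl_rev a A)"
      by (intro sum.cong refl) (metis symdiff_cancel symdiff_commute)
    also have "\<dots> = (\<Sum>A\<in>Pow cl_gens. ?r C * (cl_sign A (symdiff A C) * a A * b (symdiff A C)))"
    proof (intro sum.cong refl)
      fix A :: "'a set"
      show "cl_sign (symdiff A C) A * cl_rev b (symdiff A C) * cl_rev a A = ?r C * (cl_sign A (symdiff A C) * a A * b (symdiff A C))"
        using sgn[of A "symdiff A C"] by (simp add: cl_rev_def algebra_simps)
    qed
    also have "\<dots> = cl_rev (cl_mult a b) C"
      using True by (simp add: cl_rev_def cl_mult_symdiff sum_distrib_left)
    finally show ?thesis by simp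
  qed (simp add: cl_rev_def cl_mult_symdiff)
qed

text \<open>Only equal monomials contribute to the scalar part, and \<open>crev\<close> after
  \<open>cprin\<close> sends e_A to its inverse. This algebraic form of the norm yields its
  multiplicativity on products of vectors.\<close>

lemma cl_norm_rev_prin: "(cl_norm (Rep_clif a))\<^sup>2 = Rep_clif (crev (cprin a) * a) {}"
proof -
  have sgn: "cl_sign A A * ((-1) ^ (card A * (card A - 1) div 2) * (-1) ^ card A) = 1" for A :: "'a set"
  proof -
    have e: "card A * (card A - 1) div 2 + card A = card A * (card A + 1) div 2"
    proof (cases "card A")
      case (Suc n)
      have "Suc n * Suc (Suc n) = Suc n * n + 2 * Suc n" by (simp add: algebra_simps)
      then show ?thesis using Suc by simp
    qed simp
    show ?thesis
      by (subst cl_sign_diag, subst e[symmetric]) (simp flip: power_add)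
  qed
  have "cl_sign A A * ((-1) ^ (card A * (card A - 1) div 2) * ((-1) ^ card A * x)) = x" for A :: "'a set" and x
    using sgn[of A] by (metis mult.assoc mult_1)
  then have "cl_sign A A * ((-1) ^ (card A * (card A - 1) div 2) * ((-1) ^ card A * x)) * x = x\<^sup>2" for A :: "'a set" and x
    by (simp add: power2_eq_square)
  then show ?thesis
    unfolding times_clif.rep_eq crev.rep_eq cprin.rep_eq
    by (simp add: cl_mult_symdiff cl_norm_def sum_nonneg cl_rev_def cl_prin_def)
qed

subsection \<open>Vectors\<close>

lemma sum_e1_gens: "(\<Sum>i\<in>UNIV. h i) = h cl_e1 + (\<Sum>i\<in>(cl_gens::'n::{finite,linorder} set). h i)"
  by (simp add: cl_gens_def sum.remove[of UNIV cl_e1 h])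

lemma vec_axis_e1: "vec_clif (axis cl_e1 1) = 1"
  by transfer (auto simp: vec_to_cl_def cl_one_def axis_def fun_eq_iff)

lemma cl_mult_monom:
  assumes "A \<subseteq> cl_gens" "B \<subseteq> cl_gens"
  shows "cl_mult (\<lambda>C. if C = A then 1 else 0) (\<lambda>C. if C = B then 1 else 0) =
    cl_scale (cl_sign A B) (\<lambda>C. if C = symdiff A B then 1 else (0::real))"
proof
  fix C :: "'a set"
  let ?d = "\<lambda>A C :: 'a set. if C = A then 1 else (0::real)"
  have *: "symdiff A C = B \<longleftrightarrow> C = symdiff A B" by (metis symdiff_cancel)
  have "(\<Sum>A'\<in>Pow cl_gens. cl_sign A' (symdiff A' C) * ?d A A' * ?d B (symdiff A' C)) =
     (\<Sum>A'\<in>Pow cl_gens. if A' = A then cl_sign A (symdiff A C) * ?d B (symdiff A C) else 0)"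
    by (intro sum.cong) auto
  also have "\<dots> = cl_sign A (symdiff A C) * ?d B (symdiff A C)"
    using assms by simp
  finally have "(\<Sum>A'\<in>Pow cl_gens. cl_sign A' (symdiff A' C) * ?d A A' * ?d B (symdiff A' C)) =
    cl_sign A (symdiff A C) * ?d B (symdiff A C)" .
  then show "cl_mult (?d A) (?d B) C = cl_scale (cl_sign A B) (?d (symdiff A B)) C"
    using assms by (auto simp: cl_mult_symdiff cl_scale_def * symdiff_subset)
qed

lemma vec_gen: "j \<in> cl_gens \<Longrightarrow> Rep_clif (vec_clif (axis j 1)) = (\<lambda>C. if C = {j} then 1 else 0)"
  unfolding vec_clif.rep_eq by (auto simp: vec_to_cl_def axis_def fun_eq_iff cl_gens_def)

lemma gen_anticommute:
  assumes "i \<in> cl_gens" "j \<in> cl_gens"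
  shows "vec_clif (axis i 1) * vec_clif (axis j 1) + vec_clif (axis j 1) * vec_clif (axis i 1) = (if i = j then -2 else 0) *\<^sub>R (1 :: 'n::{finite,linorder} clif)"
proof -
  have s: "symdiff {i} {j} = symdiff {j} {i}" by (rule symdiff_commute)
  have "Rep_clif (vec_clif (axis i 1) * vec_clif (axis j 1) + vec_clif (axis j 1) * vec_clif (axis i 1)) =
     Rep_clif ((if i = j then -2 else 0) *\<^sub>R (1 :: 'n clif))"
    unfolding plus_clif.rep_eq times_clif.rep_eq scaleR_clif.rep_eq one_clif.rep_eq
    using assms
    by (auto simp: vec_gen cl_mult_monom s cl_scale_def cl_add_def cl_one_def fun_eq_iff cl_sign_prod)
  then show ?thesis by (simp add: Rep_clif_inject)
qed

lemma vec_decompose: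
  "vec_clif x = x $ cl_e1 *\<^sub>R 1 + (\<Sum>j\<in>cl_gens. x $ j *\<^sub>R vec_clif (axis j 1))"
proof -
  have "vec_clif x = vec_clif (\<Sum>j\<in>UNIV. x $ j *\<^sub>R axis j 1)"
    using basis_expansion[of x] by (simp add: scalar_mult_eq_scaleR)
  then show ?thesis
    unfolding sum_e1_gens by (simp only: vec_add vec_sum vec_scaleR vec_axis_e1)
qed

lemma vec_mult_vconj: "vec_clif x * vec_clif (vconj x) = (x \<bullet> x) *\<^sub>R (1 :: 'n::{finite,linorder} clif)"
proof -
  let ?u = "\<Sum>j\<in>cl_gens. x $ j *\<^sub>R (vec_clif (axis j 1) :: 'n clif)"
  have cjx: "vec_clif (vconj x) = x $ cl_e1 *\<^sub>R 1 - ?u"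
  proof -
    have "(\<Sum>j\<in>cl_gens. vconj x $ j *\<^sub>R (vec_clif (axis j 1) :: 'n clif)) = - ?u"
      by (auto simp: vconj_component sum_negf[symmetric] intro!: sum.cong)
    then show ?thesis unfolding vec_decompose[of "vconj x"] by (simp add: vconj_component)
  qed
  \<comment> \<open>Doubling symmetrises the double sum in i and j, so that the anticommutation
    relation applies termwise.\<close>
  have "2 *\<^sub>R (?u * ?u) = ?u * ?u + ?u * ?u" by (simp add: scaleR_2)
  also have "\<dots> = (\<Sum>i\<in>cl_gens. \<Sum>j\<in>cl_gens. (x $ i * x $ j) *\<^sub>R (vec_clif (axis i 1) * vec_clif (axis j 1) :: 'n clif))
     + (\<Sum>i\<in>cl_gens. \<Sum>j\<in>cl_gens. (x $ i * x $ j) *\<^sub>R (vec_clif (axis j 1) * vec_clif (axis i 1) :: 'n clif))"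
  proof -
    have "?u * ?u = (\<Sum>i\<in>cl_gens. \<Sum>j\<in>cl_gens. (x $ i * x $ j) *\<^sub>R (vec_clif (axis i 1) * vec_clif (axis j 1)))"
      by (simp add: sum_product mult.commute)
    moreover have "\<dots> = (\<Sum>i\<in>cl_gens. \<Sum>j\<in>cl_gens. (x $ i * x $ j) *\<^sub>R (vec_clif (axis j 1) * vec_clif (axis i 1)))"
      by (subst sum.swap) (simp add: mult.commute)
    ultimately show ?thesis by simp
  qed
  also have "\<dots> = (\<Sum>i\<in>cl_gens. \<Sum>j\<in>cl_gens. (x $ i * x $ j) *\<^sub>R ((if i = j then -2 else 0) *\<^sub>R (1 :: 'n clif)))"
    by (simp only: sum.distrib[symmetric] scaleR_add_right[symmetric])
       (intro sum.cong refl, simp only: gen_anticommute)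
  also have "\<dots> = (\<Sum>i\<in>cl_gens. (- 2 * (x $ i * x $ i)) *\<^sub>R (1 :: 'n clif))"
  proof (intro sum.cong refl)
    fix i :: 'n assume "i \<in> cl_gens"
    then have "(\<Sum>j\<in>cl_gens. (x $ i * x $ j) *\<^sub>R ((if i = j then -2 else 0) *\<^sub>R (1 :: 'n clif))) =
      (\<Sum>j\<in>{i}. (x $ i * x $ j) *\<^sub>R ((if i = j then -2 else 0) *\<^sub>R (1 :: 'n clif)))"
      by (intro sum.mono_neutral_right) auto
    then show "(\<Sum>j\<in>cl_gens. (x $ i * x $ j) *\<^sub>R ((if i = j then -2 else 0) *\<^sub>R (1 :: 'n clif))) = (- 2 * (x $ i * x $ i)) *\<^sub>R 1"
      by simp
  qed
  also have "\<dots> = 2 *\<^sub>R (- (\<Sum>i\<in>cl_gens. x $ i * x $ i) *\<^sub>R (1 :: 'n clif))"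
    by (simp add: scaleR_sum_left[symmetric] sum_distrib_left[symmetric] sum_negf)
  finally have "(1/2) *\<^sub>R (2 *\<^sub>R (?u * ?u)) = (1/2) *\<^sub>R (2 *\<^sub>R (- (\<Sum>i\<in>cl_gens. x $ i * x $ i) *\<^sub>R (1 :: 'n clif)))"
    by (rule arg_cong[where f="\<lambda>x. (1 / 2) *\<^sub>R x"])
  then have u: "?u * ?u = - (\<Sum>i\<in>cl_gens. x $ i * x $ i) *\<^sub>R (1 :: 'n clif)"
    by (simp only: scaleR_scaleR) simp
  show ?thesis
    unfolding vec_decompose[of x] cjx using u
    by (simp add: algebra_simps inner_vec_def sum_e1_gens[of "\<lambda>i. x $ i * x $ i"])
qed

lemma vconj_mult_vec: "vec_clif (vconj x) * vec_clif x = (x \<bullet> x) *\<^sub>R (1 :: 'n::{finite,linorder} clif)"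
  using vec_mult_vconj[of "vconj x"] by (simp flip: power2_norm_eq_inner)

lemma vconj_add: "vconj (x + y) = vconj x + vconj y" and vconj_scaleR: "vconj (r *\<^sub>R x) = r *\<^sub>R vconj x"
  using linear_add linear_scale linear_neg vrefl_linear unfolding vconj_def by blast+

lemma vec_vconj_polar: "vec_clif x * vec_clif (vconj y) + vec_clif y * vec_clif (vconj x) = (2 * (x \<bullet> y)) *\<^sub>R (1 :: 'n::{finite,linorder} clif)"
  using vec_mult_vconj[of "x + y"]
  by (simp add: vec_add vconj_add algebra_simps vec_mult_vconj inner_commute flip: scaleR_2)

text \<open>The polarised identity moves v past x, and then the conjugate of v times v is a scalar.
  The conjugation of x left over is why one factor of a Clifford group element amounts to two
  reflections.\<close>

lemma vec_sandwich: "vec_clif v * vec_clif x * vec_clif v = vec_clif (vrefl v (vconj x))"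
proof -
  have "vec_clif v * vec_clif x = (2 * (v \<bullet> vconj x)) *\<^sub>R 1 - vec_clif (vconj x) * vec_clif (vconj v)"
    using vec_vconj_polar[of v "vconj x"] by (simp add: algebra_simps)
  then have "vec_clif v * vec_clif x * vec_clif v = (2 * (v \<bullet> vconj x)) *\<^sub>R vec_clif v - vec_clif (vconj x) * (vec_clif (vconj v) * vec_clif v)"
    by (simp only: left_diff_distrib mult.assoc mult_1_left mult_scaleR_left)
  then show ?thesis
    by (simp add: vconj_mult_vec vrefl_def vec_diff vec_scaleR inner_commute)
qed

definition vinv :: "(real, 'n::{finite,linorder}) vec \<Rightarrow> (real, 'n) vec" where
  "vinv x = (1 / (x \<bullet> x)) *\<^sub>R vconj x"

lemma vec_mult_vinv: "x \<noteq> 0 \<Longrightarrow> vec_clif x * vec_clif (vinv x) = 1"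
  by (simp add: vinv_def vec_scaleR vec_mult_vconj)

lemma vinv_mult_vec: "x \<noteq> 0 \<Longrightarrow> vec_clif (vinv x) * vec_clif x = 1"
  by (simp add: vinv_def vec_scaleR vconj_mult_vec)

lemma vinv_eq_0 [simp]: "vinv x = 0 \<longleftrightarrow> x = 0"
  by (simp add: vinv_def)

text \<open>In \<open>cl_norm_rev_prin\<close> the vector and its conjugate meet in the middle of
  the product and become the scalar (x,x).\<close>

lemma cl_norm_vec_mult: "cl_norm (Rep_clif (vec_clif x * a)) = norm x * cl_norm (Rep_clif a)"
proof -
  have "crev (cprin (vec_clif x * a)) * (vec_clif x * a) = crev (cprin a) * (vec_clif (vconj x) * vec_clif x) * a"
    by (simp add: cprin_mult crev_mult cprin_vec crev_simps mult.assoc)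
  also have "\<dots> = (x \<bullet> x) *\<^sub>R (crev (cprin a) * a)"
    by (simp add: vconj_mult_vec)
  finally have "(cl_norm (Rep_clif (vec_clif x * a)))\<^sup>2 = (norm x * cl_norm (Rep_clif a))\<^sup>2"
    unfolding power_mult_distrib cl_norm_rev_prin
    by (simp add: scaleR_clif.rep_eq cl_scale_def power2_norm_eq_inner)
  then show ?thesis
    by (simp add: cl_norm_def sum_nonneg)
qed

subsection \<open>The Clifford group\<close>

text \<open>The Clifford group built by one left factor at a time, so that inductions peel off the
  leftmost vector. \<open>clifford_group_Gam\<close> relates it to the given definition.\<close>

inductive_set Gam :: "'n::{finite,linorder} clif set" where
  one: "1 \<in> Gam"
| vec_mult: "x \<noteq> 0 \<Longrightarrow> a \<in> Gam \<Longrightarrow> vec_clif x * a \<in> Gam"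

lemma Gam_vec: "x \<noteq> 0 \<Longrightarrow> vec_clif x \<in> Gam"
  using Gam.vec_mult[OF _ Gam.one] by simp

lemma Gam_mult: "a \<in> Gam \<Longrightarrow> b \<in> Gam \<Longrightarrow> a * b \<in> Gam"
  by (induction rule: Gam.induct) (simp_all add: mult.assoc Gam.intros)

lemma Gam_crev: "a \<in> Gam \<Longrightarrow> crev a \<in> Gam"
proof (induction rule: Gam.induct)
  case one
  then show ?case by (simp add: crev_simps Gam.one)
next
  case (vec_mult x a)
  then show ?case by (simp add: crev_mult crev_simps Gam_mult Gam_vec)
qed

lemma Gam_inverse: "a \<in> Gam \<Longrightarrow> \<exists>b\<in>Gam. a * b = 1 \<and> b * a = 1"
proof (induction rule: Gam.induct)
  case one
  then show ?case by (intro bexI[of _ 1]) (auto intro: Gam.one)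
next
  case (vec_mult x a)
  then obtain b where b: "b \<in> Gam" "a * b = 1" "b * a = 1" by auto
  have "vec_clif x * a * (b * vec_clif (vinv x)) = vec_clif x * (a * b) * vec_clif (vinv x)"
    by (simp only: mult.assoc)
  then have "vec_clif x * a * (b * vec_clif (vinv x)) = 1"
    using b vec_mult_vinv[OF vec_mult(1)] by simp
  moreover have "b * vec_clif (vinv x) * (vec_clif x * a) = b * (vec_clif (vinv x) * vec_clif x) * a"
    by (simp only: mult.assoc)
  then have "b * vec_clif (vinv x) * (vec_clif x * a) = 1"
    using b vinv_mult_vec[OF vec_mult(1)] by simp
  moreover have "b * vec_clif (vinv x) \<in> Gam"
    using b vec_mult(1) by (intro Gam_mult Gam_vec) auto
  ultimately show ?case by blast
qed

lemma cl_norm_one [simp]: "cl_norm (Rep_clif (1 :: 'a::{finite,linorder} clif)) = 1"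
proof -
  have "(cl_norm (Rep_clif (1 :: 'a clif)))\<^sup>2 = 1"
    unfolding cl_norm_rev_prin by (simp add: cprin_simps crev_simps one_clif.rep_eq cl_one_def)
  then show ?thesis by (simp add: cl_norm_def sum_nonneg)
qed

lemma cl_norm_Gam_mult: "a \<in> Gam \<Longrightarrow> cl_norm (Rep_clif (a * b)) = cl_norm (Rep_clif a) * cl_norm (Rep_clif b)"
  by (induction rule: Gam.induct) (simp_all add: mult.assoc cl_norm_vec_mult)

lemma cl_norm_vec: "cl_norm (Rep_clif (vec_clif x)) = norm x"
  using cl_norm_vec_mult[of x 1] by simp

lemma cl_norm_uminus: "cl_norm (Rep_clif (- a)) = cl_norm (Rep_clif a)"
  by (simp add: uminus_clif.rep_eq cl_neg_def cl_norm_def)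

lemma cl_norm_Gam_pos: "a \<in> Gam \<Longrightarrow> cl_norm (Rep_clif a) > 0"
  by (induction rule: Gam.induct) (auto simp: cl_norm_vec_mult)

lemma Gam_nonzero: "a \<in> Gam \<Longrightarrow> a \<noteq> 0"
  using cl_norm_Gam_pos[of a] by (auto simp: zero_clif.rep_eq cl_norm_def)

text \<open>The innermost factor v turns x into another vector by \<open>vec_sandwich\<close>, hence
  the induction for all x.\<close>

lemma Gam_conj: "a \<in> Gam \<Longrightarrow> \<exists>y. crev a * vec_clif x * a = vec_clif y"
proof (induction arbitrary: x rule: Gam.induct)
  case one
  show ?case by (rule exI[of _ x]) (simp add: crev_simps)
next
  case (vec_mult v a)
  have "crev (vec_clif v * a) * vec_clif x * (vec_clif v * a) = crev a * (vec_clif v * vec_clif x * vec_clif v) * a"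
    by (simp add: crev_mult crev_simps mult.assoc)
  also have "\<dots> = crev a * vec_clif (vrefl v (vconj x)) * a" by (simp only: vec_sandwich)
  finally show ?case using vec_mult.IH[of "vrefl v (vconj x)"] by (simp only:)
qed

lemma foldr_cl_mult_in_Gam:
  assumes "\<forall>v\<in>set vs. v \<in> cl_vectors \<and> v \<noteq> (\<lambda>_. 0)"
  shows "foldr cl_mult vs cl_one \<in> Rep_clif ` Gam"
  using assms
proof (induction vs)
  case Nil
  have "Rep_clif (1 :: 'a clif) \<in> Rep_clif ` Gam" by (intro imageI Gam.one)
  then show ?case by (simp add: one_clif.rep_eq)
next
  case (Cons v vs)
  then have "foldr cl_mult vs cl_one \<in> Rep_clif ` Gam" by simp
  then obtain b where b: "b \<in> Gam" "foldr cl_mult vs cl_one = Rep_clif b" by blast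
  have "v \<in> cl_vectors" using Cons.prems by simp
  then obtain x where x: "v = vec_to_cl x" by (auto simp: cl_vectors_def)
  have "x \<noteq> 0"
  proof
    assume "x = 0"
    then have "v = Rep_clif (vec_clif 0)" by (simp only: x vec_clif.rep_eq)
    then show False using Cons.prems by (simp add: zero_clif.rep_eq)
  qed
  then have "Rep_clif (vec_clif x * b) \<in> Rep_clif ` Gam" using b by (intro imageI Gam.vec_mult)
  then show ?case by (simp add: times_clif.rep_eq vec_clif.rep_eq b x)
qed

lemma Gam_clifford_group: "a \<in> Gam \<Longrightarrow> Rep_clif a \<in> clifford_group"
proof (induction rule: Gam.induct)
  case one
  show ?case unfolding clifford_group_def mem_Collect_eq
    by (rule exI[of _ "[]"]) (simp add: one_clif.rep_eq)
next
  case (vec_mult x a)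
  from vec_mult.IH obtain vs
    where vs: "Rep_clif a = foldr cl_mult vs cl_one" "\<forall>v\<in>set vs. v \<in> cl_vectors \<and> v \<noteq> (\<lambda>_. 0)"
    unfolding clifford_group_def mem_Collect_eq by blast
  have "vec_to_cl x \<noteq> (\<lambda>_. 0)"
    using vec_mult.hyps(1) unfolding vec_eq_0[of x, symmetric] Rep_clif_inject[symmetric] vec_clif.rep_eq zero_clif.rep_eq .
  then show ?case using vs unfolding clifford_group_def mem_Collect_eq
    by (intro exI[of _ "vec_to_cl x # vs"]) (simp add: times_clif.rep_eq vec_clif.rep_eq cl_vectors_def)
qed

lemma clifford_group_Gam: "clifford_group = Rep_clif ` Gam"
proof (intro equalityI subsetI)
  fix a :: "'a cl" assume "a \<in> clifford_group"
  then obtain vs where "a = foldr cl_mult vs cl_one" "\<forall>v\<in>set vs. v \<in> cl_vectors \<and> v \<noteq> (\<lambda>_. 0)"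
    unfolding clifford_group_def mem_Collect_eq by blast
  then show "a \<in> Rep_clif ` Gam" using foldr_cl_mult_in_Gam by blast
qed (use Gam_clifford_group in blast)

text \<open>\<open>cl_inv\<close> describes a right inverse; that b is also a left inverse makes it
  unique.\<close>

lemma cl_inv_Rep:
  assumes "a * b = 1" "b * a = (1 :: 'n::{finite,linorder} clif)"
  shows "cl_inv (Rep_clif a) = Rep_clif b"
  unfolding cl_inv_def
proof (rule the_equality)
  show "cl_elem (Rep_clif b) \<and> cl_mult (Rep_clif a) (Rep_clif b) = cl_one"
    using assms Rep_clif[of b] by (simp flip: times_clif.rep_eq one_clif.rep_eq)
next
  fix c assume c: "cl_elem c \<and> cl_mult (Rep_clif a) c = cl_one"
  then have "a * Abs_clif c = 1"
    by (simp flip: Rep_clif_inject add: times_clif.rep_eq one_clif.rep_eq Abs_clif_inverse)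
  then have "b * a * Abs_clif c = b" by (simp add: mult.assoc)
  then have "Abs_clif c = b" using assms by simp
  then show "c = Rep_clif b" using c by (metis Abs_clif_inverse mem_Collect_eq)
qed

section \<open>Differential calculus on open sets\<close>

lemma partial_has_derivative:
  fixes f :: "(real, 'n::finite) vec \<Rightarrow> 'b::real_normed_vector"
  assumes "(f has_derivative f') (at x)"
  shows "partial j f x = f' (axis j 1)"
proof -
  have "((\<lambda>t. x + t *\<^sub>R axis j 1) has_derivative (\<lambda>t. t *\<^sub>R axis j (1::real))) (at 0)"
    by (auto intro!: derivative_eq_intros)
  from has_derivative_compose[OF this, of f f'] assms
  have "((\<lambda>t. f (x + t *\<^sub>R axis j 1)) has_derivative (\<lambda>t. f' (t *\<^sub>R axis j 1))) (at 0)"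
    by simp
  moreover have "f' (t *\<^sub>R axis j 1) = t *\<^sub>R f' (axis j 1)" for t
    using has_derivative_bounded_linear[OF assms] by (simp add: linear_simps)
  ultimately have "((\<lambda>t. f (x + t *\<^sub>R axis j 1)) has_vector_derivative f' (axis j 1)) (at 0)"
    by (simp add: has_vector_derivative_def)
  then show ?thesis unfolding partial_def by (rule vector_derivative_at)
qed

lemma vec_axis_expansion: "h = (\<Sum>j\<in>UNIV. h $ j *\<^sub>R axis j (1::real))"
  using basis_expansion[of h] by (simp add: scalar_mult_eq_scaleR)

lemma has_derivative_partials:
  fixes f :: "(real, 'n::finite) vec \<Rightarrow> 'b::real_normed_vector"
  assumes "f differentiable (at x)"
  shows "(f has_derivative (\<lambda>h. \<Sum>j\<in>UNIV. h $ j *\<^sub>R partial j f x)) (at x)"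
proof -
  obtain f' where f': "(f has_derivative f') (at x)" using assms by (auto simp: differentiable_def)
  interpret bounded_linear f' using f' by (rule has_derivative_bounded_linear)
  have "f' h = (\<Sum>j\<in>UNIV. h $ j *\<^sub>R partial j f x)" for h
  proof -
    have "f' h = f' (\<Sum>j\<in>UNIV. h $ j *\<^sub>R axis j 1)" using vec_axis_expansion[of h] by simp
    then show ?thesis by (simp add: sum scaleR partial_has_derivative[OF f'])
  qed
  then show ?thesis using f' by (metis (no_types, lifting) ext)
qed

lemma partial_cong_open:
  fixes f :: "(real, 'n::finite) vec \<Rightarrow> 'b::real_normed_vector"
  assumes "open S" "x \<in> S" "\<And>y. y \<in> S \<Longrightarrow> f y = g y"
  shows "partial j f x = partial j g x"
proof -
  have "((\<lambda>t. x + t *\<^sub>R axis j 1) \<longlongrightarrow> x + 0 *\<^sub>R axis j 1) (nhds (0::real))"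
    by (intro tendsto_intros filterlim_ident)
  then have "\<forall>\<^sub>F t in nhds (0::real). x + t *\<^sub>R axis j 1 \<in> S"
    using assms(1,2) by (simp add: tendsto_def)
  then have ev: "\<forall>\<^sub>F t in nhds (0::real). f (x + t *\<^sub>R axis j 1) = g (x + t *\<^sub>R axis j 1)"
    by eventually_elim (rule assms(3))
  show ?thesis
    unfolding partial_def by (rule vector_derivative_cong_eq) (use ev in auto)
qed

text \<open>Works on subsets and demands total differentiability at every order, so that the product
  and chain rules apply directly; \<open>Ck\<close> speaks of continuous partial derivatives on the
  whole space.\<close>

fun kdiff :: "nat \<Rightarrow> (real, 'n::finite) vec set \<Rightarrow> ((real, 'n) vec \<Rightarrow> 'b::real_normed_vector) \<Rightarrow> bool" where
  "kdiff 0 S f \<longleftrightarrow> True"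
| "kdiff (Suc k) S f \<longleftrightarrow> (\<forall>x\<in>S. f differentiable (at x)) \<and> (\<forall>j. kdiff k S (partial j f))"

lemma kdiff_cong:
  assumes "open S" "\<And>x. x \<in> S \<Longrightarrow> f x = g x" "kdiff k S f"
  shows "kdiff k S g"
  using assms(2,3)
proof (induction k arbitrary: f g)
  case (Suc k)
  have "g differentiable (at x)" if "x \<in> S" for x
  proof -
    obtain f' where "(f has_derivative f') (at x)"
      using Suc.prems(2) \<open>x \<in> S\<close> by (auto simp: differentiable_def)
    then have "(g has_derivative f') (at x)"
      by (rule has_derivative_transform_within_open[OF _ assms(1) that]) (use Suc.prems in auto)
    then show ?thesis by (auto simp: differentiable_def)
  qed
  moreover have "kdiff k S (partial j g)" for j
    by (rule Suc.IH[of "partial j f"]) (use Suc.prems partial_cong_open[OF assms(1), of _ f g] in auto)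
  ultimately show ?case by simp
qed simp

lemma kdiff_Suc_imp: "kdiff (Suc k) S f \<Longrightarrow> kdiff k S f"
  by (induction k arbitrary: f) auto

lemma kdiff_subset: "kdiff k S f \<Longrightarrow> T \<subseteq> S \<Longrightarrow> kdiff k T f"
  by (induction k arbitrary: f) auto

lemma partial_const: "partial j (\<lambda>_. v) = (\<lambda>_. 0)"
  by (rule ext, subst partial_has_derivative) (auto intro: has_derivative_const)

lemma kdiff_const: "kdiff k S (\<lambda>_. v)"
  by (induction k arbitrary: v) (auto simp: partial_const)

lemma kdiff_linear:
  assumes "bounded_linear L" "open S" "kdiff k S f"
  shows "kdiff k S (\<lambda>x. L (f x))"
  using assms(3)
proof (induction k arbitrary: f)
  case (Suc k)
  have d: "((\<lambda>x. L (f x)) has_derivative (\<lambda>h. L (\<Sum>j\<in>UNIV. h $ j *\<^sub>R partial j f x))) (at x)" if "x \<in> S" for x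
    using bounded_linear.has_derivative[OF assms(1) has_derivative_partials[of f x]] that Suc.prems by simp
  interpret L: bounded_linear L by fact
  have "kdiff k S (partial j (\<lambda>x. L (f x)))" for j
  proof (rule kdiff_cong[OF assms(2)])
    show "kdiff k S (\<lambda>x. L (partial j f x))" using Suc by simp
    fix x assume "x \<in> S"
    then have "((\<lambda>x. L (f x)) has_derivative (\<lambda>h. L (\<Sum>j\<in>UNIV. h $ j *\<^sub>R partial j f x))) (at x)" by (rule d)
    from partial_has_derivative[OF this]
    show "L (partial j f x) = partial j (\<lambda>x. L (f x)) x"
      by (simp add: axis_def if_distrib[of "\<lambda>r. r *\<^sub>R _"] cong: if_cong)
  qed
  moreover have "(\<lambda>x. L (f x)) differentiable (at x)" if "x \<in> S" for x
    using d[OF that] by (auto simp: differentiable_def)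
  ultimately show ?case by simp
qed simp

lemma kdiff_add:
  assumes "open S" "kdiff k S f" "kdiff k S g"
  shows "kdiff k S (\<lambda>x. f x + g x)"
  using assms(2,3)
proof (induction k arbitrary: f g)
  case (Suc k)
  have "kdiff k S (partial j (\<lambda>x. f x + g x))" for j
  proof (rule kdiff_cong[OF assms(1)])
    show "kdiff k S (\<lambda>x. partial j f x + partial j g x)" using Suc by simp
    fix x assume "x \<in> S"
    then obtain f' g' where *: "(f has_derivative f') (at x)" "(g has_derivative g') (at x)"
      using Suc.prems by (auto simp: differentiable_def) blast
    show "partial j f x + partial j g x = partial j (\<lambda>x. f x + g x) x"
      using partial_has_derivative[OF has_derivative_add[OF *]] partial_has_derivative[OF *(1)] partial_has_derivative[OF *(2)]
      by simp
  qed
  then show ?case using Suc.prems by (auto intro: differentiable_add)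
qed simp

lemma kdiff_sum:
  assumes "open S" "\<And>i. i \<in> I \<Longrightarrow> kdiff k S (f i)"
  shows "kdiff k S (\<lambda>x. \<Sum>i\<in>I. f i x)"
  using assms(2) by (induction I rule: infinite_finite_induct) (auto intro: kdiff_const kdiff_add[OF assms(1)])

lemma kdiff_bilinear:
  assumes "bounded_bilinear h" "open S" "kdiff k S f" "kdiff k S g"
  shows "kdiff k S (\<lambda>x. h (f x) (g x))"
  using assms(3,4)
proof (induction k arbitrary: f g)
  case (Suc k)
  interpret bounded_bilinear h by fact
  have "kdiff k S (partial j (\<lambda>x. h (f x) (g x)))" for j
  proof (rule kdiff_cong[OF assms(2)])
    have "kdiff k S f" "kdiff k S g" using Suc.prems kdiff_Suc_imp by blast+
    then show "kdiff k S (\<lambda>x. h (f x) (partial j g x) + h (partial j f x) (g x))"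
      using Suc by (intro kdiff_add assms) auto
    fix x assume "x \<in> S"
    then obtain f' g' where *: "(f has_derivative f') (at x)" "(g has_derivative g') (at x)"
      using Suc.prems by (auto simp: differentiable_def) blast
    show "h (f x) (partial j g x) + h (partial j f x) (g x) = partial j (\<lambda>x. h (f x) (g x)) x"
      using partial_has_derivative[OF FDERIV[OF *]] partial_has_derivative[OF *(1)] partial_has_derivative[OF *(2)]
      by simp
  qed
  moreover have "(\<lambda>x. h (f x) (g x)) differentiable (at x)" if "x \<in> S" for x
    using Suc.prems that FDERIV by (auto simp: differentiable_def) blast
  ultimately show ?case by simp
qed simp

text \<open>A partial derivative of the composite is a sum of products of components of
  \<open>partial j \<phi>\<close> with \<open>partial i f\<close> after \<phi>; the second factor
  falls under the induction hypothesis.\<close>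

lemma kdiff_compose:
  fixes \<phi> :: "(real, 'n::finite) vec \<Rightarrow> (real, 'm::finite) vec"
  assumes "open S" "open T" "\<And>x. x \<in> S \<Longrightarrow> \<phi> x \<in> T" "\<And>k. kdiff k S \<phi>" "kdiff k T f"
  shows "kdiff k S (\<lambda>x. f (\<phi> x))"
  using assms(5)
proof (induction k arbitrary: f)
  case (Suc k)
  have d: "((\<lambda>x. f (\<phi> x)) has_derivative (\<lambda>h. \<Sum>i\<in>UNIV. (\<Sum>j\<in>UNIV. h $ j *\<^sub>R partial j \<phi> x) $ i *\<^sub>R partial i f (\<phi> x))) (at x)"
    if "x \<in> S" for x
  proof -
    have "kdiff (Suc 0) S \<phi>" by (rule assms)
    then have "\<phi> differentiable (at x)" using that by simp
    moreover have "f differentiable (at (\<phi> x))" using that assms(3) Suc.prems by auto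
    ultimately show ?thesis
      using has_derivative_compose[OF has_derivative_partials[of \<phi> x] has_derivative_partials[of f "\<phi> x"]]
      by simp
  qed
  have "kdiff k S (partial j (\<lambda>x. f (\<phi> x)))" for j
  proof (rule kdiff_cong[OF assms(1)])
    have "kdiff (Suc k) S \<phi>" by (rule assms)
    then have "kdiff k S (partial j \<phi>)" by simp
    then have "kdiff k S (\<lambda>x. partial j \<phi> x $ i)" for i
      by (rule kdiff_linear[OF bounded_linear_vec_nth assms(1)])
    moreover have "kdiff k S (\<lambda>x. partial i f (\<phi> x))" for i
      using Suc by simp
    ultimately show "kdiff k S (\<lambda>x. \<Sum>i\<in>UNIV. partial j \<phi> x $ i *\<^sub>R partial i f (\<phi> x))"
      by (intro kdiff_sum kdiff_bilinear[OF bounded_bilinear_scaleR] assms(1))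
    fix x assume "x \<in> S"
    from partial_has_derivative[OF d[OF this], of j]
    show "(\<Sum>i\<in>UNIV. partial j \<phi> x $ i *\<^sub>R partial i f (\<phi> x)) = partial j (\<lambda>x. f (\<phi> x)) x"
      by (simp add: axis_def if_distrib[of "\<lambda>r. r *\<^sub>R _"] cong: if_cong)
  qed
  moreover have "(\<lambda>x. f (\<phi> x)) differentiable (at x)" if "x \<in> S" for x
    using d[OF that] by (auto simp: differentiable_def)
  ultimately show ?case by simp
qed simp

lemma kdiff_id: "open S \<Longrightarrow> kdiff k S (\<lambda>x. x)"
proof (cases k)
  case (Suc l)
  have "partial j (\<lambda>x. x) = (\<lambda>_. axis j 1)" for j :: 'a
    by (rule ext, subst partial_has_derivative) (auto intro: has_derivative_ident)
  then show ?thesis using Suc by (simp add: kdiff_const)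
qed simp

text \<open>The increment is taken one coordinate at a time, and each one-dimensional step is
  linearised with an error controlled by the continuity of the partial derivatives at x.\<close>

lemma differentiable_continuous_partials:
  fixes f :: "(real, 'n::finite) vec \<Rightarrow> 'b::real_normed_vector"
  assumes ex: "\<And>j x. (\<lambda>t. f (x + t *\<^sub>R axis j 1)) differentiable (at 0)"
    and cont: "\<And>j. continuous_on UNIV (partial j f)"
  shows "f differentiable (at x)"
proof -
  have vd: "((\<lambda>t. f (y + t *\<^sub>R axis j 1)) has_vector_derivative partial j f (y + s *\<^sub>R axis j 1)) (at s within U)" for y j s U
  proof -
    have "((\<lambda>t. f ((y + s *\<^sub>R axis j 1) + t *\<^sub>R axis j 1)) has_vector_derivative partial j f (y + s *\<^sub>R axis j 1)) (at 0)"
      unfolding partial_def using ex vector_derivative_works by blast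
    moreover have "((\<lambda>t. t - s) has_vector_derivative 1) (at s)"
      by (auto intro!: derivative_eq_intros)
    ultimately have "(((\<lambda>t. f ((y + s *\<^sub>R axis j 1) + t *\<^sub>R axis j 1)) \<circ> (\<lambda>t. t - s)) has_vector_derivative 1 *\<^sub>R partial j f (y + s *\<^sub>R axis j 1)) (at s)"
      by (intro vector_diff_chain_at) auto
    then show ?thesis
      by (auto simp: o_def algebra_simps scaleR_diff_left intro: has_vector_derivative_at_within)
  qed
  have "(f has_derivative (\<lambda>h. \<Sum>j\<in>UNIV. h $ j *\<^sub>R partial j f x)) (at x)"
    unfolding has_derivative_at_alt
  proof (intro conjI allI impI)
    show "bounded_linear (\<lambda>h. \<Sum>j\<in>UNIV. h $ j *\<^sub>R partial j f x)"
      by (intro bounded_linear_sum bounded_linear_scaleR_const bounded_linear_vec_nth)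
    fix e :: real assume "0 < e"
    \<comment> \<open>The step in direction i costs 3 * \<open>e1\<close> times |h_i|: twice
      \<open>e1\<close> for linearising at the start of the segment, once for replacing the
      derivative there by the one at x. Each |h_i| is at most |h|, and there are n of them.\<close>
    define e1 where "e1 = e / (3 * real CARD('n))"
    have e1: "e1 > 0" using \<open>0 < e\<close> by (simp add: e1_def)
    have "\<exists>d>0. \<forall>y. dist y x < d \<longrightarrow> dist (partial j f y) (partial j f x) < e1" for j
      using cont[of j] e1 unfolding continuous_on_iff by auto
    then obtain d where d: "\<And>j. d j > 0" "\<And>j y. dist y x < d j \<Longrightarrow> dist (partial j f y) (partial j f x) < e1"
      by metis
    define \<delta> where "\<delta> = Min (range d)"
    have \<delta>: "\<delta> > 0" using d(1) by (simp add: \<delta>_def)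
    have near: "norm (partial j f (x + h) - partial j f x) \<le> e1" if "norm h < \<delta>" for h j
    proof -
      have "\<delta> \<le> d j" by (simp add: \<delta>_def)
      then show ?thesis using d(2)[of "x + h" j] that by (simp add: dist_norm less_imp_le)
    qed
    have "norm (f y - f x - (\<Sum>j\<in>UNIV. (y - x) $ j *\<^sub>R partial j f x)) \<le> e * norm (y - x)"
      if y: "norm (y - x) < \<delta>" for y
    proof -
      define h where "h = y - x"
      \<comment> \<open>The increment restricted to the coordinates in J. Induction over finite sets
        J lets the coordinates be added in any order.\<close>
      define hJ where "hJ J = (\<chi> j. if j \<in> J then h $ j else 0)" for J
      have hJ_le: "norm (hJ J + t *\<^sub>R axis i 1) < \<delta>" if "i \<notin> J" "\<bar>t\<bar> \<le> \<bar>h $ i\<bar>" for J i t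
      proof -
        have "norm (hJ J + t *\<^sub>R axis i 1) \<le> norm h"
          by (rule norm_le_componentwise_cart) (use that in \<open>auto simp: hJ_def axis_def\<close>)
        then show ?thesis using y by (simp add: h_def)
      qed
      have "norm (f (x + hJ J) - f x - (\<Sum>j\<in>J. h $ j *\<^sub>R partial j f x)) \<le> 3 * e1 * (\<Sum>j\<in>J. \<bar>h $ j\<bar>)" for J
        using finite[of J]
      proof (induction J)
        case empty
        have "hJ {} = 0" by (simp add: hJ_def vec_eq_iff)
        then show ?case by simp
      next
        case (insert i J)
        have ins: "hJ (insert i J) = hJ J + h $ i *\<^sub>R axis i 1"
          using insert.hyps by (auto simp: hJ_def vec_eq_iff axis_def)
        let ?g = "\<lambda>t. f (x + hJ J + t *\<^sub>R axis i 1)"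
        let ?g' = "\<lambda>t. partial i f (x + hJ J + t *\<^sub>R axis i 1)"
        have g'near: "norm (?g' t - partial i f x) \<le> e1" if "t \<in> closed_segment 0 (h $ i)" for t
        proof -
          have "\<bar>t\<bar> \<le> \<bar>h $ i\<bar>" using that by (auto simp: closed_segment_eq_real_ivl split: if_splits)
          from near[OF hJ_le[OF insert.hyps(2) this]] show ?thesis by (simp add: add.assoc)
        qed
        have "norm (?g (h $ i) - ?g 0 - (h $ i - 0) *\<^sub>R ?g' 0) \<le> norm (h $ i - 0) * (2 * e1)"
        proof (rule vector_differentiable_bound_linearization[where f = ?g and f' = ?g' and ?x0.0 = 0 and S = "closed_segment 0 (h $ i)"])
          show "(?g has_vector_derivative ?g' t) (at t within closed_segment 0 (h $ i))" for t by (rule vd)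
          show "norm (?g' t - ?g' 0) \<le> 2 * e1" if "t \<in> closed_segment 0 (h $ i)" for t
            using g'near[OF that] g'near[of 0] norm_triangle_ineq4[of "?g' t - partial i f x" "?g' 0 - partial i f x"]
            by simp
        qed auto
        then have 1: "norm (f (x + hJ (insert i J)) - f (x + hJ J) - h $ i *\<^sub>R ?g' 0) \<le> 2 * e1 * \<bar>h $ i\<bar>"
          by (simp add: ins add.assoc mult.commute)
        have 2: "norm (h $ i *\<^sub>R ?g' 0 - h $ i *\<^sub>R partial i f x) \<le> e1 * \<bar>h $ i\<bar>"
          using mult_left_mono[OF g'near[of 0], of "\<bar>h $ i\<bar>"]
          by (simp add: mult.commute flip: scaleR_diff_right)
        have "f (x + hJ (insert i J)) - f x - (\<Sum>j\<in>insert i J. h $ j *\<^sub>R partial j f x) =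
          (f (x + hJ (insert i J)) - f (x + hJ J) - h $ i *\<^sub>R ?g' 0) + (h $ i *\<^sub>R ?g' 0 - h $ i *\<^sub>R partial i f x)
          + (f (x + hJ J) - f x - (\<Sum>j\<in>J. h $ j *\<^sub>R partial j f x))"
          using insert.hyps by simp
        also have "norm \<dots> \<le> 2 * e1 * \<bar>h $ i\<bar> + e1 * \<bar>h $ i\<bar> + 3 * e1 * (\<Sum>j\<in>J. \<bar>h $ j\<bar>)"
          using 1 2 insert.IH by (intro norm_triangle_mono)
        finally show ?case using insert.hyps by (simp add: algebra_simps)
      qed
      moreover have "x + hJ UNIV = y" by (simp add: hJ_def h_def vec_eq_iff)
      ultimately have "norm (f y - f x - (\<Sum>j\<in>UNIV. (y - x) $ j *\<^sub>R partial j f x)) \<le> 3 * e1 * (\<Sum>j\<in>UNIV. \<bar>h $ j\<bar>)"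
        unfolding h_def by metis
      also have "\<dots> \<le> 3 * e1 * (\<Sum>j\<in>(UNIV::'n set). norm h)"
        using e1 by (intro mult_left_mono sum_mono component_le_norm_cart) auto
      also have "\<dots> = e * norm (y - x)" by (simp add: e1_def h_def)
      finally show ?thesis .
    qed
    then show "\<exists>d>0. \<forall>y. norm (y - x) < d \<longrightarrow> norm (f y - f x - (\<Sum>j\<in>UNIV. (y - x) $ j *\<^sub>R partial j f x)) \<le> e * norm (y - x)"
      using \<delta> by blast
  qed
  then show ?thesis by (auto simp: differentiable_def)
qed

lemma Ck_imp_kdiff: "Ck (Suc k) f \<Longrightarrow> kdiff (Suc k) UNIV f"
proof (induction k arbitrary: f)
  case 0
  then show ?case by (auto intro: differentiable_continuous_partials)
next
  case (Suc k)
  then have "\<And>j. continuous_on UNIV (partial j f)" by simp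
  then have "f differentiable (at x)" for x
    using Suc.prems by (intro differentiable_continuous_partials) auto
  moreover have "kdiff (Suc k) UNIV (partial j f)" for j
    using Suc.prems by (intro Suc.IH) simp
  ultimately show ?case by simp
qed

subsection \<open>Symmetry of second derivatives\<close>

text \<open>The mean value theorem in direction u turns the second difference into an increment of
  g, which is then linearised at x. As the quotient is symmetric in u and v, the limit gives the
  symmetry of second derivatives.\<close>

lemma second_difference_tendsto:
  fixes f :: "'a::real_normed_vector \<Rightarrow> real"
  assumes "open S" "x \<in> S"
    and f: "\<And>y. y \<in> S \<Longrightarrow> ((\<lambda>t. f (y + t *\<^sub>R u)) has_real_derivative g y) (at 0)"
    and g: "(g has_derivative A) (at x)"
  shows "((\<lambda>h. (f (x + h *\<^sub>R u + h *\<^sub>R v) - f (x + h *\<^sub>R u) - f (x + h *\<^sub>R v) + f x) / h\<^sup>2) \<longlongrightarrow> A v) (at_right 0)"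
proof (rule tendstoI)
  fix e :: real assume "0 < e"
  \<comment> \<open>The two linearisations of g below have errors proportional to |u| + |v| and |u|;
    N bounds their sum and stays positive if both vectors vanish.\<close>
  define N where "N = 2 * norm u + norm v + 1"
  have N: "N > 0" by (simp add: N_def add_nonneg_pos)
  define e1 where "e1 = e / (2 * N)"
  have e1: "e1 > 0" "e1 * N < e" using N \<open>0 < e\<close> by (auto simp: e1_def)
  interpret A: bounded_linear A using g by (rule has_derivative_bounded_linear)
  obtain d1 where d1: "d1 > 0" "\<And>y. norm (y - x) < d1 \<Longrightarrow> norm (g y - g x - A (y - x)) \<le> e1 * norm (y - x)"
    using g e1(1) unfolding has_derivative_at_alt by metis
  obtain d2 where d2: "d2 > 0" "ball x d2 \<subseteq> S" using assms(1,2) openE by blast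
  define d where "d = min d1 d2 / N"
  have d: "d > 0" using d1 d2 N by (simp add: d_def)
  have "dist ((f (x + h *\<^sub>R u + h *\<^sub>R v) - f (x + h *\<^sub>R u) - f (x + h *\<^sub>R v) + f x) / h\<^sup>2) (A v) < e"
    if h: "0 < h" "h < d" for h
  proof -
    have hN: "h * N < min d1 d2" using h N by (simp add: d_def pos_less_divide_eq)
    have small: "norm (s *\<^sub>R u) \<le> h * norm u" "norm (s *\<^sub>R u + h *\<^sub>R v) \<le> h * (norm u + norm v)" if "0 \<le> s" "s \<le> h" for s
    proof -
      show *: "norm (s *\<^sub>R u) \<le> h * norm u" using that by (simp add: mult_right_mono)
      have "norm (s *\<^sub>R u + h *\<^sub>R v) \<le> norm (s *\<^sub>R u) + norm (h *\<^sub>R v)" by (rule norm_triangle_ineq)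
      then show "norm (s *\<^sub>R u + h *\<^sub>R v) \<le> h * (norm u + norm v)" using * h by (simp add: algebra_simps)
    qed
    have le: "h * norm u < min d1 d2" "h * (norm u + norm v) < min d1 d2"
    proof -
      have "h * norm u \<le> h * N" "h * (norm u + norm v) \<le> h * N"
        using h by (auto intro!: mult_left_mono simp: N_def add_increasing)
      then show "h * norm u < min d1 d2" "h * (norm u + norm v) < min d1 d2" using hN by linarith+
    qed
    have inS: "x + s *\<^sub>R u \<in> S" "x + s *\<^sub>R u + h *\<^sub>R v \<in> S" if "0 \<le> s" "s \<le> h" for s
    proof -
      have "dist x (x + s *\<^sub>R u) < d2" using small[OF that] le by (simp add: dist_norm)
      moreover have "dist x (x + s *\<^sub>R u + h *\<^sub>R v) < d2"
        using small(2)[OF that] le norm_minus_cancel[of "s *\<^sub>R u + h *\<^sub>R v"]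
        by (simp add: dist_norm add.assoc del: norm_minus_cancel)
      ultimately show "x + s *\<^sub>R u \<in> S" "x + s *\<^sub>R u + h *\<^sub>R v \<in> S" using d2(2) by auto
    qed
    have line: "((\<lambda>t. f (y + t *\<^sub>R u)) has_real_derivative g (y + s *\<^sub>R u)) (at s)" if "y + s *\<^sub>R u \<in> S" for y s
    proof -
      have "((\<lambda>t. t - s) has_real_derivative 1) (at s)" by (auto intro!: derivative_eq_intros)
      from DERIV_chain2[of "\<lambda>t. f (y + s *\<^sub>R u + t *\<^sub>R u)", OF _ this] f[OF that]
      show ?thesis by (simp add: algebra_simps scaleR_diff_left)
    qed
    define \<phi> where "\<phi> s = f (x + h *\<^sub>R v + s *\<^sub>R u) - f (x + s *\<^sub>R u)" for s
    have "\<exists>s>0. s < h \<and> \<phi> h - \<phi> 0 = (h - 0) * (g (x + h *\<^sub>R v + s *\<^sub>R u) - g (x + s *\<^sub>R u))"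
    proof (rule MVT2)
      fix s assume "0 \<le> s" "s \<le> h"
      from inS[OF this] show "(\<phi> has_real_derivative g (x + h *\<^sub>R v + s *\<^sub>R u) - g (x + s *\<^sub>R u)) (at s)"
        unfolding \<phi>_def by (intro DERIV_diff line) (simp_all add: add.commute add.left_commute)
    qed (use h in simp)
    then obtain s where s: "0 < s" "s < h" "\<phi> h - \<phi> 0 = h * (g (x + h *\<^sub>R v + s *\<^sub>R u) - g (x + s *\<^sub>R u))"
      by auto
    have 1: "norm (g (x + h *\<^sub>R v + s *\<^sub>R u) - g x - A (s *\<^sub>R u + h *\<^sub>R v)) \<le> e1 * (h * (norm u + norm v))"
    proof -
      have "norm (g (x + h *\<^sub>R v + s *\<^sub>R u) - g x - A (s *\<^sub>R u + h *\<^sub>R v)) \<le> e1 * norm (s *\<^sub>R u + h *\<^sub>R v)"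
        using d1(2)[of "x + h *\<^sub>R v + s *\<^sub>R u"] small(2)[of s] le s by (simp add: algebra_simps)
      also have "\<dots> \<le> e1 * (h * (norm u + norm v))" using small(2)[of s] s e1 by (intro mult_left_mono) auto
      finally show ?thesis .
    qed
    have 2: "norm (g (x + s *\<^sub>R u) - g x - A (s *\<^sub>R u)) \<le> e1 * (h * norm u)"
    proof -
      have "norm (g (x + s *\<^sub>R u) - g x - A (s *\<^sub>R u)) \<le> e1 * norm (s *\<^sub>R u)"
        using d1(2)[of "x + s *\<^sub>R u"] small(1)[of s] le s by simp
      also have "\<dots> \<le> e1 * (h * norm u)" using small(1)[of s] s e1 by (intro mult_left_mono) auto
      finally show ?thesis .
    qed
    \<comment> \<open>The unknown intermediate point s drops out here, since A is linear.\<close>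
    have "\<bar>(g (x + h *\<^sub>R v + s *\<^sub>R u) - g (x + s *\<^sub>R u)) - h * A v\<bar> \<le> e1 * (h * (2 * norm u + norm v))"
      using 1 2 by (simp add: A.add A.scaleR algebra_simps abs_le_iff)
    also have "\<dots> \<le> h * (e1 * N)" using h e1 by (simp add: N_def algebra_simps)
    also have "\<dots> < h * e" using h e1 by simp
    finally have lt: "\<bar>(g (x + h *\<^sub>R v + s *\<^sub>R u) - g (x + s *\<^sub>R u)) - h * A v\<bar> < h * e" .
    have "(\<phi> h - \<phi> 0) - h\<^sup>2 * A v = h * ((g (x + h *\<^sub>R v + s *\<^sub>R u) - g (x + s *\<^sub>R u)) - h * A v)"
      unfolding s(3) by (simp add: power2_eq_square algebra_simps)
    then have "\<bar>(\<phi> h - \<phi> 0) - h\<^sup>2 * A v\<bar> < h\<^sup>2 * e"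
      using h lt by (simp add: power2_eq_square abs_mult)
    then have "\<bar>(\<phi> h - \<phi> 0) / h\<^sup>2 - A v\<bar> < e"
      using h by (simp add: field_simps abs_if split: if_splits)
    moreover have "\<phi> h - \<phi> 0 = f (x + h *\<^sub>R u + h *\<^sub>R v) - f (x + h *\<^sub>R u) - f (x + h *\<^sub>R v) + f x"
      by (simp add: \<phi>_def algebra_simps)
    ultimately show ?thesis by (simp add: dist_real_def)
  qed
  then show "\<forall>\<^sub>F h in at_right 0. dist ((f (x + h *\<^sub>R u + h *\<^sub>R v) - f (x + h *\<^sub>R u) - f (x + h *\<^sub>R v) + f x) / h\<^sup>2) (A v) < e"
    using d unfolding eventually_at_right_field by blast
qed

text \<open>Argued for each real component, because the mean value theorem is used. The same second
  difference has both mixed derivatives as its limit.\<close>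

lemma partial_commute:
  fixes f :: "(real, 'n::finite) vec \<Rightarrow> 'b::euclidean_space"
  assumes "open S" "x \<in> S" "kdiff 2 S f"
  shows "partial i (partial j f) x = partial j (partial i f) x"
proof (rule euclidean_eqI)
  fix b :: 'b
  have "kdiff (Suc (Suc 0)) S f" using assms(3) by (simp add: numeral_2_eq_2)
  then have d: "\<And>y. y \<in> S \<Longrightarrow> f differentiable (at y)" "\<And>i y. y \<in> S \<Longrightarrow> partial i f differentiable (at y)"
    by auto
  let ?f = "\<lambda>y. f y \<bullet> b"
  have line: "((\<lambda>t. ?f (y + t *\<^sub>R axis i 1)) has_real_derivative partial i f y \<bullet> b) (at 0)" if y: "y \<in> S" for y i
  proof -
    obtain f' where f': "(f has_derivative f') (at y)" using d(1)[OF y] by (auto simp: differentiable_def)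
    interpret bounded_linear f' using f' by (rule has_derivative_bounded_linear)
    have l: "((\<lambda>t. y + t *\<^sub>R axis i 1) has_derivative (\<lambda>t. t *\<^sub>R axis i (1::real))) (at 0)"
      by (auto intro!: derivative_eq_intros)
    have "((\<lambda>t. f (y + t *\<^sub>R axis i 1)) has_derivative (\<lambda>t. f' (t *\<^sub>R axis i 1))) (at 0)"
      using has_derivative_compose[OF l, of f f'] f' by simp
    then have "((\<lambda>t. ?f (y + t *\<^sub>R axis i 1)) has_derivative (\<lambda>t. f' (t *\<^sub>R axis i 1) \<bullet> b)) (at 0)"
      by (rule has_derivative_inner_left)
    moreover have "(\<lambda>t. f' (t *\<^sub>R axis i 1) \<bullet> b) = (*) (partial i f y \<bullet> b)"
      by (rule ext) (simp add: scaleR partial_has_derivative[OF f'])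
    ultimately show ?thesis by (simp add: has_field_derivative_def)
  qed
  have deriv: "((\<lambda>y. partial i f y \<bullet> b) has_derivative (\<lambda>h. (\<Sum>j\<in>UNIV. h $ j *\<^sub>R partial j (partial i f) x) \<bullet> b)) (at x)" for i
    using d(2) assms(2) by (intro has_derivative_inner_left has_derivative_partials)
  have ax: "(\<Sum>j\<in>UNIV. axis k 1 $ j *\<^sub>R F j) = F k" for F :: "'n \<Rightarrow> 'b" and k
    by (simp add: axis_def if_distrib[of "\<lambda>r. r *\<^sub>R _"] cong: if_cong)
  let ?q = "\<lambda>u v h. (?f (x + h *\<^sub>R u + h *\<^sub>R v) - ?f (x + h *\<^sub>R u) - ?f (x + h *\<^sub>R v) + ?f x) / h\<^sup>2"
  have lim: "(?q (axis i 1) (axis j 1) \<longlongrightarrow> partial j (partial i f) x \<bullet> b) (at_right 0)" for i j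
    using second_difference_tendsto[OF assms(1,2) line deriv, of i "axis j 1"] by (simp add: ax)
  have "?q (axis j 1) (axis i 1) = ?q (axis i 1) (axis j 1)"
    by (rule ext) (simp add: algebra_simps)
  with lim[of i j] lim[of j i]
  show "partial i (partial j f) x \<bullet> b = partial j (partial i f) x \<bullet> b"
    by (metis (no_types, lifting) tendsto_unique trivial_limit_at_right_real)
qed

section \<open>Smooth functions on a set\<close>

definition smooth_on :: "(real, 'n::finite) vec set \<Rightarrow> ((real, 'n) vec \<Rightarrow> 'b::real_normed_vector) \<Rightarrow> bool" where
  "smooth_on S f \<longleftrightarrow> (\<forall>k. kdiff k S f)"

lemma smooth_on_differentiable: "smooth_on S f \<Longrightarrow> x \<in> S \<Longrightarrow> f differentiable (at x)"
  unfolding smooth_on_def using kdiff.simps(2)[of 0 S f] by blast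

lemma smooth_on_partial: "smooth_on S f \<Longrightarrow> smooth_on S (partial j f)"
  unfolding smooth_on_def by (metis kdiff.simps(2))

lemma smooth_on_subset: "smooth_on S f \<Longrightarrow> T \<subseteq> S \<Longrightarrow> smooth_on T f"
  unfolding smooth_on_def using kdiff_subset by blast

lemma smooth_on_linear: "bounded_linear L \<Longrightarrow> open S \<Longrightarrow> smooth_on S f \<Longrightarrow> smooth_on S (\<lambda>x. L (f x))"
  unfolding smooth_on_def using kdiff_linear[of L S _ f] by blast

lemma smooth_on_add: "open S \<Longrightarrow> smooth_on S f \<Longrightarrow> smooth_on S g \<Longrightarrow> smooth_on S (\<lambda>x. f x + g x)"
  unfolding smooth_on_def using kdiff_add[of S _ f g] by blast

lemma smooth_on_sum: "open S \<Longrightarrow> (\<And>i. i \<in> I \<Longrightarrow> smooth_on S (f i)) \<Longrightarrow> smooth_on S (\<lambda>x. \<Sum>i\<in>I. f i x)"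
  unfolding smooth_on_def using kdiff_sum[of S I _ f] by blast

lemma smooth_on_bilinear:
  "bounded_bilinear h \<Longrightarrow> open S \<Longrightarrow> smooth_on S f \<Longrightarrow> smooth_on S g \<Longrightarrow> smooth_on S (\<lambda>x. h (f x) (g x))"
  unfolding smooth_on_def using kdiff_bilinear[of h S _ f g] by blast

lemma smooth_on_compose:
  "open S \<Longrightarrow> open T \<Longrightarrow> (\<And>x. x \<in> S \<Longrightarrow> \<phi> x \<in> T) \<Longrightarrow> smooth_on S \<phi> \<Longrightarrow> smooth_on T f \<Longrightarrow> smooth_on S (\<lambda>x. f (\<phi> x))"
  unfolding smooth_on_def using kdiff_compose[of S T \<phi> _ f] by blast

lemma smooth_on_id: "open S \<Longrightarrow> smooth_on S (\<lambda>x. x)"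
  and smooth_on_const: "smooth_on S (\<lambda>x. v)"
  by (auto simp: smooth_on_def kdiff_id kdiff_const)

lemma smooth_on_scaleR: "open S \<Longrightarrow> smooth_on S f \<Longrightarrow> smooth_on S (\<lambda>x. r *\<^sub>R f x)"
  by (rule smooth_on_linear[OF bounded_linear_scaleR_right])

lemmas smooth_on_times = smooth_on_bilinear[OF bounded_bilinear_scaleR]

section \<open>Powers of the norm and the inversion\<close>

lemma has_derivative_norm_powr:
  fixes x :: "'a::real_inner"
  assumes "x \<noteq> 0"
  shows "((\<lambda>x. norm x powr s) has_derivative (\<lambda>h. ((s * norm x powr (s - 2)) *\<^sub>R x) \<bullet> h)) (at x)"
proof -
  have "((\<lambda>t. t powr s) has_derivative (\<lambda>t. s * norm x powr (s - 1) * t)) (at (norm x))"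
    using has_real_derivative_powr[of "norm x" s] assms by (simp add: has_field_derivative_def)
  from has_derivative_compose[OF has_derivative_norm[OF assms] this]
  have "((\<lambda>x. norm x powr s) has_derivative (\<lambda>h. s * norm x powr (s - 1) * (h \<bullet> sgn x))) (at x)" .
  moreover have "s * norm x powr (s - 1) * (h \<bullet> sgn x) = ((s * norm x powr (s - 2)) *\<^sub>R x) \<bullet> h" for h
  proof -
    have "norm x powr (s - 1) = norm x powr (s - 2) * norm x"
      using assms powr_add[of "norm x" "s - 2" 1] by simp
    then show ?thesis using assms by (simp add: sgn_div_norm inner_commute)
  qed
  ultimately show ?thesis by simp
qed

lemma smooth_on_norm_powr: "smooth_on (- {0}) (\<lambda>x :: (real, 'n::finite) vec. norm x powr s)"
  unfolding smooth_on_def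
proof
  have o: "open (- {0 :: (real, 'n) vec})" by auto
  fix k show "kdiff k (- {0}) (\<lambda>x :: (real, 'n) vec. norm x powr s)"
  proof (induction k arbitrary: s)
    case (Suc k)
    have "(\<lambda>x :: (real, 'n) vec. norm x powr s) differentiable (at x)" if "x \<in> - {0}" for x
      using has_derivative_norm_powr[of x s] that by (auto simp: differentiable_def)
    moreover have "kdiff k (- {0}) (partial j (\<lambda>x :: (real, 'n) vec. norm x powr s))" for j
    proof (rule kdiff_cong[OF o])
      show "kdiff k (- {0}) (\<lambda>x :: (real, 'n) vec. (s * norm x powr (s - 2)) *\<^sub>R x $ j)"
        using kdiff_linear[OF bounded_linear_mult_right o Suc]
        by (intro kdiff_bilinear[OF bounded_bilinear_scaleR] o kdiff_linear[OF bounded_linear_vec_nth] kdiff_id)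
      fix x :: "(real, 'n) vec" assume "x \<in> - {0}"
      then show "(s * norm x powr (s - 2)) *\<^sub>R x $ j = partial j (\<lambda>x. norm x powr s) x"
        using partial_has_derivative[OF has_derivative_norm_powr[of x s], of j] by (simp add: inner_axis)
    qed
    ultimately show ?case by simp
  qed simp
qed

text \<open>Inversion in the unit sphere, without the conjugation contained in
  \<open>vinv\<close>.\<close>

definition inv2 :: "'a::real_inner \<Rightarrow> 'a" where
  "inv2 x = (norm x powr (-2)) *\<^sub>R x"

lemma inv2_nonzero: "x \<noteq> 0 \<Longrightarrow> inv2 x \<noteq> 0"
  by (simp add: inv2_def)

lemma smooth_on_inv2: "smooth_on (- {0 :: (real, 'n::finite) vec}) inv2"
proof -
  have "smooth_on (- {0 :: (real, 'n) vec}) (\<lambda>x. norm x powr (-2) *\<^sub>R x)"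
    by (intro smooth_on_times smooth_on_norm_powr smooth_on_id) auto
  then show ?thesis by (simp add: inv2_def[abs_def])
qed

lemma norm_powr_sq: "x \<noteq> 0 \<Longrightarrow> norm x powr s * (x \<bullet> x) = norm x powr (s + 2)"
  for x :: "'a::real_inner"
  by (simp add: powr_add powr_numeral flip: power2_norm_eq_inner)

lemma has_derivative_inv2:
  assumes "x \<noteq> (0 :: 'a::real_inner)"
  shows "(inv2 has_derivative (\<lambda>h. norm x powr (-2) *\<^sub>R h - (2 * norm x powr (-4) * (x \<bullet> h)) *\<^sub>R x)) (at x)"
  unfolding inv2_def[abs_def]
  by (rule has_derivative_eq_rhs[OF has_derivative_scaleR[OF has_derivative_norm_powr[OF assms] has_derivative_ident]])
     (simp add: fun_eq_iff)

section \<open>The Dirac operator of a Clifford module\<close>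

text \<open>Spinors form a real Clifford module: \<open>c x\<close> is multiplication by the vector
  x. Polarising the square relation gives all anticommutation relations. The instance used in the
  end is \<open>cmult E\<close>.\<close>

locale clifford_module = c: bounded_bilinear c
  for c :: "(real, 'n::finite) vec \<Rightarrow> 'b::euclidean_space \<Rightarrow> 'b" +
  assumes c_sq: "c x (c x v) = - ((x \<bullet> x) *\<^sub>R v)"
begin

definition D :: "((real, 'n) vec \<Rightarrow> 'b) \<Rightarrow> (real, 'n) vec \<Rightarrow> 'b" where
  "D f x = (\<Sum>j\<in>UNIV. c (axis j 1) (partial j f x))"

text \<open>The shift by n/2 absorbs the constant that the squares of the n basis vectors leave in
  \<open>D_X\<close>.\<close>

definition H :: "((real, 'n) vec \<Rightarrow> 'b) \<Rightarrow> (real, 'n) vec \<Rightarrow> 'b" where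
  "H f x = (\<Sum>i\<in>UNIV. x $ i *\<^sub>R partial i f x) + (CARD('n) / 2) *\<^sub>R f x"

lemma c_anticommute: "c x (c y v) = - c y (c x v) - (2 * (x \<bullet> y)) *\<^sub>R v"
proof -
  have "c x (c y v) + c y (c x v) = c (x + y) (c (x + y) v) - c x (c x v) - c y (c y v)"
    by (simp add: c.add_left c.add_right)
  also have "\<dots> = - ((2 * (x \<bullet> y)) *\<^sub>R v)"
    unfolding c_sq by (simp add: inner_commute algebra_simps)
  finally have "c x (c y v) = - ((2 * (x \<bullet> y)) *\<^sub>R v) - c y (c x v)"
    by (simp only: eq_diff_eq)
  then show ?thesis by simp
qed

lemma sum_c_axis: "(\<Sum>j\<in>UNIV. c (axis j 1) ((g \<bullet> axis j 1) *\<^sub>R v)) = c g v"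
proof -
  have "c g v = c (\<Sum>j\<in>UNIV. g $ j *\<^sub>R axis j 1) v" using vec_axis_expansion[of g] by simp
  then show ?thesis by (simp add: c.sum_left c.scaleR_left c.scaleR_right inner_axis)
qed

lemma derivative_axis_sum:
  assumes "(f has_derivative f') (at x)"
  shows "(\<Sum>j\<in>UNIV. (g \<bullet> axis j 1) *\<^sub>R f' (axis j 1)) = f' (g :: (real, 'n) vec)"
proof -
  interpret bounded_linear f' using assms by (rule has_derivative_bounded_linear)
  have "f' g = f' (\<Sum>j\<in>UNIV. g $ j *\<^sub>R axis j 1)" using vec_axis_expansion[of g] by simp
  then show ?thesis by (simp add: sum scaleR inner_axis)
qed

lemma D_has: "(f has_derivative f') (at x) \<Longrightarrow> D f x = (\<Sum>j\<in>UNIV. c (axis j 1) (f' (axis j 1)))"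
  by (simp add: D_def partial_has_derivative)

lemma H_has: "(f has_derivative f') (at x) \<Longrightarrow> H f x = f' x + (CARD('n) / 2) *\<^sub>R f x"
  using derivative_axis_sum[of f f' x x] by (simp add: H_def partial_has_derivative inner_axis)

lemma D_cong: "open S \<Longrightarrow> x \<in> S \<Longrightarrow> (\<And>y. y \<in> S \<Longrightarrow> f y = g y) \<Longrightarrow> D f x = D g x"
  unfolding D_def using partial_cong_open[of S x f g] by simp

lemma H_cong: "open S \<Longrightarrow> x \<in> S \<Longrightarrow> (\<And>y. y \<in> S \<Longrightarrow> f y = g y) \<Longrightarrow> H f x = H g x"
  unfolding H_def using partial_cong_open[of S x f g] by simp

text \<open>The bridge between total functions and identities valid only away from the pole:
  equality on an open set survives any number of derivatives.\<close>

lemma D_funpow_cong: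
  assumes "open S" "\<And>y. y \<in> S \<Longrightarrow> f y = g y" "x \<in> S"
  shows "(D ^^ m) f x = (D ^^ m) g x"
  using assms(3)
proof (induction m arbitrary: x)
  case (Suc m)
  then show ?case using D_cong[OF assms(1), of x "(D ^^ m) f" "(D ^^ m) g"] by simp
qed (simp add: assms)

lemma smooth_on_D: "open S \<Longrightarrow> smooth_on S f \<Longrightarrow> smooth_on S (D f)"
  unfolding D_def[abs_def]
  by (intro smooth_on_sum smooth_on_linear[OF c.bounded_linear_right] smooth_on_partial)

lemma smooth_on_D_funpow: "open S \<Longrightarrow> smooth_on S f \<Longrightarrow> smooth_on S ((D ^^ m) f)"
  by (induction m) (auto intro: smooth_on_D)

lemma smooth_on_X: "open S \<Longrightarrow> smooth_on S f \<Longrightarrow> smooth_on S (\<lambda>x. c x (f x))"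
  by (intro smooth_on_bilinear[OF c.bounded_bilinear_axioms] smooth_on_id)

lemma smooth_on_sq: "open S \<Longrightarrow> smooth_on S f \<Longrightarrow> smooth_on S (\<lambda>x. (x \<bullet> x) *\<^sub>R f x)"
  by (intro smooth_on_times smooth_on_bilinear[OF bounded_bilinear_inner] smooth_on_id)

lemma smooth_on_H: "open S \<Longrightarrow> smooth_on S f \<Longrightarrow> smooth_on S (H f)"
  unfolding H_def[abs_def]
  by (intro smooth_on_add smooth_on_sum smooth_on_scaleR smooth_on_times smooth_on_partial
      smooth_on_linear[OF bounded_linear_vec_nth] smooth_on_id)

lemma D_add:
  assumes "smooth_on S f" "smooth_on S g" "x \<in> S"
  shows "D (\<lambda>x. f x + g x) x = D f x + D g x"
proof -
  obtain f' where f': "(f has_derivative f') (at x)"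
    using smooth_on_differentiable[OF assms(1,3)] unfolding differentiable_def by blast
  obtain g' where g': "(g has_derivative g') (at x)"
    using smooth_on_differentiable[OF assms(2,3)] unfolding differentiable_def by blast
  show ?thesis
    unfolding D_has[OF has_derivative_add[OF f' g']] D_has[OF f'] D_has[OF g']
    by (simp only: c.add_right sum.distrib)
qed

lemma D_scaleR:
  assumes "smooth_on S f" "x \<in> S"
  shows "D (\<lambda>x. r *\<^sub>R f x) x = r *\<^sub>R D f x"
proof -
  obtain f' where f': "(f has_derivative f') (at x)"
    using smooth_on_differentiable[OF assms] unfolding differentiable_def by blast
  show ?thesis
    unfolding D_has[OF has_derivative_scaleR_right[OF f']] D_has[OF f']
    by (simp only: c.scaleR_right scaleR_sum_right)
qed

lemma D_funpow_scaleR: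
  assumes "open S" "smooth_on S f" "x \<in> S"
  shows "(D ^^ m) (\<lambda>x. r *\<^sub>R f x) x = r *\<^sub>R (D ^^ m) f x"
  using assms(3)
proof (induction m arbitrary: x)
  case (Suc m)
  have "D ((D ^^ m) (\<lambda>x. r *\<^sub>R f x)) x = D (\<lambda>x. r *\<^sub>R (D ^^ m) f x) x"
    by (rule D_cong[OF assms(1) Suc.prems]) (rule Suc.IH)
  then show ?case using D_scaleR[OF smooth_on_D_funpow[OF assms(1,2)] Suc.prems] by simp
qed simp

lemma H_scaleR:
  assumes "smooth_on S f" "x \<in> S"
  shows "H (\<lambda>x. r *\<^sub>R f x) x = r *\<^sub>R H f x"
proof -
  obtain f' where f': "(f has_derivative f') (at x)"
    using smooth_on_differentiable[OF assms] unfolding differentiable_def by blast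
  show ?thesis
    unfolding H_has[OF has_derivative_scaleR_right[OF f']] H_has[OF f']
    by (simp add: algebra_simps)
qed

lemma D_mult:
  assumes \<phi>: "(\<phi> has_derivative (\<lambda>h. g \<bullet> h)) (at x)" and f: "f differentiable (at x)"
  shows "D (\<lambda>x. \<phi> x *\<^sub>R f x) x = \<phi> x *\<^sub>R D f x + c g (f x)"
proof -
  obtain f' where f': "(f has_derivative f') (at x)" using f by (auto simp: differentiable_def)
  show ?thesis
    unfolding D_has[OF has_derivative_scaleR[OF \<phi> f']] D_has[OF f']
    by (simp add: c.add_right sum.distrib c.scaleR_right scaleR_sum_right flip: sum_c_axis[of g "f x"])
qed

lemma H_mult:
  assumes \<phi>: "(\<phi> has_derivative (\<lambda>h. g \<bullet> h)) (at x)" and f: "f differentiable (at x)"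
  shows "H (\<lambda>x. \<phi> x *\<^sub>R f x) x = \<phi> x *\<^sub>R H f x + (g \<bullet> x) *\<^sub>R f x"
proof -
  obtain f' where f': "(f has_derivative f') (at x)" using f by (auto simp: differentiable_def)
  show ?thesis
    unfolding H_has[OF has_derivative_scaleR[OF \<phi> f']] H_has[OF f'] by (simp add: algebra_simps)
qed

text \<open>Differentiating the factor x gives the sum of the squares of the basis vectors, that is
  -n. Moving x out past the basis vectors gives twice the radial derivative. Together they are -2
  H.\<close>

lemma D_X:
  assumes "f differentiable (at x)"
  shows "D (\<lambda>x. c x (f x)) x = - c x (D f x) - 2 *\<^sub>R H f x"
proof -
  obtain f' where f': "(f has_derivative f') (at x)" using assms by (auto simp: differentiable_def)
  have "D (\<lambda>x. c x (f x)) x = (\<Sum>j\<in>UNIV. c (axis j 1) (c x (f' (axis j 1)))) + (\<Sum>j\<in>UNIV. c (axis j 1) (c (axis j 1) (f x)))"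
    unfolding D_has[OF c.FDERIV[OF has_derivative_ident f']] by (simp add: c.add_right sum.distrib)
  also have "(\<Sum>j\<in>UNIV. c (axis j 1) (c (axis j 1) (f x))) = - (CARD('n) *\<^sub>R f x)"
    by (simp add: c_sq inner_axis_axis sum_negf sum_constant_scaleR)
  also have "(\<Sum>j\<in>UNIV. c (axis j 1) (c x (f' (axis j 1)))) =
     - c x (\<Sum>j\<in>UNIV. c (axis j 1) (f' (axis j 1))) - 2 *\<^sub>R (\<Sum>j\<in>UNIV. (x \<bullet> axis j 1) *\<^sub>R f' (axis j 1))"
    by (subst c_anticommute) (simp add: sum_subtractf sum_negf c.sum_right scaleR_sum_right inner_commute)
  finally show ?thesis
    unfolding derivative_axis_sum[OF f'] D_has[OF f'] H_has[OF f'] by (simp add: scaleR_add_right)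
qed

text \<open>H measures the degree of homogeneity and D lowers it by one; the interchange of second
  partial derivatives enters here.\<close>

lemma D_H:
  assumes S: "open S" and f: "smooth_on S f" and x: "x \<in> S"
  shows "D (H f) x = H (D f) x + D f x"
proof -
  have d: "((\<lambda>x. x $ i *\<^sub>R partial i f x) has_derivative
      (\<lambda>h. x $ i *\<^sub>R (\<Sum>j\<in>UNIV. h $ j *\<^sub>R partial j (partial i f) x) + h $ i *\<^sub>R partial i f x)) (at x)" for i
    by (intro has_derivative_scaleR has_derivative_partials bounded_linear.has_derivative[OF bounded_linear_vec_nth]
       has_derivative_ident smooth_on_differentiable[OF smooth_on_partial[OF f] x])
  have df: "(f has_derivative (\<lambda>h. \<Sum>j\<in>UNIV. h $ j *\<^sub>R partial j f x)) (at x)"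
    by (intro has_derivative_partials smooth_on_differentiable[OF f x])
  have H': "(H f has_derivative (\<lambda>h. (\<Sum>i\<in>UNIV. x $ i *\<^sub>R (\<Sum>j\<in>UNIV. h $ j *\<^sub>R partial j (partial i f) x) + h $ i *\<^sub>R partial i f x)
     + (CARD('n) / 2) *\<^sub>R (\<Sum>j\<in>UNIV. h $ j *\<^sub>R partial j f x))) (at x)"
    unfolding H_def[abs_def] by (intro has_derivative_add has_derivative_sum has_derivative_scaleR_right d df)
  have ax: "(\<Sum>j\<in>UNIV. axis k 1 $ j *\<^sub>R F j) = F k" for F :: "'n \<Rightarrow> 'b" and k
    by (simp add: axis_def if_distrib[of "\<lambda>r. r *\<^sub>R _"] cong: if_cong)
  have comm: "partial k (partial i f) x = partial i (partial k f) x" for i k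
    using partial_commute[OF S x, of f] f unfolding smooth_on_def by blast
  have PD: "(\<Sum>k\<in>UNIV. c (axis k 1) (partial i (partial k f) x)) = partial i (D f) x" for i
  proof -
    have "(D f has_derivative (\<lambda>h. \<Sum>k\<in>UNIV. c (axis k 1) (\<Sum>j\<in>UNIV. h $ j *\<^sub>R partial j (partial k f) x))) (at x)"
      unfolding D_def[abs_def]
      by (intro has_derivative_sum bounded_linear.has_derivative[OF c.bounded_linear_right] has_derivative_partials
          smooth_on_differentiable[OF smooth_on_partial[OF f] x])
    from partial_has_derivative[OF this, of i] show ?thesis by (simp add: ax)
  qed
  have "D (H f) x = (\<Sum>k\<in>UNIV. c (axis k 1) ((\<Sum>i\<in>UNIV. x $ i *\<^sub>R partial i (partial k f) x)
       + partial k f x + (CARD('n) / 2) *\<^sub>R partial k f x))"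
    unfolding D_has[OF H'] by (simp add: ax sum.distrib comm)
  also have "\<dots> = (\<Sum>i\<in>UNIV. x $ i *\<^sub>R (\<Sum>k\<in>UNIV. c (axis k 1) (partial i (partial k f) x))) + D f x + (CARD('n) / 2) *\<^sub>R D f x"
    by (simp add: c.add_right sum.distrib c.sum_right c.scaleR_right D_def scaleR_sum_right) (rule sum.swap)
  finally show ?thesis unfolding PD by (simp add: H_def)
qed

end

section \<open>The osp(1|2) relations and powers of D on the Kelvin transform\<close>

context clifford_module
begin

lemma D_sq:
  assumes "smooth_on S f" "x \<in> S"
  shows "D (\<lambda>x. (x \<bullet> x) *\<^sub>R f x) x = (x \<bullet> x) *\<^sub>R D f x + 2 *\<^sub>R c x (f x)"
proof -
  have "((\<lambda>x. x \<bullet> x) has_derivative (\<lambda>h. (2 *\<^sub>R x) \<bullet> h)) (at x)"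
    by (auto intro!: derivative_eq_intros simp: inner_commute)
  from D_mult[OF this smooth_on_differentiable[OF assms]] show ?thesis by (simp add: c.scaleR_left)
qed

lemma D_X_smooth: "smooth_on S f \<Longrightarrow> x \<in> S \<Longrightarrow> D (\<lambda>x. c x (f x)) x = - c x (D f x) - 2 *\<^sub>R H f x"
  by (intro D_X smooth_on_differentiable)

lemma D_lin:
  assumes "smooth_on S f" "smooth_on S g" "open S" "x \<in> S"
  shows "D (\<lambda>x. f x + r *\<^sub>R g x) x = D f x + r *\<^sub>R D g x"
  unfolding D_add[OF assms(1) smooth_on_scaleR[OF assms(3,2)] assms(4)] D_scaleR[OF assms(2,4)] ..

lemma D_D_sq:
  assumes S: "open S" and f: "smooth_on S f" and x: "x \<in> S"
  shows "D (D (\<lambda>x. (x \<bullet> x) *\<^sub>R f x)) x = (x \<bullet> x) *\<^sub>R D (D f) x - 4 *\<^sub>R H f x"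
proof -
  have Df: "smooth_on S (D f)" by (rule smooth_on_D[OF S f])
  have "D (D (\<lambda>x. (x \<bullet> x) *\<^sub>R f x)) x = D (\<lambda>x. (x \<bullet> x) *\<^sub>R D f x + 2 *\<^sub>R c x (f x)) x"
    by (rule D_cong[OF S x]) (rule D_sq[OF f])
  also have "\<dots> = (x \<bullet> x) *\<^sub>R D (D f) x - 4 *\<^sub>R H f x"
    unfolding D_lin[OF smooth_on_sq[OF S Df] smooth_on_X[OF S f] S x] D_sq[OF Df x] D_X_smooth[OF f x]
    by (simp add: algebra_simps)
  finally show ?thesis .
qed

lemma D_D_X:
  assumes S: "open S" and f: "smooth_on S f" and x: "x \<in> S"
  shows "D (D (\<lambda>x. c x (f x))) x = c x (D (D f) x) - 2 *\<^sub>R D f x"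
proof -
  have Df: "smooth_on S (D f)" by (rule smooth_on_D[OF S f])
  have "D (D (\<lambda>x. c x (f x))) x = D (\<lambda>x. (-1) *\<^sub>R c x (D f x) + (-2) *\<^sub>R H f x) x"
    by (rule D_cong[OF S x]) (simp add: D_X_smooth[OF f])
  also have "\<dots> = (-1) *\<^sub>R D (\<lambda>x. c x (D f x)) x + (-2) *\<^sub>R D (H f) x"
    unfolding D_lin[OF smooth_on_scaleR[OF S smooth_on_X[OF S Df]] smooth_on_H[OF S f] S x]
      D_scaleR[OF smooth_on_X[OF S Df] x] ..
  also have "\<dots> = c x (D (D f) x) - 2 *\<^sub>R D f x"
    unfolding D_X_smooth[OF Df x] D_H[OF S f x] by (simp add: algebra_simps)
  finally show ?thesis .
qed

lemma D_D_H:
  assumes S: "open S" and f: "smooth_on S f" and x: "x \<in> S"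
  shows "D (D (H f)) x = H (D (D f)) x + 2 *\<^sub>R D (D f) x"
proof -
  have Df: "smooth_on S (D f)" by (rule smooth_on_D[OF S f])
  have "D (D (H f)) x = D (\<lambda>x. H (D f) x + 1 *\<^sub>R D f x) x"
    by (rule D_cong[OF S x]) (simp add: D_H[OF S f])
  also have "\<dots> = H (D (D f)) x + 2 *\<^sub>R D (D f) x"
    unfolding D_lin[OF smooth_on_H[OF S Df] Df S x] D_H[OF S Df x] by (simp add: scaleR_2)
  finally show ?thesis .
qed

lemma D_D_lin:
  assumes S: "open S" and f: "smooth_on S f" and g: "smooth_on S g" and x: "x \<in> S"
  shows "D (D (\<lambda>x. f x + r *\<^sub>R g x)) x = D (D f) x + r *\<^sub>R D (D g) x"
proof -
  have "D (D (\<lambda>x. f x + r *\<^sub>R g x)) x = D (\<lambda>x. D f x + r *\<^sub>R D g x) x"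
    by (rule D_cong[OF S x]) (rule D_lin[OF f g S])
  also have "\<dots> = D (D f) x + r *\<^sub>R D (D g) x"
    by (rule D_lin[OF smooth_on_D[OF S f] smooth_on_D[OF S g] S x])
  finally show ?thesis .
qed

text \<open>Each induction step applies D twice, using that D^2 has commutator -4 H with the square
  of the norm, -2 D with multiplication by x, and 2 D^2 with H.\<close>

lemma D_odd_sq:
  assumes S: "open S" and f: "smooth_on S f" and x: "x \<in> S"
  shows "(D ^^ (2 * j + 3)) (\<lambda>x. (x \<bullet> x) *\<^sub>R f x) x =
    (x \<bullet> x) *\<^sub>R (D ^^ (2 * j + 3)) f x + 2 *\<^sub>R c x ((D ^^ (2 * j + 2)) f x)
    - (4 * (j + 1)) *\<^sub>R (H ((D ^^ (2 * j + 1)) f) x + (j + 1) *\<^sub>R (D ^^ (2 * j + 1)) f x)"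
  using x
proof (induction j arbitrary: x)
  case 0
  have Df: "smooth_on S (D f)" and DDf: "smooth_on S (D (D f))" by (intro smooth_on_D S f)+
  have "D (D (D (\<lambda>x. (x \<bullet> x) *\<^sub>R f x))) x = D (\<lambda>x. (x \<bullet> x) *\<^sub>R D (D f) x + (-4) *\<^sub>R H f x) x"
    by (rule D_cong[OF S 0]) (simp add: D_D_sq[OF S f])
  also have "\<dots> = (x \<bullet> x) *\<^sub>R D (D (D f)) x + 2 *\<^sub>R c x (D (D f) x) - 4 *\<^sub>R (H (D f) x + D f x)"
    unfolding D_lin[OF smooth_on_sq[OF S DDf] smooth_on_H[OF S f] S 0] D_sq[OF DDf 0] D_H[OF S f 0] by simp
  finally show ?case by (simp add: numeral_3_eq_3 numeral_2_eq_2)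
next
  case (Suc j)
  define h where "h = (D ^^ (2 * j + 1)) f"
  have h: "smooth_on S h" and Dh: "smooth_on S (D h)" and DDh: "smooth_on S (D (D h))"
    unfolding h_def by (intro smooth_on_D smooth_on_D_funpow S f)+
  have e: "(D ^^ (2 * j + 3)) f = D (D h)" "(D ^^ (2 * j + 2)) f = D h"
    "(D ^^ (2 * Suc j + 3)) F = D (D ((D ^^ (2 * j + 3)) F))" "(D ^^ (2 * Suc j + 2)) f = D (D (D h))"
    "(D ^^ (2 * Suc j + 1)) f = D (D h)" for F
    by (simp_all add: h_def numeral_3_eq_3)
  let ?F = "\<lambda>x. ((x \<bullet> x) *\<^sub>R D (D h) x + 2 *\<^sub>R c x (D h x)) + (- 4 * (real j + 1)) *\<^sub>R (H h x + (real j + 1) *\<^sub>R h x)"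
  have "D ((D ^^ (2 * j + 3)) (\<lambda>x. (x \<bullet> x) *\<^sub>R f x)) y = D ?F y" if "y \<in> S" for y
  proof (rule D_cong[OF S that])
    fix z assume "z \<in> S"
    from Suc.IH[OF this] show "(D ^^ (2 * j + 3)) (\<lambda>x. (x \<bullet> x) *\<^sub>R f x) z = ?F z"
      unfolding e h_def[symmetric] by (simp add: algebra_simps)
  qed
  then have "D (D ((D ^^ (2 * j + 3)) (\<lambda>x. (x \<bullet> x) *\<^sub>R f x))) x = D (D ?F) x"
    by (intro D_cong[OF S Suc.prems])
  also have "\<dots> = (x \<bullet> x) *\<^sub>R D (D (D (D h))) x - 4 *\<^sub>R H (D (D h)) x
     + 2 *\<^sub>R (c x (D (D (D h)) x) - 2 *\<^sub>R D (D h) x)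
     + (- 4 * (real j + 1)) *\<^sub>R (H (D (D h)) x + 2 *\<^sub>R D (D h) x + (real j + 1) *\<^sub>R D (D h) x)"
    unfolding D_D_lin[OF S smooth_on_add[OF S smooth_on_sq[OF S DDh] smooth_on_scaleR[OF S smooth_on_X[OF S Dh]]]
        smooth_on_add[OF S smooth_on_H[OF S h] smooth_on_scaleR[OF S h]] Suc.prems]
      D_D_lin[OF S smooth_on_sq[OF S DDh] smooth_on_X[OF S Dh] Suc.prems]
      D_D_lin[OF S smooth_on_H[OF S h] h Suc.prems]
      D_D_sq[OF S DDh Suc.prems] D_D_X[OF S Dh Suc.prems] D_D_H[OF S h Suc.prems] ..
  \<comment> \<open>The coefficient of H is -4 - 4(j + 1) = -4(j + 2); the constant closes up
    because 1 + (j + 1)(j + 3) is the square of j + 2.\<close>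
  also have "\<dots> = (x \<bullet> x) *\<^sub>R D (D (D (D h))) x + 2 *\<^sub>R c x (D (D (D h)) x)
     - (4 * (real j + 2)) *\<^sub>R (H (D (D h)) x + (real j + 2) *\<^sub>R D (D h) x)"
    by (rule euclidean_eqI) (simp add: inner_add_left inner_diff_left algebra_simps)
  finally show ?case unfolding e by (simp add: algebra_simps)
qed

text \<open>On the right stands the operator D |x|^2 D, by \<open>D_sq\<close>. The lemma computes
  its conjugate by |x|^s, in a shape that can be matched with the outcome of
  \<open>D_odd_sq\<close>.\<close>

lemma inversion_bracket:
  fixes s :: real
  defines "S \<equiv> - {0 :: (real, 'n) vec}"
  assumes g: "smooth_on S g" and x: "x \<in> S"
  defines "u \<equiv> \<lambda>x. norm x powr s *\<^sub>R g x"
  shows "(x \<bullet> x) *\<^sub>R D (D u) x + 2 *\<^sub>R c x (D u x) + (2 * s) *\<^sub>R (H u x - (s / 2) *\<^sub>R u x) =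
    norm x powr s *\<^sub>R ((x \<bullet> x) *\<^sub>R D (D g) x + 2 *\<^sub>R c x (D g x))"
proof -
  have S: "open S" by (auto simp: S_def)
  have Dg: "smooth_on S (D g)" by (rule smooth_on_D[OF S g])
  have P: "smooth_on S (\<lambda>x. norm x powr r)" for r unfolding S_def by (rule smooth_on_norm_powr)
  have D1: "D (\<lambda>x. norm x powr r *\<^sub>R h x) y = norm y powr r *\<^sub>R D h y + r *\<^sub>R (norm y powr (r - 2) *\<^sub>R c y (h y))"
    if "smooth_on S h" "y \<in> S" for h y r
    using D_mult[OF has_derivative_norm_powr smooth_on_differentiable[OF that], of r] that
    by (simp add: S_def c.scaleR_left)
  have Du: "D u y = norm y powr s *\<^sub>R D g y + s *\<^sub>R (norm y powr (s - 2) *\<^sub>R c y (g y))" if "y \<in> S" for y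
    unfolding u_def by (rule D1[OF g that])
  have sm1: "smooth_on S (\<lambda>x. norm x powr r *\<^sub>R D g x)" "smooth_on S (\<lambda>x. norm x powr r *\<^sub>R c x (g x))" for r
    by (intro smooth_on_times smooth_on_X S P Dg g)+
  have "D (D u) x = D (\<lambda>y. norm y powr s *\<^sub>R D g y + s *\<^sub>R (norm y powr (s - 2) *\<^sub>R c y (g y))) x"
    by (rule D_cong[OF S x]) (rule Du)
  also have "\<dots> = norm x powr s *\<^sub>R D (D g) x + s *\<^sub>R (norm x powr (s - 2) *\<^sub>R c x (D g x))
    + s *\<^sub>R (norm x powr (s - 2) *\<^sub>R (- c x (D g x) - 2 *\<^sub>R H g x) - ((s - 2) * norm x powr (s - 4) * (x \<bullet> x)) *\<^sub>R g x)"
    unfolding D_lin[OF sm1 S x] D1[OF Dg x] D1[OF smooth_on_X[OF S g] x] D_X_smooth[OF g x] c_sq by simp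
  finally have DDu: "D (D u) x = norm x powr s *\<^sub>R D (D g) x + s *\<^sub>R (norm x powr (s - 2) *\<^sub>R c x (D g x))
    + s *\<^sub>R (norm x powr (s - 2) *\<^sub>R (- c x (D g x) - 2 *\<^sub>R H g x) - ((s - 2) * norm x powr (s - 4) * (x \<bullet> x)) *\<^sub>R g x)" .
  have x0: "x \<noteq> 0" using x by (simp add: S_def)
  have Hu: "H u x = norm x powr s *\<^sub>R H g x + (s * norm x powr (s - 2) * (x \<bullet> x)) *\<^sub>R g x"
    unfolding u_def using H_mult[OF has_derivative_norm_powr[OF x0] smooth_on_differentiable[OF g x], of s] by simp
  \<comment> \<open>All powers of the norm become monomials in p and q, and the claim becomes a
    polynomial identity in each component.\<close>
  define p where "p = norm x powr (s - 4)"
  define q where "q = x \<bullet> x"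
  have p2: "norm x powr (s - 2) = p * q" using norm_powr_sq[OF x0, of "s - 4"] by (simp add: p_def q_def)
  have p3: "norm x powr s = p * q * q" using norm_powr_sq[OF x0, of "s - 2"] unfolding p2 q_def[symmetric] by simp
  have ux: "u x = norm x powr s *\<^sub>R g x" by (simp add: u_def)
  show ?thesis
    unfolding DDu Du[OF x] Hu c.add_right c.scaleR_right c_sq ux p2 p3 p_def[symmetric] q_def[symmetric]
    by (rule euclidean_eqI) (simp add: inner_add_left inner_diff_left algebra_simps)
qed

text \<open>J is the Kelvin transform of spinor fields.\<close>
definition J :: "((real, 'n) vec \<Rightarrow> 'b) \<Rightarrow> (real, 'n) vec \<Rightarrow> 'b" where
  "J f x = norm x powr (- real CARD('n)) *\<^sub>R c x (f (inv2 x))"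

lemma smooth_on_J: "smooth_on (- {0}) f \<Longrightarrow> smooth_on (- {0}) (J f)"
  unfolding J_def[abs_def]
  by (intro smooth_on_times smooth_on_X smooth_on_norm_powr smooth_on_compose[OF _ _ _ smooth_on_inv2])
     (auto simp: inv2_nonzero)

text \<open>Two cancellations: the radial derivative from the chain rule for the inversion against
  the one in -2 H, and the constant n in -2 H against the derivative of the weight |x|^(-n).\<close>

lemma D_J:
  assumes f: "smooth_on (- {0}) f" and x: "x \<noteq> 0"
  shows "D (J f) x = - (norm x powr (-2) *\<^sub>R J (D f) x)"
proof -
  obtain f' where f': "(f has_derivative f') (at (inv2 x))"
    using smooth_on_differentiable[OF f, of "inv2 x"] x inv2_nonzero[OF x] by (auto simp: differentiable_def)
  interpret f': bounded_linear f' using f' by (rule has_derivative_bounded_linear)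
  let ?n = "real CARD('n)" and ?p = "norm x powr (-2)" and ?q = "norm x powr (-4)"
  let ?h = "\<lambda>x. f (inv2 x)"
  have h': "(?h has_derivative (\<lambda>h. f' (?p *\<^sub>R h - (2 * ?q * (x \<bullet> h)) *\<^sub>R x))) (at x)"
    by (rule has_derivative_compose[OF has_derivative_inv2[OF x] f'])
  have h'_eq: "f' (?p *\<^sub>R h - (2 * ?q * (x \<bullet> h)) *\<^sub>R x) = ?p *\<^sub>R f' h - (2 * ?q * (x \<bullet> h)) *\<^sub>R f' x" for h
    by (simp add: f'.diff f'.scaleR)
  have hd: "?h differentiable (at x)" using h' by (auto simp: differentiable_def)
  have Xd: "(\<lambda>x. c x (?h x)) differentiable (at x)"
    using c.FDERIV[OF has_derivative_ident h'] by (auto simp: differentiable_def)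
  have q: "?q * (x \<bullet> x) = ?p" using norm_powr_sq[OF x, of "-4"] by simp
  have p: "?p * (x \<bullet> x) = 1" using norm_powr_sq[OF x, of "-2"] x by simp
  have Dh: "D ?h x = ?p *\<^sub>R D f (inv2 x) - (2 * ?q) *\<^sub>R c x (f' x)"
    unfolding D_has[OF h'] D_has[OF f'] h'_eq sum_c_axis[of x "f' x", symmetric]
    by (simp add: c.diff_right c.scaleR_right sum_subtractf scaleR_sum_right)
  have Hh: "H ?h x = - (?p *\<^sub>R f' x) + (?n / 2) *\<^sub>R ?h x"
    unfolding H_has[OF h'] h'_eq using q by (simp add: mult.assoc flip: scaleR_diff_left)
  have "D (J f) x = norm x powr (- ?n) *\<^sub>R D (\<lambda>x. c x (?h x)) x + c ((- ?n * norm x powr (- ?n - 2)) *\<^sub>R x) (c x (?h x))"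
    unfolding J_def[abs_def] by (rule D_mult[OF has_derivative_norm_powr[OF x] Xd])
  also have "\<dots> = norm x powr (- ?n) *\<^sub>R (- c x (D ?h x) - 2 *\<^sub>R H ?h x) + (?n * (norm x powr (- ?n - 2) * (x \<bullet> x))) *\<^sub>R ?h x"
    by (simp add: D_X[OF hd] c.scaleR_left c.minus_left c_sq)
  also have "norm x powr (- ?n - 2) * (x \<bullet> x) = norm x powr (- ?n)" using norm_powr_sq[OF x, of "- ?n - 2"] by simp
  also have "norm x powr (- ?n) *\<^sub>R (- c x (D ?h x) - 2 *\<^sub>R H ?h x) + (?n * norm x powr (- ?n)) *\<^sub>R ?h x
     = norm x powr (- ?n) *\<^sub>R (- c x (D ?h x) - 2 *\<^sub>R H ?h x + ?n *\<^sub>R ?h x)"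
    by (simp add: algebra_simps)
  also have "- c x (D ?h x) - 2 *\<^sub>R H ?h x + ?n *\<^sub>R ?h x = - (?p *\<^sub>R c x (D f (inv2 x)))"
  proof -
    have "c x (D ?h x) = ?p *\<^sub>R c x (D f (inv2 x)) + (2 * (?q * (x \<bullet> x))) *\<^sub>R f' x"
      unfolding Dh by (simp add: c.diff_right c.scaleR_right c_sq mult.assoc)
    then show ?thesis unfolding Hh q by (simp add: algebra_simps)
  qed
  finally show ?thesis unfolding J_def[abs_def] by (simp add: mult.commute)
qed

lemma D_odd_inversion:
  assumes f: "smooth_on (- {0}) f" and x: "x \<noteq> 0"
  shows "(D ^^ (2 * k + 1)) (\<lambda>x. norm x powr (2 * real k) *\<^sub>R J f x) x =
    - (norm x powr (- 2 * real k - 2) *\<^sub>R J ((D ^^ (2 * k + 1)) f) x)"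
proof -
  let ?S = "- {0 :: (real, 'n) vec}"
  have S: "open ?S" by auto
  have "x \<in> ?S" using x by simp
  then show ?thesis
  proof (induction k arbitrary: x)
    case 0
    have "D (\<lambda>x. norm x powr 0 *\<^sub>R J f x) x = D (J f) x"
      by (rule D_cong[OF S 0]) simp
    then show ?case using D_J[OF f] 0 by simp
  next
    case (Suc k)
    define u where "u = (\<lambda>x. norm x powr (2 * real k) *\<^sub>R J f x)"
    define h where "h = (D ^^ (2 * k + 1)) f"
    \<comment> \<open>Chosen so that 2s and -s/2 are the constants -4(k + 1) and k + 1 of
      \<open>D_odd_sq\<close> for j = k.\<close>
    define s where "s = - 2 * real k - 2"
    define w where "w = (\<lambda>x. norm x powr s *\<^sub>R J h x)"
    have h: "smooth_on ?S h" unfolding h_def by (rule smooth_on_D_funpow[OF S f])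
    have Jh: "smooth_on ?S (J h)" by (rule smooth_on_J[OF h])
    have w: "smooth_on ?S w" unfolding w_def by (intro smooth_on_times S smooth_on_norm_powr Jh)
    have u: "smooth_on ?S u" unfolding u_def by (intro smooth_on_times S smooth_on_norm_powr smooth_on_J f)
    have IH: "(D ^^ (2 * k + 1)) u y = (-1) *\<^sub>R w y" if "y \<in> ?S" for y
      using Suc.IH[OF that] by (simp add: u_def w_def s_def h_def)
    have IH1: "D ((D ^^ (2 * k + 1)) u) y = (-1) *\<^sub>R D w y" if "y \<in> ?S" for y
      using D_cong[OF S that IH] D_scaleR[OF w that, of "-1"] by simp
    have IH2: "D (D ((D ^^ (2 * k + 1)) u)) y = (-1) *\<^sub>R D (D w) y" if "y \<in> ?S" for y
      using D_cong[OF S that IH1] D_scaleR[OF smooth_on_D[OF S w] that, of "-1"] by simp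
    have IHH: "H ((D ^^ (2 * k + 1)) u) x = (-1) *\<^sub>R H w x"
      using H_cong[OF S Suc.prems IH] H_scaleR[OF w Suc.prems, of "-1"] by simp
    have e: "(D ^^ (2 * k + 3)) F = D (D ((D ^^ (2 * k + 1)) F))" "(D ^^ (2 * k + 2)) F = D ((D ^^ (2 * k + 1)) F)" for F
      by (simp_all add: numeral_3_eq_3)
    have JDh: "D (J h) y = (-1) *\<^sub>R (norm y powr (-2) *\<^sub>R J (D h) y)" if "y \<in> ?S" for y
      using D_J[OF h] that by simp
    have JDDh: "D (J (D h)) x = - (norm x powr (-2) *\<^sub>R J (D (D h)) x)"
      using D_J[OF smooth_on_D[OF S h]] Suc.prems by simp
    have "(D ^^ (2 * Suc k + 1)) (\<lambda>x. norm x powr (2 * real (Suc k)) *\<^sub>R J f x) x = (D ^^ (2 * k + 3)) (\<lambda>x. (x \<bullet> x) *\<^sub>R u x) x"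
    proof -
      have eq: "norm y powr (2 * real (Suc k)) *\<^sub>R J f y = (y \<bullet> y) *\<^sub>R u y" if "y \<in> ?S" for y
        using norm_powr_sq[of y "2 * real k"] that by (simp add: u_def algebra_simps)
      have m: "2 * Suc k + 1 = 2 * k + 3" by simp
      show ?thesis unfolding m by (rule D_funpow_cong[OF S eq Suc.prems])
    qed
    also have "\<dots> = - ((x \<bullet> x) *\<^sub>R D (D w) x + 2 *\<^sub>R c x (D w x) + (2 * s) *\<^sub>R (H w x - (s / 2) *\<^sub>R w x))"
      unfolding D_odd_sq[OF S u Suc.prems]
      unfolding e IH2[OF Suc.prems] IH1[OF Suc.prems] IHH IH[OF Suc.prems]
      by (rule euclidean_eqI) (simp add: s_def c.minus_right inner_add_left inner_diff_left field_simps)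
    also have "\<dots> = - (norm x powr s *\<^sub>R ((x \<bullet> x) *\<^sub>R D (D (J h)) x + 2 *\<^sub>R c x (D (J h) x)))"
      unfolding w_def using inversion_bracket[OF Jh Suc.prems, of s] by simp
    \<comment> \<open>Now \<open>D_J\<close> is used twice: the factor (x,x) first cancels the power
      |x|^(-2) it produces, and the second use lowers the exponent s by 2.\<close>
    also have "(x \<bullet> x) *\<^sub>R D (D (J h)) x + 2 *\<^sub>R c x (D (J h) x) = D (\<lambda>x. (x \<bullet> x) *\<^sub>R D (J h) x) x"
      using D_sq[OF smooth_on_D[OF S Jh] Suc.prems] by simp
    also have "\<dots> = D (\<lambda>x. (-1) *\<^sub>R J (D h) x) x"
    proof (rule D_cong[OF S Suc.prems])
      fix y :: "(real, 'n) vec" assume y: "y \<in> ?S"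
      then have "(y \<bullet> y) * norm y powr (-2) = 1"
        using norm_powr_sq[of y "-2"] by (simp add: mult.commute)
      then show "(y \<bullet> y) *\<^sub>R D (J h) y = (-1) *\<^sub>R J (D h) y" by (simp add: JDh[OF y])
    qed
    also have "\<dots> = norm x powr (-2) *\<^sub>R J (D (D h)) x"
      using D_scaleR[OF smooth_on_J[OF smooth_on_D[OF S h]] Suc.prems, of "-1"] JDDh by simp
    also have "- (norm x powr s *\<^sub>R norm x powr (-2) *\<^sub>R J (D (D h)) x) = - (norm x powr (s - 2) *\<^sub>R J (D (D h)) x)"
      using Suc.prems by (simp flip: powr_add)
    also have "s - 2 = - 2 * real (Suc k) - 2" by (simp add: s_def)
    also have "D (D h) = (D ^^ (2 * Suc k + 1)) f" by (simp add: h_def)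
    finally show ?case .
  qed
qed

subsection \<open>Reflections and translations\<close>

lemma smooth_on_bounded_linear: "bounded_linear L \<Longrightarrow> smooth_on UNIV L"
  using smooth_on_linear[of L UNIV "\<lambda>x. x"] smooth_on_id[of UNIV] by simp

text \<open>The derivative of \<open>vrefl v\<close> maps e_j to 2 (v,e_j) v - (v,v) e_j. The first
  part sums to -2 (v,v) f' v, which cancels the term left by moving v past the e_j in the second
  part.\<close>

lemma D_reflection:
  assumes f: "smooth_on UNIV f"
  shows "D (\<lambda>x. c v (f (vrefl v x))) x = (v \<bullet> v) *\<^sub>R c v (D f (vrefl v x))"
proof -
  obtain f' where f': "(f has_derivative f') (at (vrefl v x))"
    using smooth_on_differentiable[OF f, of "vrefl v x"] by (auto simp: differentiable_def)
  interpret f': bounded_linear f' using f' by (rule has_derivative_bounded_linear)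
  have "(vrefl v has_derivative vrefl v) (at x)"
    using vrefl_linear by (intro bounded_linear_imp_has_derivative linear_conv_bounded_linear[THEN iffD1])
  from bounded_linear.has_derivative[OF c.bounded_linear_right has_derivative_compose[OF this f']]
  have d: "((\<lambda>x. c v (f (vrefl v x))) has_derivative (\<lambda>h. c v (f' (vrefl v h)))) (at x)" .
  have "D (\<lambda>x. c v (f (vrefl v x))) x = 2 *\<^sub>R (\<Sum>j\<in>UNIV. c (axis j 1) ((v \<bullet> axis j 1) *\<^sub>R c v (f' v)))
     - (v \<bullet> v) *\<^sub>R (\<Sum>j\<in>UNIV. c (axis j 1) (c v (f' (axis j 1))))"
    unfolding D_has[OF d]
    by (simp add: vrefl_def f'.diff f'.scaleR c.diff_right c.scaleR_right sum_subtractf scaleR_sum_right inner_commute)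
  also have "(\<Sum>j\<in>UNIV. c (axis j 1) (c v (f' (axis j 1)))) = - c v (D f (vrefl v x)) - 2 *\<^sub>R f' v"
    unfolding D_has[OF f'] derivative_axis_sum[OF f', of v, symmetric]
    by (subst c_anticommute) (simp add: sum_subtractf sum_negf c.sum_right scaleR_sum_right inner_commute)
  finally show ?thesis unfolding sum_c_axis c_sq by (simp add: algebra_simps)
qed

lemma D_affine:
  assumes f: "smooth_on UNIV f"
  shows "D (\<lambda>x. f (p + r *\<^sub>R x)) x = r *\<^sub>R D f (p + r *\<^sub>R x)"
proof -
  obtain f' where f': "(f has_derivative f') (at (p + r *\<^sub>R x))"
    using smooth_on_differentiable[OF f, of "p + r *\<^sub>R x"] by (auto simp: differentiable_def)
  interpret f': bounded_linear f' using f' by (rule has_derivative_bounded_linear)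
  have "((\<lambda>x. p + r *\<^sub>R x) has_derivative (\<lambda>h. r *\<^sub>R h)) (at x)"
    by (auto intro!: derivative_eq_intros)
  from has_derivative_compose[OF this f']
  have d: "((\<lambda>x. f (p + r *\<^sub>R x)) has_derivative (\<lambda>h. f' (r *\<^sub>R h))) (at x)" .
  show ?thesis unfolding D_has[OF d] D_has[OF f'] by (simp add: f'.scaleR c.scaleR_right scaleR_sum_right)
qed

end

section \<open>Action of the Clifford group\<close>

abbreviation N :: "'n::{finite,linorder} clif \<Rightarrow> real" where
  "N a \<equiv> cl_norm (Rep_clif a)"

abbreviation e1 :: "(real, 'n::{finite,linorder}) vec" where
  "e1 \<equiv> axis cl_e1 1"

locale ordered_clifford_module = clifford_module c
  for c :: "(real, 'n::{finite,linorder}) vec \<Rightarrow> 'b::euclidean_space \<Rightarrow> 'b"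
begin

definition gen_act :: "'n \<Rightarrow> 'b \<Rightarrow> 'b" where
  "gen_act j v = c e1 (c (axis j 1) v)"

definition monom_act :: "'n set \<Rightarrow> 'b \<Rightarrow> 'b" where
  "monom_act A v = foldr gen_act (sorted_list_of_set A) v"

text \<open>\<open>tau\<close> as an action on spinors rather than a matrix; \<open>spin_act\<close>
  likewise corresponds to \<open>tau'\<close>.\<close>

definition clif_act :: "'n clif \<Rightarrow> 'b \<Rightarrow> 'b" where
  "clif_act a v = (\<Sum>A\<in>Pow cl_gens. Rep_clif a A *\<^sub>R monom_act A v)"

definition spin_act :: "'n clif \<Rightarrow> 'b \<Rightarrow> 'b" where
  "spin_act a v = clif_act (cprin a) v"

lemma c_e1_e1: "c e1 (c e1 v) = - v"
  by (simp add: c_sq inner_axis_axis)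

text \<open>As e_i is orthogonal to e_1, the two signs in e_1 e_i e_1 e_j cancel. Hence the products
  e_1 e_j satisfy the Clifford relations of the generators.\<close>

lemma gen_act_gen_act: "i \<in> cl_gens \<Longrightarrow> gen_act i (gen_act j v) = c (axis i 1) (c (axis j 1) v)"
  unfolding gen_act_def using c_anticommute[of "axis i 1" e1 "c (axis j 1) v"]
  by (auto simp: inner_axis_axis c.minus_right c_e1_e1 cl_gens_def)

lemma gen_act_same: "i \<in> cl_gens \<Longrightarrow> gen_act i (gen_act i v) = - v"
  by (simp add: gen_act_gen_act c_sq inner_axis_axis)

lemma gen_act_anticommute: "i \<in> cl_gens \<Longrightarrow> j \<in> cl_gens \<Longrightarrow> i \<noteq> j \<Longrightarrow> gen_act i (gen_act j v) = - gen_act j (gen_act i v)"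
  using c_anticommute[of "axis i 1" "axis j 1" v] by (simp add: gen_act_gen_act inner_axis_axis)

lemma bounded_linear_gen_act: "bounded_linear (gen_act j)"
  unfolding gen_act_def[abs_def]
  by (rule bounded_linear_compose[OF c.bounded_linear_right c.bounded_linear_right])

lemma bounded_linear_monom_act: "bounded_linear (monom_act A)"
proof -
  have "bounded_linear (foldr gen_act xs)" for xs
    by (induction xs) (auto intro: bounded_linear_gen_act bounded_linear_compose bounded_linear_ident simp: id_def o_def)
  then show ?thesis by (simp add: monom_act_def[abs_def])
qed

lemma bounded_linear_clif_act: "bounded_linear (clif_act a)"
  unfolding clif_act_def[abs_def]
  by (intro bounded_linear_sum bounded_linear_compose[OF bounded_linear_scaleR_right bounded_linear_monom_act])

lemma bounded_linear_spin_act: "bounded_linear (spin_act a)"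
  unfolding spin_act_def[abs_def] by (rule bounded_linear_clif_act)

lemma monom_act_empty [simp]: "monom_act {} v = v"
  by (simp add: monom_act_def)

lemma monom_act_insert_min:
  assumes "\<forall>a\<in>A. b < a"
  shows "monom_act (insert b A) v = gen_act b (monom_act A v)"
proof -
  have "sorted_list_of_set (insert b A) = b # sorted_list_of_set A"
    using assms by (subst sorted_list_of_set_insert) (auto intro!: insort_is_Cons simp: less_imp_le)
  then show ?thesis by (simp add: monom_act_def)
qed

text \<open>The core of the homomorphism property: sorting j into the increasing product costs one
  sign for each smaller index passed and one more if j is already present. The induction peels off
  the least index.\<close>

lemma gen_act_monom_act:
  assumes "j \<in> cl_gens" "B \<subseteq> cl_gens"
  shows "gen_act j (monom_act B v) = cl_sign {j} B *\<^sub>R monom_act (symdiff {j} B) v"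
  using finite[of B] assms(2)
proof (induction B rule: finite_linorder_min_induct)
  case empty
  then show ?case using monom_act_insert_min[of "{}" j v] by simp
next
  case (insert b A)
  interpret gvl: bounded_linear "gen_act i" for i by (rule bounded_linear_gen_act)
  have bn: "b \<notin> A" using insert.hyps by auto
  have T: "monom_act (insert b A) v = gen_act b (monom_act A v)" using insert.hyps by (intro monom_act_insert_min) auto
  have s: "cl_sign {j} (insert b A) = (if b \<le> j then -1 else 1) * cl_sign {j} A"
    using bn by (simp add: cl_sign_prod)
  consider "j < b" | "j = b" | "b < j" by (meson linorder_neqE)
  then show ?case
  proof cases
    case 1
    have "cl_sign {j} A = 1"
      using 1 insert.hyps by (auto simp: cl_sign_prod intro!: prod.neutral)
    moreover have "symdiff {j} (insert b A) = insert j (insert b A)"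
      using 1 insert.hyps by (auto simp: symdiff_def)
    moreover have "monom_act (insert j (insert b A)) v = gen_act j (monom_act (insert b A) v)"
      using 1 insert.hyps by (intro monom_act_insert_min) auto
    ultimately show ?thesis using 1 by (auto simp: s)
  next
    case 2
    have "cl_sign {j} A = 1"
      using 2 insert.hyps by (auto simp: cl_sign_prod intro!: prod.neutral)
    moreover have "symdiff {j} (insert b A) = A"
      using 2 bn by (auto simp: symdiff_def)
    ultimately show ?thesis using 2 insert.prems s by (simp add: T gen_act_same)
  next
    case 3
    have "gen_act j (monom_act (insert b A) v) = - gen_act b (gen_act j (monom_act A v))"
      unfolding T by (rule gen_act_anticommute) (use 3 insert.prems assms(1) in auto)
    also have "\<dots> = - (cl_sign {j} A *\<^sub>R gen_act b (monom_act (symdiff {j} A) v))"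
      using insert.IH insert.prems by (simp add: gvl.scaleR)
    also have "gen_act b (monom_act (symdiff {j} A) v) = monom_act (insert b (symdiff {j} A)) v"
      using 3 insert.hyps by (intro monom_act_insert_min[symmetric]) (auto simp: symdiff_def)
    also have "insert b (symdiff {j} A) = symdiff {j} (insert b A)"
      using 3 bn by (auto simp: symdiff_def)
    finally show ?thesis using less_imp_le[OF 3] by (simp add: s)
  qed
qed

lemma clif_act_linear:
  "clif_act (a + b) v = clif_act a v + clif_act b v" "clif_act (r *\<^sub>R a) v = r *\<^sub>R clif_act a v"
  "clif_act (- a) v = - clif_act a v" "clif_act 0 v = 0"
  by (simp_all add: clif_act_def plus_clif.rep_eq scaleR_clif.rep_eq uminus_clif.rep_eq zero_clif.rep_eq cl_add_def cl_scale_def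
      cl_neg_def scaleR_add_left sum.distrib scaleR_sum_right sum_negf)

lemma clif_act_sum: "clif_act (\<Sum>i\<in>I. f i) v = (\<Sum>i\<in>I. clif_act (f i) v)"
  by (induction I rule: infinite_finite_induct) (auto simp: clif_act_linear)

lemma clif_act_one: "clif_act 1 v = v"
proof -
  have "(\<Sum>A\<in>Pow cl_gens. Rep_clif (1::'n clif) A *\<^sub>R monom_act A v) = (\<Sum>A\<in>{{}}. Rep_clif (1::'n clif) A *\<^sub>R monom_act A v)"
    by (intro sum.mono_neutral_right) (auto simp: one_clif.rep_eq cl_one_def)
  then show ?thesis by (simp add: clif_act_def one_clif.rep_eq cl_one_def)
qed

lemma clif_act_gen_mult:
  assumes j: "j \<in> cl_gens"
  shows "clif_act (vec_clif (axis j 1) * b) v = gen_act j (clif_act b v)"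
proof -
  interpret gvl: bounded_linear "gen_act j" by (rule bounded_linear_gen_act)
  let ?b = "Rep_clif b"
  have jP: "{j} \<subseteq> cl_gens" using j by simp
  have R: "Rep_clif (vec_clif (axis j 1) * b) C = cl_sign {j} (symdiff {j} C) * ?b (symdiff {j} C)" if "C \<subseteq> cl_gens" for C
  proof -
    have "Rep_clif (vec_clif (axis j 1) * b) C =
      (\<Sum>A\<in>Pow cl_gens. if A = {j} then cl_sign {j} (symdiff {j} C) * ?b (symdiff {j} C) else 0)"
      unfolding times_clif.rep_eq cl_mult_symdiff vec_gen[OF j] if_P[OF that] by (intro sum.cong) auto
    then show ?thesis using j by simp
  qed
  have "clif_act (vec_clif (axis j 1) * b) v = (\<Sum>C\<in>Pow cl_gens. (cl_sign {j} (symdiff {j} C) * ?b (symdiff {j} C)) *\<^sub>R monom_act C v)"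
    unfolding clif_act_def by (intro sum.cong refl) (simp add: R)
  also have "\<dots> = (\<Sum>B\<in>Pow cl_gens. (cl_sign {j} B * ?b B) *\<^sub>R monom_act (symdiff {j} B) v)"
    using sum_Pow_symdiff[OF jP, of "\<lambda>C. (cl_sign {j} (symdiff {j} C) * ?b (symdiff {j} C)) *\<^sub>R monom_act C v"] by simp
  also have "\<dots> = (\<Sum>B\<in>Pow cl_gens. ?b B *\<^sub>R gen_act j (monom_act B v))"
    by (intro sum.cong refl) (simp add: gen_act_monom_act[OF j] mult.commute)
  also have "\<dots> = gen_act j (clif_act b v)"
    by (simp add: clif_act_def gvl.sum gvl.scaleR)
  finally show ?thesis .
qed

text \<open>For x = e_1 the right side is -e_1 e_1 = 1; for the other e_j conjugation compensates
  the sign. Under \<open>spin_act\<close> the conjugation disappears, which is what fits the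
  reflections \<open>K\<close>.\<close>

lemma clif_act_vec_mult: "clif_act (vec_clif x * b) v = - c e1 (c (vconj x) (clif_act b v))"
proof -
  let ?w = "clif_act b v"
  have "vec_clif x * b = x $ cl_e1 *\<^sub>R b + (\<Sum>j\<in>cl_gens. x $ j *\<^sub>R (vec_clif (axis j 1) * b))"
    by (subst vec_decompose) (simp add: distrib_right sum_distrib_right)
  then have "clif_act (vec_clif x * b) v = x $ cl_e1 *\<^sub>R ?w + (\<Sum>j\<in>cl_gens. x $ j *\<^sub>R gen_act j ?w)"
    by (simp add: clif_act_linear clif_act_sum clif_act_gen_mult)
  also have "\<dots> = - c e1 (\<Sum>j\<in>UNIV. vconj x $ j *\<^sub>R c (axis j 1) ?w)"
  proof -
    have "(\<Sum>j\<in>cl_gens. vconj x $ j *\<^sub>R c (axis j 1) ?w) = - (\<Sum>j\<in>cl_gens. x $ j *\<^sub>R c (axis j 1) ?w)"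
      by (auto simp: vconj_component sum_negf[symmetric] intro!: sum.cong)
    then show ?thesis
      unfolding sum_e1_gens
      by (simp add: vconj_component c.add_right c.diff_right c.sum_right c.scaleR_right c_e1_e1 gen_act_def)
  qed
  also have "(\<Sum>j\<in>UNIV. vconj x $ j *\<^sub>R c (axis j 1) ?w) = c (vconj x) ?w"
    using vec_axis_expansion[of "vconj x"] by (metis (no_types, lifting) c.scaleR_left c.sum_left sum.cong)
  finally show ?thesis .
qed

lemma spin_act_vec_mult: "spin_act (vec_clif x * b) v = - c e1 (c x (spin_act b v))"
  by (simp add: spin_act_def cprin_mult cprin_vec clif_act_vec_mult)

lemma spin_act_one: "spin_act 1 v = v"
  by (simp add: spin_act_def cprin_simps clif_act_one)

lemma spin_act_minus: "spin_act (- a) v = - spin_act a v"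
  by (simp add: spin_act_def cprin_simps clif_act_linear)

lemma spin_act_scaleR: "spin_act (r *\<^sub>R a) v = r *\<^sub>R spin_act a v"
  by (simp add: spin_act_def cprin_simps clif_act_linear)

lemma spin_act_Gam_mult: "a \<in> Gam \<Longrightarrow> spin_act (a * b) v = spin_act a (spin_act b v)"
proof (induction rule: Gam.induct)
  case one
  then show ?case by (simp add: spin_act_one)
next
  case (vec_mult x a)
  then show ?case by (simp add: spin_act_vec_mult mult.assoc)
qed

definition sandwich :: "'n clif \<Rightarrow> (real, 'n) vec \<Rightarrow> (real, 'n) vec" where
  "sandwich a x = cl_to_vec (Rep_clif (crev a * vec_clif x * a))"

lemma vec_clif_sandwich: "a \<in> Gam \<Longrightarrow> vec_clif (sandwich a x) = crev a * vec_clif x * a"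
  using Gam_conj[of a x] by (auto simp: sandwich_def)

lemma sandwich_vec_mult: "sandwich (vec_clif v * a) x = sandwich a (vrefl v (vrefl e1 x))"
  unfolding sandwich_def vec_sandwich[of v x, unfolded vconj_def, symmetric]
  by (simp add: crev_mult crev_simps mult.assoc)

lemma sandwich_one: "sandwich 1 x = x"
  by (simp add: sandwich_def crev_simps)

text \<open>The similarity x \<mapsto> a^* x a lifted to spinor fields. By \<open>M_vec_mult\<close>
  it is built from pairs of reflections \<open>K e1\<close>, \<open>K v\<close>.\<close>

definition M :: "'n clif \<Rightarrow> ((real, 'n) vec \<Rightarrow> 'b) \<Rightarrow> (real, 'n) vec \<Rightarrow> 'b" where
  "M a f x = spin_act a (f (sandwich a x))"

definition K :: "(real, 'n) vec \<Rightarrow> ((real, 'n) vec \<Rightarrow> 'b) \<Rightarrow> (real, 'n) vec \<Rightarrow> 'b" where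
  "K v f x = c v (f (vrefl v x))"

lemma smooth_on_K: "smooth_on UNIV f \<Longrightarrow> smooth_on UNIV (K v f)"
  unfolding K_def[abs_def]
  by (intro smooth_on_linear[OF c.bounded_linear_right] smooth_on_compose[of UNIV UNIV "vrefl v" f]
      smooth_on_bounded_linear[of "vrefl v"] linear_conv_bounded_linear[THEN iffD1] vrefl_linear) auto

lemma D_K: "smooth_on UNIV f \<Longrightarrow> D (K v f) = (\<lambda>x. (v \<bullet> v) *\<^sub>R K v (D f) x)"
  unfolding K_def[abs_def] by (rule ext) (rule D_reflection)

lemma M_vec_mult: "M (vec_clif v * a) f x = (-1) *\<^sub>R K e1 (K v (M a f)) x"
  by (simp add: M_def K_def spin_act_vec_mult sandwich_vec_mult)

lemma K_scaleR: "K v (\<lambda>x. r *\<^sub>R f x) = (\<lambda>x. r *\<^sub>R K v f x)"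
  by (simp add: K_def[abs_def] c.scaleR_right)

lemma D_scaleR_UNIV: "smooth_on UNIV f \<Longrightarrow> D (\<lambda>x. r *\<^sub>R f x) = (\<lambda>x. r *\<^sub>R D f x)"
  by (rule ext) (rule D_scaleR, auto)

text \<open>A factor v contributes (v,v) from its own reflection and 1 from that in e_1, in total
  the squared norm of a. Smoothness is proved along with it, since each step differentiates the
  previous field.\<close>

lemma M_intertwining:
  assumes "a \<in> Gam" "smooth_on UNIV f"
  shows "smooth_on UNIV (M a f) \<and> D (M a f) = (\<lambda>x. (N a)\<^sup>2 *\<^sub>R M a (D f) x)"
  using assms
proof (induction rule: Gam.induct)
  case one
  then show ?case by (simp add: M_def[abs_def] spin_act_one sandwich_one)
next
  case (vec_mult v a)
  let ?G = "M a f"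
  have G: "smooth_on UNIV ?G" "D ?G = (\<lambda>x. (N a)\<^sup>2 *\<^sub>R M a (D f) x)" using vec_mult by auto
  have Kv: "smooth_on UNIV (K v ?G)" and KK: "smooth_on UNIV (K e1 (K v ?G))"
    by (intro smooth_on_K G)+
  have eq: "M (vec_clif v * a) F = (\<lambda>x. (-1) *\<^sub>R K e1 (K v (M a F)) x)" for F
    by (rule ext) (rule M_vec_mult)
  have "smooth_on UNIV (M (vec_clif v * a) f)"
    unfolding eq by (intro smooth_on_scaleR KK) auto
  moreover have "D (M (vec_clif v * a) f) = (\<lambda>x. (N (vec_clif v * a))\<^sup>2 *\<^sub>R M (vec_clif v * a) (D f) x)"
    unfolding eq D_scaleR_UNIV[OF KK] D_K[OF Kv] D_K[OF G(1)] G(2) K_scaleR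
    by (simp add: inner_axis_axis cl_norm_vec_mult power_mult_distrib power2_norm_eq_inner)
  ultimately show ?case by blast
qed

lemma smooth_on_M: "a \<in> Gam \<Longrightarrow> smooth_on UNIV f \<Longrightarrow> smooth_on UNIV (M a f)"
  using M_intertwining by blast

lemma D_M: "a \<in> Gam \<Longrightarrow> smooth_on UNIV f \<Longrightarrow> D (M a f) = (\<lambda>x. (N a)\<^sup>2 *\<^sub>R M a (D f) x)"
  using M_intertwining by blast

lemma D_funpow_intertwining:
  assumes kdiff: "\<And>f. smooth_on UNIV f \<Longrightarrow> smooth_on UNIV (P f)"
    and D: "\<And>f. smooth_on UNIV f \<Longrightarrow> D (P f) = (\<lambda>x. r *\<^sub>R P (D f) x)"
    and f: "smooth_on UNIV f"
  shows "(D ^^ m) (P f) = (\<lambda>x. r ^ m *\<^sub>R P ((D ^^ m) f) x)"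
proof (induction m)
  case (Suc m)
  have s: "smooth_on UNIV ((D ^^ m) f)" by (intro smooth_on_D_funpow f) auto
  have "(D ^^ Suc m) (P f) = D (\<lambda>x. r ^ m *\<^sub>R P ((D ^^ m) f) x)" by (simp add: Suc)
  also have "\<dots> = (\<lambda>x. r ^ m *\<^sub>R D (P ((D ^^ m) f)) x)" by (rule D_scaleR_UNIV[OF kdiff[OF s]])
  also have "\<dots> = (\<lambda>x. r ^ Suc m *\<^sub>R P ((D ^^ Suc m) f) x)" by (simp add: D[OF s] mult.commute)
  finally show ?case .
qed simp

text \<open>The case r = 1 is a translation; r = -1 supplies the minus sign in x \<mapsto> q - ...
  .\<close>

definition T :: "(real, 'n) vec \<Rightarrow> real \<Rightarrow> ((real, 'n) vec \<Rightarrow> 'b) \<Rightarrow> (real, 'n) vec \<Rightarrow> 'b" where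
  "T q r f x = f (q + r *\<^sub>R x)"

lemma smooth_on_T: "smooth_on UNIV f \<Longrightarrow> smooth_on UNIV (T q r f)"
  unfolding T_def[abs_def]
  by (intro smooth_on_compose[of UNIV UNIV "\<lambda>x. q + r *\<^sub>R x" f] smooth_on_add smooth_on_const smooth_on_scaleR smooth_on_id) auto

lemma D_T: "smooth_on UNIV f \<Longrightarrow> D (T q r f) = (\<lambda>x. r *\<^sub>R T q r (D f) x)"
  unfolding T_def[abs_def] by (rule ext) (rule D_affine)

lemma D_translate: "D (\<lambda>x. g (x - p)) x = D g (x - p)"
  by (simp add: D_def partial_def algebra_simps)

lemma D_funpow_translate: "(D ^^ m) (\<lambda>x. g (x - p)) = (\<lambda>x. (D ^^ m) g (x - p))"
proof (induction m)
  case (Suc m)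
  have "D (\<lambda>x. (D ^^ m) g (x - p)) = (\<lambda>x. D ((D ^^ m) g) (x - p))"
    by (rule ext) (rule D_translate)
  then show ?case by (simp add: Suc)
qed simp

end

section \<open>Factorisation of Clifford matrices\<close>

lemma Gam_inverse_unique:
  assumes "a \<in> Gam" "a * b = 1"
  shows "b \<in> Gam" "b * a = 1"
proof -
  obtain b' where b': "b' \<in> Gam" "a * b' = 1" "b' * a = 1" using Gam_inverse[OF assms(1)] by auto
  have "b = b' * a * b" using b' by simp
  also have "\<dots> = b'" using assms(2) by (simp add: mult.assoc)
  finally show "b \<in> Gam" "b * a = 1" using b' by auto
qed

context ordered_clifford_module
begin

text \<open>The case b = 0, where d^* is inverse to a. Since d c^* is a vector u and c^* = a^* u,
  the product c^* a is the sandwich of u and hence a vector.\<close>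

lemma sl2_lower_triangular:
  fixes a g d :: "'n clif"
  assumes a: "a \<in> Gam" and ad: "a * crev d = 1" and gd: "g * crev d = vec_clif u"
  shows "\<exists>q. \<forall>x. (- crev g + crev a * vec_clif x) * a = vec_clif (q + sandwich a x)"
proof -
  have da: "crev d * a = 1" using Gam_inverse_unique[OF a ad] by simp
  have "crev a * d = crev (crev d * a)" by (simp add: crev_mult)
  then have ad': "crev a * d = 1" by (simp add: da crev_simps)
  have dg: "d * crev g = vec_clif u" using arg_cong[OF gd, of crev] by (simp add: crev_mult crev_simps)
  have "crev g = crev a * (d * crev g)" using ad' by (simp flip: mult.assoc)
  then have "crev g * a = vec_clif (sandwich a u)" by (simp add: dg vec_clif_sandwich[OF a])
  then have "(- crev g + crev a * vec_clif x) * a = vec_clif (- sandwich a u + sandwich a x)" for x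
    by (simp add: left_diff_distrib vec_diff vec_clif_sandwich[OF a])
  then show ?thesis by blast
qed

text \<open>If c = 0, then k d^* is inverse to the vector a b^* and so a vector; if d = 0 it
  vanishes. Otherwise the determinant gives t d^* = k^* with a vector t, so that k d^* is the
  sandwich k t^-1 k^* of a vector.\<close>

lemma sl2_pole:
  fixes a b g d k :: "'n clif"
  assumes b: "b \<in> Gam" and k: "k \<in> Gam" "k * crev b = 1" "crev b * k = 1"
    and a: "a \<in> Gam \<union> {0}" and g: "g \<in> Gam \<union> {0}" and d: "d \<in> Gam \<union> {0}"
    and det: "a * crev d - b * crev g = 1"
    and ab: "a * crev b = vec_clif u1" and gd: "g * crev d = vec_clif u2"
    and v: "crev k * a = vec_clif v"
  shows "\<exists>p. k * crev d = vec_clif p"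
proof -
  consider "g = 0" | "d = 0" | "g \<in> Gam" "d \<in> Gam" using g d by auto
  then show ?thesis
  proof cases
    case 1
    then have ad: "a * crev d = 1" using det by (simp add: crev_simps)
    then have "a \<in> Gam" using a by auto
    then have "crev d * a = 1" using Gam_inverse_unique[OF _ ad] by simp
    have "vec_clif u1 * (k * crev d) = a * (crev b * k) * crev d" by (simp add: ab[symmetric] mult.assoc)
    then have inv: "vec_clif u1 * (k * crev d) = 1" using k ad by simp
    then have "u1 \<noteq> 0" by auto
    have "k * crev d = vec_clif (vinv u1) * vec_clif u1 * (k * crev d)" using vinv_mult_vec[OF \<open>u1 \<noteq> 0\<close>] by simp
    also have "\<dots> = vec_clif (vinv u1)" using inv by (simp add: mult.assoc)
    finally show ?thesis by blast
  next
    case 2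
    then show ?thesis by (intro exI[of _ 0]) (simp add: crev_simps)
  next
    case 3
    obtain g' where g': "g' \<in> Gam" "g * g' = 1" "g' * g = 1" using Gam_inverse[OF 3(1)] by auto
    have gg: "crev g * crev g' = 1" "crev g' * crev g = 1"
      using arg_cong[OF g'(3), of crev] arg_cong[OF g'(2), of crev] by (simp_all add: crev_mult crev_simps)
    have bk: "b * crev k = 1" "crev k * b = 1"
      using arg_cong[OF k(2), of crev] arg_cong[OF k(3), of crev] by (simp_all add: crev_mult crev_simps)
    have dg: "d * crev g = vec_clif u2" using arg_cong[OF gd, of crev] by (simp add: crev_mult crev_simps)
    define u where "u = sandwich (crev g') u2"
    have "vec_clif u = g' * (d * crev g) * crev g'"
      unfolding u_def dg using vec_clif_sandwich[OF Gam_crev[OF g'(1)]] by simp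
    also have "\<dots> = g' * d" using gg by (simp add: mult.assoc)
    finally have u: "vec_clif u = g' * d" .
    have "g * vec_clif u = d" unfolding u using g' by (simp flip: mult.assoc)
    then have d_eq: "crev d = vec_clif u * crev g" by (metis crev_mult crev_simps(7))
    have "u \<noteq> 0" using \<open>g * vec_clif u = d\<close> Gam_nonzero[OF 3(2)] by auto
    have "a = b * (crev k * a)" using bk by (simp flip: mult.assoc)
    then have a_eq: "a = b * vec_clif v" by (simp add: v)
    \<comment> \<open>Multiplying the determinant condition by \<open>crev k\<close> gives (v u - 1)
      c^* = k^*. Taking out u on the right of v u - 1 leaves v - u^-1.\<close>
    define t where "t = v - vinv u"
    have "vec_clif t * crev d = vec_clif v * vec_clif u * crev g - vec_clif (vinv u) * vec_clif u * crev g"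
      by (simp add: t_def d_eq vec_diff left_diff_distrib mult.assoc)
    also have "\<dots> = vec_clif v * vec_clif u * crev g - crev g" using vinv_mult_vec[OF \<open>u \<noteq> 0\<close>] by simp
    also have "\<dots> = crev k * b * (vec_clif v * vec_clif u * crev g - crev g)" using bk by simp
    also have "\<dots> = crev k * (a * crev d - b * crev g)"
      by (simp add: a_eq d_eq right_diff_distrib mult.assoc)
    finally have td: "vec_clif t * crev d = crev k" using det by simp
    have "t \<noteq> 0" using td Gam_nonzero[OF Gam_crev[OF k(1)]] by auto
    have "crev d = vec_clif (vinv t) * vec_clif t * crev d" using vinv_mult_vec[OF \<open>t \<noteq> 0\<close>] by simp
    also have "\<dots> = vec_clif (vinv t) * crev k" using td by (simp add: mult.assoc)
    finally have "k * crev d = crev (crev k) * vec_clif (vinv t) * crev k" by (simp add: mult.assoc)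
    then show ?thesis using vec_clif_sandwich[OF Gam_crev[OF k(1)]] by metis
  qed
qed

text \<open>The big cell of the Bruhat decomposition: x is translated by -p, inverted, conjugated by
  k, negated and translated by -v.\<close>

lemma sl2_bruhat:
  fixes a b g d :: "'n clif"
  assumes b: "b \<in> Gam"
    and a: "a \<in> Gam \<union> {0}" and g: "g \<in> Gam \<union> {0}" and d: "d \<in> Gam \<union> {0}"
    and det: "a * crev d - b * crev g = 1"
    and ab: "a * crev b = vec_clif u1" and gd: "g * crev d = vec_clif u2"
  obtains k p v where "k \<in> Gam" "k * crev b = 1" "crev b * k = 1"
    "\<And>x. crev d - crev b * vec_clif x = - (crev b * vec_clif (x - p))"
    "\<And>x. x \<noteq> p \<Longrightarrow> (- crev g + crev a * vec_clif x) * - (vec_clif (vinv (x - p)) * k) = vec_clif (- v - sandwich k (vinv (x - p)))"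
proof -
  obtain k where k: "k \<in> Gam" "crev b * k = 1" "k * crev b = 1"
    using Gam_inverse[OF Gam_crev[OF b]] by auto
  have bk: "b * crev k = 1" "crev k * b = 1"
    using arg_cong[OF k(2), of crev] arg_cong[OF k(3), of crev] by (simp_all add: crev_mult crev_simps)
  have a_eq: "a = vec_clif u1 * k" using k by (simp flip: ab) (simp add: mult.assoc)
  define v where "v = sandwich k u1"
  have v: "crev k * a = vec_clif v" by (simp add: v_def vec_clif_sandwich[OF k(1)] a_eq mult.assoc)
  have v': "crev a * k = vec_clif v" using arg_cong[OF v, of crev] by (simp add: crev_mult crev_simps)
  obtain p where p: "k * crev d = vec_clif p"
    using sl2_pole[OF b k(1,3,2) a g d det ab gd v] by auto
  have d_eq: "crev d = crev b * vec_clif p" using k p by (metis mult.assoc mult_1)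
  have w: "crev d - crev b * vec_clif x = - (crev b * vec_clif (x - p))" for x
    by (simp add: d_eq vec_diff right_diff_distrib)
  have y: "(- crev g + crev a * vec_clif x) * - (vec_clif (vinv (x - p)) * k) = vec_clif (- v - sandwich k (vinv (x - p)))"
    if "x \<noteq> p" for x
  proof -
    \<comment> \<open>Both a^* k and k^* a equal the vector v, so a^* p - c^* is k^* times the
      determinant.\<close>
    have "crev a * vec_clif p - crev g = crev a * k * crev d - crev g" by (simp add: p[symmetric] mult.assoc)
    also have "\<dots> = crev k * a * crev d - crev k * b * crev g" by (simp add: v v' bk)
    also have "\<dots> = crev k * (a * crev d - b * crev g)" by (simp add: right_diff_distrib mult.assoc)
    finally have kk: "crev a * vec_clif p - crev g = crev k" using det by simp
    have "- crev g + crev a * vec_clif x = (crev a * vec_clif p - crev g) + crev a * vec_clif (x - p)"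
      by (simp add: vec_diff right_diff_distrib)
    then have "(- crev g + crev a * vec_clif x) * - (vec_clif (vinv (x - p)) * k)
      = - (crev k * vec_clif (vinv (x - p)) * k) - crev a * (vec_clif (x - p) * vec_clif (vinv (x - p))) * k"
      by (simp add: kk distrib_right mult.assoc)
    also have "\<dots> = - vec_clif (sandwich k (vinv (x - p))) - vec_clif v"
      using vec_mult_vinv[of "x - p"] that by (simp add: vec_clif_sandwich[OF k(1)] v')
    finally show ?thesis by (simp add: vec_diff vec_minus)
  qed
  show thesis by (rule that[OF k(1,3,2) w y])
qed

section \<open>The intertwining relation for a Clifford matrix\<close>

lemma spin_act_scaleR_right: "spin_act a (r *\<^sub>R v) = r *\<^sub>R spin_act a v"
  using bounded_linear_spin_act[of a] by (simp add: linear_simps)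

lemma M_scaleR: "M a (\<lambda>x. r *\<^sub>R f x) = (\<lambda>x. r *\<^sub>R M a f x)"
  by (simp add: M_def[abs_def] spin_act_scaleR_right)

lemma J_scaleR: "J (\<lambda>x. r *\<^sub>R f x) = (\<lambda>x. r *\<^sub>R J f x)"
  by (simp add: J_def[abs_def] c.scaleR_right mult.commute)

lemma c_e1_vconj: "c e1 (c (vconj z) w) = c z (c e1 w)"
  using c_anticommute[of z e1 w]
  by (simp add: vconj_def vrefl_def inner_axis_axis c.diff_left c.diff_right c.scaleR_left c.scaleR_right c_e1_e1)

text \<open>The Clifford inverse is the inversion followed by conjugation, so a reflection
  \<open>K e1\<close> turns the Kelvin transform into one with Clifford inverses.\<close>

lemma vrefl_e1_inv2: "vrefl e1 (inv2 z) = vinv z"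
proof -
  have "norm z powr (-2) = 1 / (z \<bullet> z)"
    by (cases "z = 0") (auto simp: powr_minus powr_numeral power2_norm_eq_inner divide_inverse)
  then show ?thesis
    using linear_scale[OF vrefl_linear, of e1 "norm z powr (-2)" z] by (simp add: inv2_def vinv_def vconj_def)
qed

text \<open>The inverse of z acts as z e_1 divided by (z,z), up to sign, while \<open>J\<close>
  carries z itself. This accounts for the power 2 - n.\<close>

lemma J_K_M:
  assumes "z \<noteq> 0"
  shows "J (K e1 (M k f)) z = norm z powr (2 - real CARD('n)) *\<^sub>R spin_act (- (vec_clif (vinv z) * k)) (f (sandwich k (vinv z)))"
proof -
  have p: "norm z powr 2 * (1 / (z \<bullet> z)) = 1"
    using assms by (simp add: powr_numeral power2_norm_eq_inner)
  let ?w = "spin_act k (f (sandwich k (vinv z)))"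
  have "spin_act (- (vec_clif (vinv z) * k)) (f (sandwich k (vinv z))) = c e1 (c (vinv z) ?w)"
    by (simp add: spin_act_minus spin_act_vec_mult)
  also have "\<dots> = (1 / (z \<bullet> z)) *\<^sub>R c z (c e1 ?w)"
    by (simp add: vinv_def c.scaleR_left c.scaleR_right c_e1_vconj)
  finally have e: "spin_act (- (vec_clif (vinv z) * k)) (f (sandwich k (vinv z))) = (1 / (z \<bullet> z)) *\<^sub>R c z (c e1 ?w)" .
  have "norm z powr (2 - real CARD('n)) = norm z powr (- real CARD('n)) * norm z powr 2"
    unfolding powr_add[symmetric] by simp
  then have "norm z powr (2 - real CARD('n)) * (1 / (z \<bullet> z)) = norm z powr (- real CARD('n))"
    using p by (simp add: mult.assoc)
  then show ?thesis
    unfolding e by (simp add: J_def K_def M_def vrefl_e1_inv2)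
qed

text \<open>For r the norm of a or of k and m = n: the source weight times the factors r^2 from 2k +
  1 uses of D is the target weight.\<close>

lemma powr_power_shift:
  assumes "0 < (r::real)"
  shows "r powr (- (2 * real k + 2 - m)) * r ^ (2 * (2 * k + 1)) = r powr (2 * real k + m)"
proof -
  have "r ^ (2 * (2 * k + 1)) = r powr (real (2 * (2 * k + 1)))"
    by (rule powr_realpow[OF assms, symmetric])
  moreover have "- (2 * real k + 2 - m) + real (2 * (2 * k + 1)) = 2 * real k + m" by simp
  ultimately show ?thesis by (simp only: powr_add[symmetric])
qed

text \<open>The field \<open>\<Phi> t f\<close> is \<open>\<bar>w\<bar>\<^sup>t \<tau>'(w)\<^sup>-\<^sup>1 f(g\<^sup>-\<^sup>1 x)\<close>; relative to the exponent in \<open>pi'\<close> the factor \<open>\<bar>w\<bar>\<close>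
  that normalises the argument of \<open>\<tau>'\<close> has been moved into the power.\<close>
lemma intertwining:
  assumes abgd: "a \<in> Gam \<union> {0}" "b \<in> Gam \<union> {0}" "g \<in> Gam \<union> {0}" "d \<in> Gam \<union> {0}"
    and det: "a * crev d - b * crev g = 1"
    and ab: "a * crev b = vec_clif u1" and gd: "g * crev d = vec_clif u2"
  defines "w \<equiv> \<lambda>x. crev d - crev b * vec_clif x"
  defines "S \<equiv> {x. w x \<noteq> 0}"
  shows "\<exists>\<Phi>. open S \<and>
    (\<forall>x\<in>S. w x \<in> Gam \<and> (\<exists>wi y. w x * wi = 1 \<and> wi * w x = 1 \<and> (- crev g + crev a * vec_clif x) * wi = vec_clif y \<and>
       (\<forall>t f. \<Phi> t f x = N (w x) powr t *\<^sub>R spin_act wi (f y)))) \<and>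
    (\<forall>k f. smooth_on UNIV f \<longrightarrow> (\<forall>x\<in>S. (D ^^ (2 * k + 1)) (\<Phi> (2 * real k + 2 - real CARD('n)) f) x =
       \<Phi> (- 2 * real k - real CARD('n)) ((D ^^ (2 * k + 1)) f) x))"
proof (cases "b = 0")
  case True
  then have ad: "a * crev d = 1" using det by (simp add: crev_simps)
  then have a: "a \<in> Gam" using abgd(1) by auto
  have d: "crev d \<in> Gam" "crev d * a = 1" using Gam_inverse_unique[OF a ad] by auto
  have w: "w x = crev d" for x by (simp add: w_def True crev_simps)
  have SU: "S = UNIV" using Gam_nonzero[OF d(1)] by (simp add: S_def w)
  obtain q where q: "\<And>x. (- crev g + crev a * vec_clif x) * a = vec_clif (q + sandwich a x)"
    using sl2_lower_triangular[OF a ad gd] by blast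
  have Na: "N a > 0" "N (crev d) = 1 / N a"
    using cl_norm_Gam_pos[OF a] cl_norm_Gam_mult[OF a, of "crev d"] ad by (auto simp: field_simps)
  define P where "P f = M a (T q 1 f)" for f
  \<comment> \<open>Here w is the constant \<open>crev d\<close>, the inverse of a, whence the
    exponent -t.\<close>
  define \<Phi> where "\<Phi> t f = (\<lambda>x. N a powr (- t) *\<^sub>R P f x)" for t f
  have P: "smooth_on UNIV (P f)" "D (P f) = (\<lambda>x. (N a)\<^sup>2 *\<^sub>R P (D f) x)" if "smooth_on UNIV f" for f
    using smooth_on_M[OF a smooth_on_T[OF that]] D_M[OF a smooth_on_T[OF that]] D_T[OF that]
    by (simp_all add: P_def)
  have "\<Phi> t f x = N (w x) powr t *\<^sub>R spin_act a (f (q + sandwich a x))" for t f x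
    using Na by (simp add: \<Phi>_def P_def M_def T_def w powr_minus powr_divide inverse_eq_divide)
  moreover have "(D ^^ (2 * k + 1)) (\<Phi> (2 * real k + 2 - real CARD('n)) f) x =
       \<Phi> (- 2 * real k - real CARD('n)) ((D ^^ (2 * k + 1)) f) x" if f: "smooth_on UNIV f" for k f x
  proof -
    have "(D ^^ (2 * k + 1)) (\<Phi> (2 * real k + 2 - real CARD('n)) f) x =
      N a powr (- (2 * real k + 2 - real CARD('n))) *\<^sub>R (D ^^ (2 * k + 1)) (P f) x"
      unfolding \<Phi>_def by (rule D_funpow_scaleR[of UNIV]) (auto intro: P(1) f)
    also have "\<dots> = (N a powr (- (2 * real k + 2 - real CARD('n))) * N a ^ (2 * (2 * k + 1))) *\<^sub>R P ((D ^^ (2 * k + 1)) f) x"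
    proof -
      have "(D ^^ (2 * k + 1)) (P f) = (\<lambda>x. ((N a)\<^sup>2) ^ (2 * k + 1) *\<^sub>R P ((D ^^ (2 * k + 1)) f) x)"
        by (rule D_funpow_intertwining[of P, OF P f])
      then show ?thesis by (simp only: power_mult scaleR_scaleR)
    qed
    also have "\<dots> = \<Phi> (- 2 * real k - real CARD('n)) ((D ^^ (2 * k + 1)) f) x"
      unfolding powr_power_shift[OF Na(1)] by (simp add: \<Phi>_def add.commute)
    finally show ?thesis .
  qed
  ultimately show ?thesis
    using d ad q by (intro exI[of _ \<Phi>]) (simp add: SU w, blast)
next
  case False
  then have b: "b \<in> Gam" using abgd(2) by auto
  obtain k p v where k: "k \<in> Gam" "k * crev b = 1" "crev b * k = 1"
    and wx: "\<And>x. crev d - crev b * vec_clif x = - (crev b * vec_clif (x - p))"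
    and y: "\<And>x. x \<noteq> p \<Longrightarrow> (- crev g + crev a * vec_clif x) * - (vec_clif (vinv (x - p)) * k) = vec_clif (- v - sandwich k (vinv (x - p)))"
    using sl2_bruhat[OF b abgd(1,3,4) det ab gd] by blast
  have w: "w x = vec_clif 0 - crev b * vec_clif (x - p)" for x by (simp add: w_def wx)
  have wG: "w x \<in> Gam" if "x \<noteq> p" for x
  proof -
    have "w x = crev b * vec_clif (- (x - p))" by (simp add: w vec_minus del: minus_diff_eq)
    then show ?thesis using that by (auto intro!: Gam_mult Gam_crev Gam_vec b)
  qed
  have Sp: "S = - {p}"
  proof -
    have "w p = 0" by (simp add: w)
    then show ?thesis using wG Gam_nonzero unfolding S_def by blast
  qed
  have Nk: "N k > 0" "N (crev b) = 1 / N k"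
    using cl_norm_Gam_pos[OF k(1)] cl_norm_Gam_mult[OF k(1), of "crev b"] k by (auto simp: field_simps)
  have Nw: "N (w x) = norm (x - p) / N k" for x
    using cl_norm_Gam_mult[OF Gam_crev[OF b], of "vec_clif (x - p)"] by (simp add: w cl_norm_uminus cl_norm_vec Nk)
  have inv: "w x * - (vec_clif (vinv (x - p)) * k) = 1" "- (vec_clif (vinv (x - p)) * k) * w x = 1" if "x \<noteq> p" for x
  proof -
    have z: "x - p \<noteq> 0" using that by simp
    have "w x * - (vec_clif (vinv (x - p)) * k) = crev b * (vec_clif (x - p) * vec_clif (vinv (x - p))) * k"
      by (simp add: w mult.assoc)
    then show "w x * - (vec_clif (vinv (x - p)) * k) = 1" using vec_mult_vinv[OF z] k by simp
    have "- (vec_clif (vinv (x - p)) * k) * w x = vec_clif (vinv (x - p)) * (k * crev b) * vec_clif (x - p)"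
      by (simp add: w mult.assoc)
    then show "- (vec_clif (vinv (x - p)) * k) * w x = 1" using vinv_mult_vec[OF z] k by simp
  qed
  \<comment> \<open>The globally smooth part of the action. The inversion and the translation by p
    are kept apart, as only they involve the pole.\<close>
  define P where "P f = K e1 (M k (T (- v) (-1) f))" for f
  have P: "smooth_on UNIV (P f)" "D (P f) = (\<lambda>x. (- (N k)\<^sup>2) *\<^sub>R P (D f) x)" if f: "smooth_on UNIV f" for f
  proof -
    have 1: "smooth_on UNIV (T (- v) (-1) f)" and 2: "smooth_on UNIV (M k (T (- v) (-1) f))"
      by (intro smooth_on_M k smooth_on_T f)+
    show "smooth_on UNIV (P f)" unfolding P_def by (intro smooth_on_K 2)
    show "D (P f) = (\<lambda>x. (- (N k)\<^sup>2) *\<^sub>R P (D f) x)"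
      unfolding P_def D_K[OF 2] D_M[OF k(1) 1] D_T[OF f] M_scaleR K_scaleR by (simp add: inner_axis_axis)
  qed
  \<comment> \<open>The exponent is what remains of t after \<open>J\<close> has taken 2 - n; it is
    2k for the source and -2k - 2 for the target.\<close>
  define h where "h t f = (\<lambda>z. norm z powr (t - 2 + real CARD('n)) *\<^sub>R J (P f) z)" for t f
  define \<Phi> where "\<Phi> t f = (\<lambda>x. N k powr (- t) *\<^sub>R h t f (x - p))" for t f
  have \<Phi>: "\<Phi> t f x = N (w x) powr t *\<^sub>R spin_act (- (vec_clif (vinv (x - p)) * k)) (f (- v - sandwich k (vinv (x - p))))"
    if "x \<noteq> p" for t f x
  proof -
    have z: "x - p \<noteq> 0" using that by simp
    have "norm (x - p) powr (t - 2 + real CARD('n)) * norm (x - p) powr (2 - real CARD('n)) = norm (x - p) powr t"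
      by (simp flip: powr_add)
    moreover have "N (w x) powr t = N k powr (- t) * norm (x - p) powr t"
      using Nk by (simp add: Nw powr_divide powr_minus_divide)
    ultimately show ?thesis
      unfolding \<Phi>_def h_def P_def J_K_M[OF z] by (simp add: T_def)
  qed
  have D\<Phi>: "(D ^^ (2 * j + 1)) (\<Phi> (2 * real j + 2 - real CARD('n)) f) x =
       \<Phi> (- 2 * real j - real CARD('n)) ((D ^^ (2 * j + 1)) f) x" if f: "smooth_on UNIV f" and x: "x \<noteq> p" for j f x
  proof -
    let ?t = "2 * real j + 2 - real CARD('n)" and ?m = "2 * j + 1"
    have z: "x - p \<noteq> 0" using x by simp
    have sP: "smooth_on (- {0}) (P f)" using smooth_on_subset[OF P(1)[OF f]] by simp
    have "smooth_on (- {0}) (h ?t f)"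
      unfolding h_def by (intro smooth_on_times smooth_on_norm_powr smooth_on_J sP) auto
    then have "(D ^^ ?m) (\<Phi> ?t f) x = N k powr (- ?t) *\<^sub>R (D ^^ ?m) (h ?t f) (x - p)"
      unfolding \<Phi>_def D_funpow_translate[of ?m "\<lambda>z. N k powr (- ?t) *\<^sub>R h ?t f z"]
      using z by (intro D_funpow_scaleR[of "- {0}"]) auto
    also have "h ?t f = (\<lambda>z. norm z powr (2 * real j) *\<^sub>R J (P f) z)" by (simp add: h_def)
    also have "(D ^^ ?m) (\<lambda>z. norm z powr (2 * real j) *\<^sub>R J (P f) z) (x - p) =
        - (norm (x - p) powr (- 2 * real j - 2) *\<^sub>R J ((D ^^ ?m) (P f)) (x - p))"
      by (rule D_odd_inversion[OF sP z])
    \<comment> \<open>The exponent is odd, so the sign of the constant survives and cancels the one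
      from \<open>D_odd_inversion\<close>.\<close>
    also have "J ((D ^^ ?m) (P f)) (x - p) = (- (N k ^ (2 * ?m))) *\<^sub>R J (P ((D ^^ ?m) f)) (x - p)"
    proof -
      have "(- (N k)\<^sup>2) ^ ?m = - (N k ^ (2 * ?m))"
        by (subst power_minus_odd) (simp, simp only: power_mult)
      moreover have "(D ^^ ?m) (P f) = (\<lambda>x. (- (N k)\<^sup>2) ^ ?m *\<^sub>R P ((D ^^ ?m) f) x)"
        by (rule D_funpow_intertwining[of P, OF P f])
      ultimately show ?thesis by (simp only: J_scaleR)
    qed
    also have "N k powr (- ?t) *\<^sub>R - (norm (x - p) powr (- 2 * real j - 2) *\<^sub>R
        ((- (N k ^ (2 * ?m))) *\<^sub>R J (P ((D ^^ ?m) f)) (x - p))) =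
        (N k powr (- ?t) * N k ^ (2 * ?m)) *\<^sub>R norm (x - p) powr (- 2 * real j - 2) *\<^sub>R J (P ((D ^^ ?m) f)) (x - p)"
      by (simp add: mult_ac)
    also have "\<dots> = \<Phi> (- 2 * real j - real CARD('n)) ((D ^^ ?m) f) x"
    proof -
      have e: "- (- 2 * real j - real CARD('n)) = 2 * real j + real CARD('n)"
        "- 2 * real j - real CARD('n) - 2 + real CARD('n) = - 2 * real j - 2" by simp_all
      show ?thesis unfolding powr_power_shift[OF Nk(1)] \<Phi>_def h_def e ..
    qed
    finally show ?thesis .
  qed
  show ?thesis
  proof (intro exI[of _ \<Phi>] conjI ballI allI impI)
    show "open S" unfolding Sp by (rule open_Compl) simp
    fix x assume "x \<in> S"
    then have x: "x \<noteq> p" by (simp add: Sp)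
    show "w x \<in> Gam" by (rule wG[OF x])
    show "\<exists>wi y. w x * wi = 1 \<and> wi * w x = 1 \<and> (- crev g + crev a * vec_clif x) * wi = vec_clif y \<and>
       (\<forall>t f. \<Phi> t f x = N (w x) powr t *\<^sub>R spin_act wi (f y))"
      using inv[OF x] y[OF x] \<Phi>[OF x] by blast
  qed (use D\<Phi> Sp in auto)
qed

end

section \<open>Matrices\<close>

definition cmult :: "('n::{finite,linorder} \<Rightarrow> complex^'m^'m) \<Rightarrow> (real, 'n) vec \<Rightarrow> complex^'m \<Rightarrow> complex^'m" where
  "cmult E x v = (\<Sum>j\<in>UNIV. x $ j *\<^sub>R (E j *v v))"

lemma matrix_vector_scaleR_left: "(r *\<^sub>R (A :: complex^'m^'k)) *v v = r *\<^sub>R (A *v v)"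
  by (simp add: Finite_Cartesian_Product.vec_eq_iff matrix_vector_mult_def scaleR_sum_right)

lemma matrix_vector_scaleR_right: "(A :: complex^'m^'k) *v (r *\<^sub>R v) = r *\<^sub>R (A *v v)"
  by (simp add: Finite_Cartesian_Product.vec_eq_iff matrix_vector_mult_def scaleR_sum_right)

lemma matrix_vector_sum_left: "(\<Sum>i\<in>I. A i :: complex^'m^'k) *v v = (\<Sum>i\<in>I. A i *v v)"
  by (induction I rule: infinite_finite_induct) (auto simp: matrix_vector_mult_add_rdistrib)

lemma matrix_vector_sum_right: "(A :: complex^'m^'k) *v (\<Sum>i\<in>I. v i) = (\<Sum>i\<in>I. A *v v i)"
  by (induction I rule: infinite_finite_induct) (auto simp: matrix_vector_right_distrib)

lemma matrix_inv_eq: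
  fixes A B :: "complex^'m^'m"
  assumes "A ** B = mat 1" "B ** A = mat 1"
  shows "matrix_inv A = B"
proof -
  have "A ** matrix_inv A = mat 1 \<and> matrix_inv A ** A = mat 1"
    unfolding matrix_inv_def by (rule someI[of _ B]) (use assms in auto)
  then show ?thesis by (metis assms(2) matrix_mul_assoc matrix_mul_lid matrix_mul_rid)
qed

lemma of_real_scalar: "complex_of_real r *s v = r *\<^sub>R (v :: complex^'m)"
  by (simp add: Finite_Cartesian_Product.vec_eq_iff) (simp add: scaleR_conv_of_real)

lemma clifford_ops_anticommute:
  assumes "clifford_ops E"
  shows "E i *v (E j *v v) + E j *v (E i *v v) = (if i = j then -2 else 0) *\<^sub>R v"
proof -
  have "(E i ** E j + E j ** E i) *v v = ((if i = j then -2 else 0) *\<^sub>R mat 1) *v v"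
    using assms by (simp add: clifford_ops_def)
  then show ?thesis
    by (simp only: matrix_vector_mult_add_rdistrib matrix_vector_mul_assoc[symmetric] matrix_vector_scaleR_left matrix_vector_mul_lid)
qed

lemma clifford_module_cmult:
  fixes E :: "'n::{finite,linorder} \<Rightarrow> complex^'m^'m"
  assumes "clifford_ops E"
  shows "ordered_clifford_module (cmult E)"
proof -
  have "bilinear (cmult E)"
    unfolding bilinear_def
    by (auto intro!: linearI simp: cmult_def matrix_vector_right_distrib matrix_vector_scaleR_right
        algebra_simps sum.distrib scaleR_sum_right)
  then have bb: "bounded_bilinear (cmult E)" by (simp add: bilinear_conv_bounded_bilinear)
  have "cmult E x (cmult E x v) = - ((x \<bullet> x) *\<^sub>R v)" for x v
  proof -
    let ?Q = "\<Sum>i\<in>UNIV. \<Sum>j\<in>UNIV. (x $ i * x $ j) *\<^sub>R (E i *v (E j *v v))"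
    have Q: "cmult E x (cmult E x v) = ?Q"
      by (simp add: cmult_def matrix_vector_sum_right matrix_vector_scaleR_right scaleR_sum_right)
    have Q': "?Q = (\<Sum>i\<in>UNIV. \<Sum>j\<in>UNIV. (x $ i * x $ j) *\<^sub>R (E j *v (E i *v v)))"
      by (subst sum.swap) (simp add: mult.commute)
    \<comment> \<open>Doubling symmetrises in i and j, so that only the diagonal terms
      survive.\<close>
    have "?Q + ?Q = (\<Sum>i\<in>UNIV. \<Sum>j\<in>UNIV. (x $ i * x $ j) *\<^sub>R (E i *v (E j *v v) + E j *v (E i *v v)))"
      by (subst (2) Q') (simp only: sum.distrib scaleR_add_right)
    also have "\<dots> = (\<Sum>i\<in>UNIV. \<Sum>j\<in>UNIV. if j = i then (- 2 * (x $ i * x $ i)) *\<^sub>R v else 0)"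
      by (intro sum.cong refl) (simp add: clifford_ops_anticommute[OF assms])
    also have "\<dots> = (\<Sum>i\<in>UNIV. (- 2 * (x $ i * x $ i)) *\<^sub>R v)" by simp
    also have "\<dots> = 2 *\<^sub>R (- ((x \<bullet> x) *\<^sub>R v))"
      by (simp add: inner_vec_def scaleR_sum_left[symmetric] sum_distrib_left[symmetric] sum_negf)
    finally have "2 *\<^sub>R ?Q = 2 *\<^sub>R (- ((x \<bullet> x) *\<^sub>R v))" by (simp only: scaleR_2)
    then have "(1/2) *\<^sub>R (2 *\<^sub>R ?Q) = (1/2) *\<^sub>R (2 *\<^sub>R (- ((x \<bullet> x) *\<^sub>R v)))"
      by (rule arg_cong)
    then have "?Q = - ((x \<bullet> x) *\<^sub>R v)" by (simp only: scaleR_scaleR) simp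
    then show ?thesis unfolding Q .
  qed
  with bb show ?thesis
    by (intro ordered_clifford_module.intro clifford_module.intro clifford_module_axioms.intro)
qed

lemma cmult_axis: "cmult E (axis j 1) v = E j *v v"
  by (simp add: cmult_def axis_def if_distrib[of "\<lambda>r. r *\<^sub>R _"] cong: if_cong)

lemma smooth_compact_support_smooth_on: "smooth_compact_support f \<Longrightarrow> smooth_on UNIV f"
  unfolding smooth_compact_support_def smooth_on_def
  by (metis Ck_imp_kdiff kdiff_Suc_imp)

theorem mainTheorem12:
  fixes E :: "'n::{finite,linorder} \<Rightarrow> complex^'m^'m"
    and k :: nat
    and a b c d :: "'n cl"
    and f :: "(real, 'n) vec \<Rightarrow> complex^'m"
  assumes "CARD('n) \<ge> 2"
    and "clifford_ops E"
    and "(a, b, c, d) \<in> SL2_Gamma"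
    and "smooth_compact_support f"
    and "cl_sub (cl_rev d) (cl_mult (cl_rev b) (vec_to_cl x)) \<noteq> (\<lambda>_. 0)"
  shows "(dirac E ^^ (2 * k + 1)) (pi' E (- of_nat k - 1 / 2) (a, b, c, d) f) x
       = pi' E (of_nat k + 1 / 2) (a, b, c, d) ((dirac E ^^ (2 * k + 1)) f) x"
proof -
  interpret m: ordered_clifford_module "cmult E"
    by (rule clifford_module_cmult[OF assms(2)])
  have dirac: "dirac E = m.D"
    by (intro ext) (simp add: dirac_def m.D_def cmult_axis)
  have foldr_gen_act: "foldr (\<lambda>j M. (E cl_e1 ** E j) ** M) xs (mat 1) *v v = foldr m.gen_act xs v" for xs v
    by (induction xs) (simp_all add: m.gen_act_def cmult_axis matrix_vector_mul_assoc[symmetric])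
  have tau': "tau' E (Rep_clif e) *v v = m.spin_act e v" for e v
    by (simp add: tau'_def tau_def m.spin_act_def m.clif_act_def m.monom_act_def matrix_vector_sum_left matrix_vector_scaleR_left
        foldr_gen_act cprin.rep_eq)
  have typed: "\<exists>e. u = Rep_clif e \<and> e \<in> Gam \<union> {0}" if "u \<in> clifford_group \<union> {\<lambda>_. 0}" for u :: "'n cl"
    using that unfolding clifford_group_Gam by (auto intro: exI[of _ 0] simp: zero_clif.rep_eq)
  obtain A B G \<Delta> where ABGD: "a = Rep_clif A" "b = Rep_clif B" "c = Rep_clif G" "d = Rep_clif \<Delta>"
    "A \<in> Gam \<union> {0}" "B \<in> Gam \<union> {0}" "G \<in> Gam \<union> {0}" "\<Delta> \<in> Gam \<union> {0}"
    using assms(3) typed unfolding SL2_Gamma_def by clarify meson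
  note rep = times_clif.rep_eq minus_clif.rep_eq plus_clif.rep_eq uminus_clif.rep_eq one_clif.rep_eq zero_clif.rep_eq
    crev.rep_eq vec_clif.rep_eq scaleR_clif.rep_eq
  have det: "A * crev \<Delta> - B * crev G = 1"
    using assms(3) by (simp add: SL2_Gamma_def ABGD rep flip: Rep_clif_inject)
  obtain u1 where u1: "A * crev B = vec_clif u1"
    using assms(3) by (auto simp: SL2_Gamma_def ABGD cl_vectors_def rep simp flip: Rep_clif_inject)
  obtain u2 where u2: "G * crev \<Delta> = vec_clif u2"
    using assms(3) by (auto simp: SL2_Gamma_def ABGD cl_vectors_def rep simp flip: Rep_clif_inject)
  define w where "w x = crev \<Delta> - crev B * vec_clif x" for x
  define S where "S = {x. w x \<noteq> 0}"
  obtain \<Phi> where S: "open S"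
    and \<Phi>: "\<And>x. x \<in> S \<Longrightarrow> w x \<in> Gam \<and> (\<exists>wi y. w x * wi = 1 \<and> wi * w x = 1 \<and> (- crev G + crev A * vec_clif x) * wi = vec_clif y \<and>
       (\<forall>t f. \<Phi> t f x = N (w x) powr t *\<^sub>R m.spin_act wi (f y)))"
    and D\<Phi>: "\<And>k f x. smooth_on UNIV f \<Longrightarrow> x \<in> S \<Longrightarrow> (m.D ^^ (2 * k + 1)) (\<Phi> (2 * real k + 2 - real CARD('n)) f) x =
       \<Phi> (- 2 * real k - real CARD('n)) ((m.D ^^ (2 * k + 1)) f) x"
    using m.intertwining[OF ABGD(5-8) det u1 u2] unfolding w_def[symmetric] S_def[symmetric] by metis
  \<comment> \<open>The extra 1 in the exponent is the factor |w| from inverting \<open>tau'\<close>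
    at w / |w|.\<close>
  have pi_eq: "pi' E (of_real \<mu>) (a, b, c, d) h y = \<Phi> (- 2 * \<mu> - real CARD('n) + 1) h y" if y: "y \<in> S" for \<mu> h y
  proof -
    obtain wi z where wG: "w y \<in> Gam" and inv: "w y * wi = 1" "wi * w y = 1"
      and z: "(- crev G + crev A * vec_clif y) * wi = vec_clif z"
      and \<Phi>y: "\<And>t f. \<Phi> t f y = N (w y) powr t *\<^sub>R m.spin_act wi (f z)"
      using \<Phi>[OF y] by blast
    have N: "N (w y) > 0" by (rule cl_norm_Gam_pos[OF wG])
    have w: "cl_sub (cl_rev d) (cl_mult (cl_rev b) (vec_to_cl y)) = Rep_clif (w y)"
      by (simp add: w_def ABGD rep)
    have w0: "Rep_clif (w y) \<noteq> (\<lambda>_. 0)"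
      using Gam_nonzero[OF wG] by (simp flip: zero_clif.rep_eq add: Rep_clif_inject)
    have num: "cl_to_vec (cl_mult (cl_add (cl_neg (cl_rev c)) (cl_mult (cl_rev a) (vec_to_cl y))) (cl_inv (Rep_clif (w y)))) = z"
      unfolding cl_inv_Rep[OF inv] using arg_cong[OF z, of "\<lambda>e. cl_to_vec (Rep_clif e)"]
      unfolding cl_to_vec_vec by (simp only: ABGD rep)
    let ?M = "tau' E (cl_scale (1 / N (w y)) (Rep_clif (w y)))" and ?M' = "N (w y) *\<^sub>R tau' E (Rep_clif wi)"
    have M: "?M *v v = (1 / N (w y)) *\<^sub>R m.spin_act (w y) v" for v
      using tau'[of "(1 / N (w y)) *\<^sub>R w y" v] by (simp add: rep m.spin_act_scaleR)
    have M': "?M' *v v = N (w y) *\<^sub>R m.spin_act wi v" for v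
      by (simp add: matrix_vector_scaleR_left tau')
    have wiG: "wi \<in> Gam" by (rule Gam_inverse_unique(1)[OF wG inv(1)])
    have "m.spin_act (w y) (m.spin_act wi v) = v" "m.spin_act wi (m.spin_act (w y) v) = v" for v
      using m.spin_act_Gam_mult[OF wG, of wi v] m.spin_act_Gam_mult[OF wiG, of "w y" v] by (simp_all add: inv m.spin_act_one)
    then have "?M ** ?M' = mat 1" "?M' ** ?M = mat 1"
      unfolding matrix_eq matrix_vector_mul_assoc[symmetric] M M' m.spin_act_scaleR_right using N by simp_all
    then have Minv: "matrix_inv ?M = ?M'" by (rule matrix_inv_eq)
    have e: "- 2 * complex_of_real \<mu> - of_nat CARD('n) = of_real (- 2 * \<mu> - real CARD('n))" by simp
    have "pi' E (of_real \<mu>) (a, b, c, d) h y = N (w y) powr (- 2 * \<mu> - real CARD('n)) *\<^sub>R N (w y) *\<^sub>R m.spin_act wi (h z)"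
      unfolding pi'_def prod.case Let_def w if_not_P[OF w0] num Minv M' e powr_of_real[OF less_imp_le[OF N]] of_real_scalar ..
    also have "\<dots> = N (w y) powr (- 2 * \<mu> - real CARD('n) + 1) *\<^sub>R m.spin_act wi (h z)"
      using N by (simp add: powr_add)
    finally show ?thesis by (simp only: \<Phi>y)
  qed
  have x: "x \<in> S"
  proof -
    have "Rep_clif (w x) \<noteq> Rep_clif 0" using assms(5) by (simp add: w_def ABGD rep)
    then show ?thesis by (auto simp: S_def)
  qed
  have f: "smooth_on UNIV f" by (rule smooth_compact_support_smooth_on[OF assms(4)])
  have mu: "- of_nat k - 1 / 2 = complex_of_real (- real k - 1 / 2)" "of_nat k + 1 / 2 = complex_of_real (real k + 1 / 2)"
    by simp_all
  have t: "- 2 * (- real k - 1 / 2) - real CARD('n) + 1 = 2 * real k + 2 - real CARD('n)"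
    "- 2 * (real k + 1 / 2) - real CARD('n) + 1 = - 2 * real k - real CARD('n)" by simp_all
  have "(m.D ^^ (2 * k + 1)) (pi' E (of_real (- real k - 1 / 2)) (a, b, c, d) f) x =
    (m.D ^^ (2 * k + 1)) (\<Phi> (2 * real k + 2 - real CARD('n)) f) x"
    \<comment> \<open>The two fields are known to agree only on S; since S is open, so do all their
      derivatives at x.\<close>
    by (rule m.D_funpow_cong[OF S _ x]) (simp only: pi_eq t)
  also have "\<dots> = pi' E (of_real (real k + 1 / 2)) (a, b, c, d) ((m.D ^^ (2 * k + 1)) f) x"
    by (simp only: D\<Phi>[OF f x] pi_eq[OF x] t)
  finally show ?thesis unfolding dirac mu .
qed

end
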